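(* Let $\mathcal{M},\mathcal{N},\mathcal{L}$ be diffeological étale manifolds and let $f:\mathcal{M}\times\mathcal{N}\to\mathcal{L}$ be a smooth map. For $x\in\mathcal{M}$ define $f^x:\mathcal{N}\to\mathcal{L}$ by $f^x(y)=f(x,y)$. Then the following are equivalent: (1) for every $(x,y)\in\mathcal{M}\times\mathcal{N}$, the internal tangent map $d(f^x)_y:T_y\mathcal{N}\to T_{f(x,y)}\mathcal{L}$ is an isomorphism; (2) the track map $(\mathrm{Pr}_1,f):\mathcal{M}\times\mathcal{N}\to\mathcal{M}\times\mathcal{L}$, $(x,y)\mapsto(x,f(x,y))$, is a diffeological étale map.
   Context: An $n$-domain is an open subset of $\mathbb{R}^n$; a domain is an $n$-domain for some $n\ge 0$. A parametrization in a set $X$ is a map from a domain to $X$. A diffeology on $X$ is a set $\mathcal{D}$ of parametrizations in $X$ such that: (D1) the images of the elements of $\mathcal{D}$ cover $X$; (D2) $P\circ F\in\mathcal{D}$ for every $P:U\to X$ in $\mathcal{D}$ and every smooth map $F:V\to U$ between domains; (D3) if a family of $n$-parametrizations $P_i:U_i\to X$ in $\mathcal{D}$ agree on overlaps, their common extension to $\bigcup_i U_i$ is in $\mathcal{D}$. A diffeological space is a set with a diffeology, whose elements are called plots. A map $f:X\to Y$ is smooth if $f\circ P$ is a plot in $Y$ for every plot $P$ in $X$; a diffeomorphism is a smooth bijection with smooth inverse. A subset of $X$ is D-open if its preimage under every plot is open. Subsets carry the subspace diffeology (plots with values in the subset), and products carry the product diffeology (plots are the tuples of plots). Domains carry their usual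 smooth parametrizations as plots. For smooth maps $f:X\to Y$ and $g:Z\to Y$, the pullback of $f$ by $g$ is $g^*f:g^*X\to Z$, $(z,x)\mapsto z$, where $g^*X=\{(z,x)\in Z\times X: g(z)=f(x)\}$. Internal tangent space: for $x\in X$, consider the category whose objects are the plots $P:U\to X$ with $0\in U$ and $P(0)=x$ (plots centered at $x$), and whose morphisms from $Q:V\to X$ to $P:U\to X$ are the germs at $0$ of smooth maps $F:W\to U$, $W\subseteq V$ an open neighborhood of $0$, with $F(0)=0$ and $Q|_W=P\circ F$. The internal tangent space $T_xX$ is the colimit in real vector spaces of the functor sending $P:U\to X$ to $T_0U$ and the germ of $F$ to $dF_0$; write $dP_0:T_0U\to T_xX$ for the structure maps. For smooth $f:X\to Y$, the internal tangent map $df_x:T_xX\to T_{f(x)}Y$ is the unique linear map with $df_x\circ dP_0=d(f\circ P)_0$ for every plot $P$ centered at $x$. Étale map: a map $f:X\to Y$ such that every $x_0\in X$ has a D-open neighborhood $O\subseteq X$, and $f(x_0)$ a D-open neighborhood $O'\subseteq Y$, with $f|_O:O\to O'$ a diffeomorphism. Diffeological étale map: a smooth map whose pullback by every plot in the target is étale. Diffeological étale $n$-manifold: a diffeological space $\mathcal{M}$ admitting a family of diffeological étale maps from $n$-domains into $\mathcal{M}$ (diffeological étale charts) whose images cover $\mathcal{M}$. A diffeological étale manifold is a diffeological étale $n$-manifold for some $n$. *)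

theory Defs
  imports "HOL-Analysis.Analysis" "HOL-Analysis.Finite_Function_Topology"
begin

section \<open>Domains and smooth maps between them\<close>

text \<open>
  The dimension of a plot varies within a single diffeology, so \<open>\<real>\<^sup>n\<close> is taken to be the topological
  space \<^const>\<open>Euclidean_space\<close> \<open>n\<close>, whose points are the \<open>x :: nat \<Rightarrow> real\<close> with \<open>x i = 0\<close> for all
  \<open>i \<ge> n\<close>. As these sets of points are nested, the dimension always has to be carried along with a
  domain.
\<close>

abbreviation Rn :: "nat \<Rightarrow> (nat \<Rightarrow> real) set"
  where "Rn n \<equiv> topspace (Euclidean_space n)"

definition origin :: "nat \<Rightarrow> real"
  where "origin = (\<lambda>i. 0)"

definition n_domain :: "nat \<Rightarrow> (nat \<Rightarrow> real) set \<Rightarrow> bool"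
  where "n_domain n U \<longleftrightarrow> openin (Euclidean_space n) U"

definition partial :: "nat \<Rightarrow> ((nat \<Rightarrow> real) \<Rightarrow> real) \<Rightarrow> (nat \<Rightarrow> real) \<Rightarrow> real"
  where "partial i f x = deriv (\<lambda>t. f (x(i := t))) (x i)"

text \<open>
  \<open>Ck k n U f\<close>: all iterated partial derivatives of \<open>f\<close> of order at most \<open>k\<close> exist and are
  continuous on the \<open>n\<close>-domain \<open>U\<close>.
\<close>

fun Ck :: "nat \<Rightarrow> nat \<Rightarrow> (nat \<Rightarrow> real) set \<Rightarrow> ((nat \<Rightarrow> real) \<Rightarrow> real) \<Rightarrow> bool" where
  "Ck 0 n U f \<longleftrightarrow> continuous_map (subtopology (Euclidean_space n) U) euclideanreal f"
| "Ck (Suc k) n U f \<longleftrightarrow> continuous_map (subtopology (Euclidean_space n) U) euclideanreal f \<and>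
     (\<forall>i<n. (\<forall>x\<in>U. (\<lambda>t. f (x(i := t))) field_differentiable at (x i)) \<and> Ck k n U (partial i f))"

definition smooth_domain_map ::
    "nat \<Rightarrow> (nat \<Rightarrow> real) set \<Rightarrow> nat \<Rightarrow> (nat \<Rightarrow> real) set \<Rightarrow> ((nat \<Rightarrow> real) \<Rightarrow> nat \<Rightarrow> real) \<Rightarrow> bool"
  where "smooth_domain_map m V n U F \<longleftrightarrow>
    n_domain m V \<and> n_domain n U \<and> F \<in> V \<rightarrow> U \<and> (\<forall>j<n. \<forall>k. Ck k m V (\<lambda>x. F x j))"

text \<open>\<open>differential m F x\<close> is the linear map given by the Jacobian matrix of \<open>F\<close> at \<open>x \<in> \<real>\<^sup>m\<close>.\<close>

definition differential ::
    "nat \<Rightarrow> ((nat \<Rightarrow> real) \<Rightarrow> nat \<Rightarrow> real) \<Rightarrow> (nat \<Rightarrow> real) \<Rightarrow> (nat \<Rightarrow> real) \<Rightarrow> nat \<Rightarrow> real"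
  where "differential m F x v = (\<lambda>j. \<Sum>i<m. partial i (\<lambda>y. F y j) x * v i)"


section \<open>Diffeological spaces\<close>

text \<open>
  A parametrization \<open>P : U \<rightarrow> X\<close> of dimension \<open>n\<close> is the triple \<open>(n, U, P)\<close>, with \<open>P\<close> normalised to
  \<^const>\<open>undefined\<close> outside \<open>U\<close>, so that equal maps give equal triples.
\<close>

type_synonym 'a param = "nat \<times> (nat \<Rightarrow> real) set \<times> ((nat \<Rightarrow> real) \<Rightarrow> 'a)"

definition parametrizations :: "'a set \<Rightarrow> 'a param set"
  where "parametrizations X = {(n, U, P). n_domain n U \<and> P \<in> U \<rightarrow>\<^sub>E X}"

definition diffeology :: "'a set \<Rightarrow> 'a param set \<Rightarrow> bool"
  where "diffeology X D \<longleftrightarrow>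
    D \<subseteq> parametrizations X \<and>
    (\<Union>(n, U, P)\<in>D. P ` U) = X \<and>
    (\<forall>n U P m V F. (n, U, P) \<in> D \<longrightarrow> smooth_domain_map m V n U F \<longrightarrow> (m, V, compose V P F) \<in> D) \<and>
    (\<forall>n \<F> R. (\<forall>(U, P)\<in>\<F>. (n, U, P) \<in> D) \<longrightarrow>
       (\<forall>(U, P)\<in>\<F>. \<forall>(V, Q)\<in>\<F>. \<forall>r\<in>U \<inter> V. P r = Q r) \<longrightarrow>
       R \<in> extensional (\<Union>(U, P)\<in>\<F>. U) \<longrightarrow> (\<forall>(U, P)\<in>\<F>. \<forall>r\<in>U. R r = P r) \<longrightarrow>
       (n, (\<Union>(U, P)\<in>\<F>. U), R) \<in> D)"

record 'a dspace =
  points :: "'a set"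
  plots :: "'a param set"

definition diffeological_space :: "'a dspace \<Rightarrow> bool"
  where "diffeological_space X \<longleftrightarrow> diffeology (points X) (plots X)"

definition dsmooth :: "'a dspace \<Rightarrow> 'b dspace \<Rightarrow> ('a \<Rightarrow> 'b) \<Rightarrow> bool"
  where "dsmooth X Y f \<longleftrightarrow> f \<in> points X \<rightarrow> points Y \<and>
    (\<forall>(n, U, P)\<in>plots X. (n, U, compose U f P) \<in> plots Y)"

definition diffeomorphism :: "'a dspace \<Rightarrow> 'b dspace \<Rightarrow> ('a \<Rightarrow> 'b) \<Rightarrow> bool"
  where "diffeomorphism X Y f \<longleftrightarrow> bij_betw f (points X) (points Y) \<and> dsmooth X Y f \<and>
    dsmooth Y X (inv_into (points X) f)"

definition D_open :: "'a dspace \<Rightarrow> 'a set \<Rightarrow> bool"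
  where "D_open X A \<longleftrightarrow> A \<subseteq> points X \<and> (\<forall>(n, U, P)\<in>plots X. n_domain n {r \<in> U. P r \<in> A})"

definition subspace_of :: "'a dspace \<Rightarrow> 'a set \<Rightarrow> 'a dspace"
  where "subspace_of X A = \<lparr>points = A, plots = {(n, U, P) \<in> plots X. P ` U \<subseteq> A}\<rparr>"

definition prod_dspace :: "'a dspace \<Rightarrow> 'b dspace \<Rightarrow> ('a \<times> 'b) dspace"
  where "prod_dspace X Y = \<lparr>points = points X \<times> points Y,
    plots = {(n, U, \<lambda>r\<in>U. (P r, Q r)) | n U P Q. (n, U, P) \<in> plots X \<and> (n, U, Q) \<in> plots Y}\<rparr>"

definition domain_dspace :: "nat \<Rightarrow> (nat \<Rightarrow> real) set \<Rightarrow> (nat \<Rightarrow> real) dspace"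
  where "domain_dspace n U = \<lparr>points = U,
    plots = {(m, V, F). F \<in> extensional V \<and> smooth_domain_map m V n U F}\<rparr>"


section \<open>Etale maps and diffeological etale manifolds\<close>

definition pullback_dspace ::
    "'z dspace \<Rightarrow> 'x dspace \<Rightarrow> ('z \<Rightarrow> 'y) \<Rightarrow> ('x \<Rightarrow> 'y) \<Rightarrow> ('z \<times> 'x) dspace"
  where "pullback_dspace Z X g f =
    subspace_of (prod_dspace Z X) {(z, x) \<in> points Z \<times> points X. g z = f x}"

definition etale :: "'a dspace \<Rightarrow> 'b dspace \<Rightarrow> ('a \<Rightarrow> 'b) \<Rightarrow> bool"
  where "etale X Y f \<longleftrightarrow> f \<in> points X \<rightarrow> points Y \<and>
    (\<forall>x\<in>points X. \<exists>A B. D_open X A \<and> x \<in> A \<and> D_open Y B \<and> f x \<in> B \<and>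
       diffeomorphism (subspace_of X A) (subspace_of Y B) f)"

definition diffeological_etale :: "'a dspace \<Rightarrow> 'b dspace \<Rightarrow> ('a \<Rightarrow> 'b) \<Rightarrow> bool"
  where "diffeological_etale X Y f \<longleftrightarrow> dsmooth X Y f \<and>
    (\<forall>(n, U, P)\<in>plots Y.
       etale (pullback_dspace (domain_dspace n U) X P f) (domain_dspace n U) fst)"

definition etale_n_manifold :: "nat \<Rightarrow> 'a dspace \<Rightarrow> bool"
  where "etale_n_manifold n M \<longleftrightarrow> diffeological_space M \<and>
    (\<exists>\<A>. (\<forall>(U, \<phi>)\<in>\<A>. n_domain n U \<and> diffeological_etale (domain_dspace n U) M \<phi>) \<and>
         (\<Union>(U, \<phi>)\<in>\<A>. \<phi> ` U) = points M)"

definition etale_manifold :: "'a dspace \<Rightarrow> bool"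
  where "etale_manifold M \<longleftrightarrow> (\<exists>n. etale_n_manifold n M)"


section \<open>Internal tangent spaces\<close>

definition centered_plots :: "'a dspace \<Rightarrow> 'a \<Rightarrow> 'a param set"
  where "centered_plots X x = {(n, U, P) \<in> plots X. origin \<in> U \<and> P origin = x}"

text \<open>
  \<open>plot_morphism q p W F\<close>: the map \<open>F\<close> on \<open>W\<close> represents a morphism from the centered plot \<open>q\<close> to
  the centered plot \<open>p\<close>. Passing to germs is not needed here, since the differential at the origin
  depends only on the germ.
\<close>

fun plot_morphism ::
    "'a param \<Rightarrow> 'a param \<Rightarrow> (nat \<Rightarrow> real) set \<Rightarrow> ((nat \<Rightarrow> real) \<Rightarrow> nat \<Rightarrow> real) \<Rightarrow> bool"
  where "plot_morphism (m, V, Q) (n, U, P) W F \<longleftrightarrow> smooth_domain_map m W n U F \<and>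
    W \<subseteq> V \<and> origin \<in> W \<and> F origin = origin \<and> (\<forall>r\<in>W. Q r = P (F r))"

text \<open>
  The colimit is the quotient of the direct sum of the spaces \<open>T\<^sub>0 U = \<real>\<^sup>n\<close>, over all plots
  \<open>(n, U, P)\<close> centered at \<open>x\<close>, by the subspace spanned by the vectors identifying \<open>v \<in> T\<^sub>0 V\<close> with
  its image under each morphism. The direct sum has basis vectors \<open>(p, i)\<close>, where \<open>p\<close> is a centered
  plot and \<open>i\<close> is less than its dimension; \<open>summand p\<close> is the inclusion of the summand of \<open>p\<close>.
\<close>

type_synonym 'a tangent_rep = "('a param \<times> nat, real) poly_mapping"

type_synonym 'a tangent = "'a tangent_rep set"

definition tangent_sum :: "'a dspace \<Rightarrow> 'a \<Rightarrow> 'a tangent_rep set"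
  where "tangent_sum X x =
    {\<xi>. Poly_Mapping.keys \<xi> \<subseteq> {(p, i). p \<in> centered_plots X x \<and> i < fst p}}"

definition summand :: "'a param \<Rightarrow> (nat \<Rightarrow> real) \<Rightarrow> 'a tangent_rep"
  where "summand p v = (\<Sum>i<fst p. Poly_Mapping.single (p, i) (v i))"

definition tangent_relations :: "'a dspace \<Rightarrow> 'a \<Rightarrow> 'a tangent_rep set"
  where "tangent_relations X x = span
    {summand q v - summand p (differential (fst q) F origin v) | p q W F v.
       p \<in> centered_plots X x \<and> q \<in> centered_plots X x \<and> plot_morphism q p W F \<and> v \<in> Rn (fst q)}"

definition tangent_class :: "'a dspace \<Rightarrow> 'a \<Rightarrow> 'a tangent_rep \<Rightarrow> 'a tangent"
  where "tangent_class X x \<xi> = {\<xi> + \<rho> | \<rho>. \<rho> \<in> tangent_relations X x}"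

definition tangent_space :: "'a dspace \<Rightarrow> 'a \<Rightarrow> 'a tangent set"
  where "tangent_space X x = tangent_class X x ` tangent_sum X x"

definition tangent_add :: "'a tangent \<Rightarrow> 'a tangent \<Rightarrow> 'a tangent"
  where "tangent_add A B = {\<xi> + \<eta> | \<xi> \<eta>. \<xi> \<in> A \<and> \<eta> \<in> B}"

text \<open>Adding the relations matters only for \<open>c = 0\<close>.\<close>

definition tangent_scale :: "'a dspace \<Rightarrow> 'a \<Rightarrow> real \<Rightarrow> 'a tangent \<Rightarrow> 'a tangent"
  where "tangent_scale X x c A = {c *\<^sub>R \<xi> + \<rho> | \<xi> \<rho>. \<xi> \<in> A \<and> \<rho> \<in> tangent_relations X x}"

text \<open>The structure map \<open>dP\<^sub>0 : T\<^sub>0 U \<rightarrow> T\<^sub>x X\<close> of the colimit, for \<open>p = (n, U, P)\<close>.\<close>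

definition dplot :: "'a dspace \<Rightarrow> 'a \<Rightarrow> 'a param \<Rightarrow> (nat \<Rightarrow> real) \<Rightarrow> 'a tangent"
  where "dplot X x p v = tangent_class X x (summand p v)"

definition tangent_linear ::
    "'a dspace \<Rightarrow> 'a \<Rightarrow> 'b dspace \<Rightarrow> 'b \<Rightarrow> ('a tangent \<Rightarrow> 'b tangent) \<Rightarrow> bool"
  where "tangent_linear X x Y y T \<longleftrightarrow> T \<in> tangent_space X x \<rightarrow> tangent_space Y y \<and>
    (\<forall>A\<in>tangent_space X x. \<forall>B\<in>tangent_space X x.
       T (tangent_add A B) = tangent_add (T A) (T B)) \<and>
    (\<forall>c. \<forall>A\<in>tangent_space X x. T (tangent_scale X x c A) = tangent_scale Y y c (T A))"

definition tangent_iso ::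
    "'a dspace \<Rightarrow> 'a \<Rightarrow> 'b dspace \<Rightarrow> 'b \<Rightarrow> ('a tangent \<Rightarrow> 'b tangent) \<Rightarrow> bool"
  where "tangent_iso X x Y y T \<longleftrightarrow>
    tangent_linear X x Y y T \<and> bij_betw T (tangent_space X x) (tangent_space Y y)"

definition tangent_map :: "'a dspace \<Rightarrow> 'b dspace \<Rightarrow> ('a \<Rightarrow> 'b) \<Rightarrow> 'a \<Rightarrow> 'a tangent \<Rightarrow> 'b tangent"
  where "tangent_map X Y f x = (THE T. T \<in> extensional (tangent_space X x) \<and>
    tangent_linear X x Y (f x) T \<and>
    (\<forall>(n, U, P)\<in>centered_plots X x. \<forall>v\<in>Rn n.
       T (dplot X x (n, U, P) v) = dplot Y (f x) (n, U, compose U f P) v))"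

end

theory Submission
  imports Defs
begin

text \<open>
  A smooth map is diffeological etale iff every plot of the target lifts locally through any given
  point of the source, and two lifts of the same plot that agree at a point agree near it. Hence a
  chart \<open>\<phi>\<close> of an etale manifold identifies the internal tangent space with \<open>\<real>\<^sup>n\<close>: a plot through
  the base point of \<open>\<phi>\<close> factors through \<open>\<phi>\<close> by a unique germ, and the differential of that germ
  inverts \<open>d\<phi>\<^sub>0\<close>. So \<open>d(f\<^sup>x)\<^sub>y\<close> is an isomorphism iff a representative \<open>h\<close> of \<open>f\<^sup>x\<close> in charts has
  bijective differential.

  If this holds everywhere, let \<open>F\<close> represent \<open>(w, u) \<mapsto> f (P w, \<phi> u)\<close> in a chart of the target and
  let \<open>q\<close> represent a plot \<open>Q\<close>. By the implicit function theorem \<open>F (w, u) = q w\<close> has locally a unique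
  solution \<open>u\<close>, smooth in \<open>w\<close>, and this is a lift of the plot \<open>(P, Q)\<close> through the track map; the
  uniqueness of lifts follows in the same way. Conversely, lifting \<open>(x, \<psi>)\<close> through the track map, for
  a chart \<open>\<psi>\<close> of the target, gives a local inverse of \<open>h\<close>.
\<close>

section \<open>Domains in coordinates\<close>

text \<open>Plots of every dimension occur at once, so all points live in
  \<open>nat \<Rightarrow> real\<close> and smoothness means iterated partial derivatives.
  Differentiability is used in slope form: \<open>f y - f x\<close> is the sum of the
  \<open>a i y * (y i - x i)\<close>, with \<open>a i\<close> continuous at \<open>x\<close>. A
  curve that is merely continuous may be substituted into this identity, and that is how the
  implicit function acquires its derivative.

  The target of the track map is tested by plots \<open>(P, Q)\<close> with \<open>P\<close> an
  arbitrary plot of \<open>M\<close>. The equation to be solved therefore has its parameters in the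
  domain of \<open>P\<close>, of arbitrary dimension \<open>p\<close>, and not in a chart of
  \<open>M\<close>.

  Two obstacles shape the rest. Charts need not be injective, so an equality of points becomes an
  equality of representatives only through uniqueness of lifts, near a point where the
  representatives already agree. And the dimensions \<open>n\<close> and \<open>l\<close> of the
  charts of \<open>N\<close> and \<open>L\<close> are unrelated a priori, so invertibility of a
  differential is recorded by conditions that make sense for rectangular matrices.\<close>

lemma Rn_iff: "x \<in> Rn n \<longleftrightarrow> (\<forall>i\<ge>n. x i = 0)"
  by (simp add: topspace_Euclidean_space)

lemma origin_Rn [simp]: "origin \<in> Rn n"
  by (simp add: Rn_iff origin_def)

lemma Rn_upd: "x \<in> Rn n \<Longrightarrow> i < n \<Longrightarrow> x(i := t) \<in> Rn n"
  by (simp add: Rn_iff)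

lemma Rn_eqI: "x \<in> Rn n \<Longrightarrow> y \<in> Rn n \<Longrightarrow> (\<And>i. i < n \<Longrightarrow> x i = y i) \<Longrightarrow> x = y"
  by (rule ext) (metis Rn_iff not_le)

text \<open>Open balls of the sup-norm on the first \<open>n\<close> coordinates. They reduce the
  product topology on \<open>Rn n\<close> to finitely many inequalities; for \<open>n = 0\<close>
  the cube is the single point of \<open>Rn 0\<close>, whatever \<open>d\<close> is.\<close>

definition cube :: "nat \<Rightarrow> (nat \<Rightarrow> real) \<Rightarrow> real \<Rightarrow> (nat \<Rightarrow> real) set"
  where "cube n x d = {y \<in> Rn n. \<forall>i<n. \<bar>y i - x i\<bar> < d}"

lemma Euclidean_space_eq: "Euclidean_space n = top_of_set (Rn n)"
  unfolding topspace_Euclidean_space by (simp only: Euclidean_space_def euclidean_product_topology)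

lemma n_domain_openin: "n_domain n U \<longleftrightarrow> openin (top_of_set (Rn n)) U"
  unfolding n_domain_def by (subst Euclidean_space_eq) (rule refl)

lemma n_domain_open: "n_domain n U \<longleftrightarrow> (\<exists>T. open T \<and> U = Rn n \<inter> T)"
  by (simp add: n_domain_openin openin_open)

lemma n_domain_subset: "n_domain n U \<Longrightarrow> U \<subseteq> Rn n"
  by (auto simp: n_domain_open)

lemma n_domain_RnD: "n_domain n U \<Longrightarrow> x \<in> U \<Longrightarrow> x \<in> Rn n"
  using n_domain_subset by blast

lemma n_domain_Rn [simp]: "n_domain n (Rn n)"
  by (simp add: n_domain_def)

lemma n_domain_Int: "n_domain n U \<Longrightarrow> n_domain n V \<Longrightarrow> n_domain n (U \<inter> V)"
  by (auto simp: n_domain_def)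

text \<open>Taking the minimum turns one radius per coordinate into one radius for a whole
  cube.\<close>

lemma exists_common_radius:
  assumes "\<And>i. i < n \<Longrightarrow> \<exists>d>0. P i d" and mono: "\<And>i d d'. i < n \<Longrightarrow> P i d \<Longrightarrow> 0 < d' \<Longrightarrow> d' \<le> d \<Longrightarrow> P i d'"
  shows "\<exists>d>(0::real). \<forall>i<(n::nat). P i d"
  using assms
proof (induction n)
  case 0 show ?case by (auto intro: exI[of _ 1])
next
  case (Suc n)
  then obtain d where d: "d > 0" "\<forall>i<n. P i d" by (metis less_Suc_eq)
  obtain e where e: "e > 0" "P n e" using Suc.prems(1) by blast
  have "\<forall>i<Suc n. P i (min d e)"
    using d e Suc.prems(2) by (auto simp: less_Suc_eq)
  then show ?case using d(1) e(1) by (intro exI[of _ "min d e"]) simp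
qed

lemma open_cube: "open {y :: nat \<Rightarrow> real. \<forall>i<n. \<bar>y i - x i\<bar> < d}"
proof -
  have "open (\<Inter>i\<in>{..<n}. {y :: nat \<Rightarrow> real. \<bar>y i - x i\<bar> < d})"
    by (intro open_INT finite_lessThan ballI open_Collect_less continuous_intros continuous_on_product_coordinates)
  also have "(\<Inter>i\<in>{..<n}. {y :: nat \<Rightarrow> real. \<bar>y i - x i\<bar> < d}) = {y. \<forall>i<n. \<bar>y i - x i\<bar> < d}"
    by auto
  finally show ?thesis .
qed

lemma n_domain_cube [simp]: "n_domain n (cube n x d)"
  unfolding n_domain_open cube_def using open_cube[of n x d] by blast

lemma in_cube_self [simp]: "x \<in> cube n x d \<longleftrightarrow> x \<in> Rn n \<and> (n = 0 \<or> d > 0)"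
  by (auto simp: cube_def)

lemma cube_mono: "d \<le> d' \<Longrightarrow> cube n x d \<subseteq> cube n x d'"
  by (force simp: cube_def)

text \<open>A basic open set of the product topology is a box. Its first \<open>n\<close> sides
  contain intervals of a common radius, and on the remaining coordinates all points of
  \<open>Rn n\<close> vanish, so these sides impose nothing new.\<close>

lemma n_domain_iff_cube:
  "n_domain n U \<longleftrightarrow> U \<subseteq> Rn n \<and> (\<forall>x\<in>U. \<exists>d>0. cube n x d \<subseteq> U)"
proof
  assume U: "n_domain n U"
  have "\<exists>d>0. cube n x d \<subseteq> U" if "x \<in> U" for x
  proof -
    obtain T where T: "open T" "U = Rn n \<inter> T" using U unfolding n_domain_open by blast
    have op: "openin (product_topology (\<lambda>i. euclideanreal) UNIV) T"
      using T(1) by (simp add: euclidean_product_topology)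
    have "x \<in> T" using that T(2) by blast
    then obtain X where X: "x \<in> (\<Pi>\<^sub>E i\<in>UNIV. X i)" "\<And>i. openin euclideanreal (X i)"
        "(\<Pi>\<^sub>E i\<in>UNIV. X i) \<subseteq> T"
      using product_topology_open_contains_basis[OF op] by blast
    have "\<exists>d>0. \<forall>i<n. ball (x i) d \<subseteq> X i"
    proof (rule exists_common_radius)
      fix i
      have "open (X i)" using X(2)[of i] by simp
      moreover have "x i \<in> X i" using X(1) by (rule PiE_mem) simp
      ultimately show "\<exists>d>0. ball (x i) d \<subseteq> X i" by (meson open_contains_ball)
    qed (meson subset_ball subset_trans)
    then obtain d where d: "d > 0" "\<forall>i<n. ball (x i) d \<subseteq> X i" by blast
    have "y \<in> U" if "y \<in> cube n x d" for y
    proof -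
      have "y i \<in> X i" for i
      proof (cases "i < n")
        case True
        then have "y i \<in> ball (x i) d" using that by (simp add: cube_def dist_real_def abs_minus_commute)
        then show ?thesis using d True by blast
      next
        case False
        then have "y i = x i" using that \<open>x \<in> U\<close> T(2) by (auto simp: cube_def Rn_iff)
        then show ?thesis using X(1) by (auto simp: PiE_iff)
      qed
      then have "y \<in> T" using X(3) by (auto simp: PiE_iff)
      then show ?thesis using that T(2) by (auto simp: cube_def)
    qed
    then show ?thesis using d(1) by blast
  qed
  then show "U \<subseteq> Rn n \<and> (\<forall>x\<in>U. \<exists>d>0. cube n x d \<subseteq> U)"
    using n_domain_subset U by blast
next
  assume *: "U \<subseteq> Rn n \<and> (\<forall>x\<in>U. \<exists>d>0. cube n x d \<subseteq> U)"
  have "openin (Euclidean_space n) U"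
    unfolding openin_subopen[of _ U]
  proof
    fix x assume "x \<in> U"
    then obtain d where d: "d > 0" "cube n x d \<subseteq> U" using * by blast
    show "\<exists>T. openin (Euclidean_space n) T \<and> x \<in> T \<and> T \<subseteq> U"
      using n_domain_cube[of n x d] d * \<open>x \<in> U\<close> unfolding n_domain_def
      by (intro exI[of _ "cube n x d"]) auto
  qed
  then show "n_domain n U" by (simp add: n_domain_def)
qed

lemma n_domain_locallyI:
  assumes "\<And>x. x \<in> U \<Longrightarrow> \<exists>V. n_domain n V \<and> x \<in> V \<and> V \<subseteq> U"
  shows "n_domain n U"
  unfolding n_domain_def using assms unfolding n_domain_def by (subst openin_subopen) blast

lemma n_domain_cubeE:
  assumes "n_domain n U" "x \<in> U"
  obtains d where "d > 0" "cube n x d \<subseteq> U"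
  using assms n_domain_iff_cube by blast

lemma cube_upd: "x \<in> Rn n \<Longrightarrow> i < n \<Longrightarrow> 0 < d \<Longrightarrow> \<bar>t - x i\<bar> < d \<Longrightarrow> x(i := t) \<in> cube n x d"
  by (auto simp: cube_def Rn_upd)

text \<open>Openness keeps the coordinate line through \<open>x\<close> inside \<open>U\<close> for
  a while. This is what makes the partial derivatives at points of \<open>U\<close> depend only on
  the values of \<open>f\<close> on \<open>U\<close>.\<close>

lemma eventually_upd_in:
  assumes "n_domain n U" "x \<in> U" "i < n"
  shows "\<forall>\<^sub>F t in nhds (x i). x(i := t) \<in> U"
proof -
  obtain d where "d > 0" "cube n x d \<subseteq> U" using assms n_domain_iff_cube by blast
  then show ?thesis
    unfolding eventually_nhds_metric using assms cube_upd[of x n i d] n_domain_RnD[of n U x]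
    by (auto simp: dist_real_def intro!: exI[of _ d])
qed

section \<open>Continuity on domains\<close>

lemma continuous_map_subtop_iff:
  assumes "U \<subseteq> Rn n"
  shows "continuous_map (subtopology (Euclidean_space n) U) euclidean f \<longleftrightarrow> continuous_on U f"
  using assms by (subst Euclidean_space_eq) (simp add: subtopology_subtopology inf.absorb2)

lemma continuous_on_iff_cube:
  fixes f :: "(nat \<Rightarrow> real) \<Rightarrow> real"
  assumes "n_domain n U"
  shows "continuous_on U f \<longleftrightarrow> (\<forall>x\<in>U. \<forall>e>0. \<exists>d>0. \<forall>y\<in>cube n x d. y \<in> U \<longrightarrow> \<bar>f y - f x\<bar> < e)"
proof
  assume f: "continuous_on U f"
  show "\<forall>x\<in>U. \<forall>e>0. \<exists>d>0. \<forall>y\<in>cube n x d. y \<in> U \<longrightarrow> \<bar>f y - f x\<bar> < e"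
  proof (intro ballI allI impI)
    fix x and e :: real assume x: "x \<in> U" and e: "e > 0"
    have "openin (top_of_set U) (U \<inter> f -` ball (f x) e)"
      by (rule continuous_openin_preimage_gen[OF f open_ball])
    then have "n_domain n (U \<inter> f -` ball (f x) e)"
      using assms unfolding n_domain_openin by (rule openin_trans)
    then obtain d where "d > 0" "cube n x d \<subseteq> U \<inter> f -` ball (f x) e"
      using x e n_domain_cubeE[of n _ x] by (metis Int_iff centre_in_ball vimage_eq)
    then show "\<exists>d>0. \<forall>y\<in>cube n x d. y \<in> U \<longrightarrow> \<bar>f y - f x\<bar> < e"
      by (intro exI[of _ d]) (auto simp: dist_real_def subset_iff abs_minus_commute)
  qed
next
  assume *: "\<forall>x\<in>U. \<forall>e>0. \<exists>d>0. \<forall>y\<in>cube n x d. y \<in> U \<longrightarrow> \<bar>f y - f x\<bar> < e"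
  show "continuous_on U f"
    unfolding continuous_on_def tendsto_iff
  proof (intro ballI allI impI)
    fix x and e :: real assume x: "x \<in> U" and e: "e > 0"
    then obtain d where d: "d > 0" "\<forall>y\<in>cube n x d. y \<in> U \<longrightarrow> \<bar>f y - f x\<bar> < e" using * by blast
    let ?T = "{y. \<forall>i<n. \<bar>y i - x i\<bar> < d}"
    have "dist (f y) (f x) < e" if "y \<in> ?T" "y \<in> U" for y
    proof -
      have "y \<in> cube n x d" using that n_domain_subset[OF assms] by (auto simp: cube_def)
      then show ?thesis using d(2) that(2) unfolding dist_real_def by blast
    qed
    moreover have "x \<in> ?T" using d(1) by simp
    ultimately show "\<forall>\<^sub>F y in at x within U. dist (f y) (f x) < e"
      unfolding eventually_at_topological using open_cube[of n x d] by blast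
  qed
qed

lemma n_domain_preimage:
  assumes "n_domain m V" "n_domain n U" "\<And>j. j < n \<Longrightarrow> continuous_on V (\<lambda>x. F x j)" "F \<in> V \<rightarrow> Rn n"
  shows "n_domain m {x \<in> V. F x \<in> U}"
proof -
  obtain T where T: "open T" "U = Rn n \<inter> T" using assms(2) unfolding n_domain_open by blast
  have "continuous_on V (\<lambda>x. F x j)" for j
  proof (cases "j < n")
    case False
    then have "\<forall>x\<in>V. F x j = 0" using assms(4) by (auto simp: Pi_iff Rn_iff)
    then show ?thesis by (metis continuous_on_cong continuous_on_const)
  qed (use assms in auto)
  then have "continuous_on V F" by (rule continuous_on_coordinatewise_then_product)
  then have "openin (top_of_set V) (V \<inter> F -` T)" using T(1) by (rule continuous_openin_preimage_gen)
  moreover have "V \<inter> F -` T = {x \<in> V. F x \<in> U}" using T assms(4) by auto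
  ultimately show ?thesis
    using assms(1) unfolding n_domain_openin by (metis openin_trans)
qed

text \<open>The coordinates of \<open>F\<close> from \<open>n\<close> on are identically zero,
  because \<open>F\<close> takes values in \<open>Rn n\<close>; continuity of the first
  \<open>n\<close> is therefore continuity of \<open>F\<close>.\<close>

lemma continuous_on_comp_coords:
  assumes "continuous_on U f" "\<And>j. j < n \<Longrightarrow> continuous_on V (\<lambda>x. F x j)" "F \<in> V \<rightarrow> U" "U \<subseteq> Rn n"
  shows "continuous_on V (\<lambda>x. f (F x))"
proof -
  have "continuous_on V (\<lambda>x. F x j)" for j
  proof (cases "j < n")
    case False
    then have "\<forall>x\<in>V. F x j = 0" using assms(3,4) by (auto simp: Pi_iff Rn_iff subset_iff)
    then show ?thesis by (metis continuous_on_cong continuous_on_const)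
  qed (use assms in auto)
  then have "continuous_on V F" by (rule continuous_on_coordinatewise_then_product)
  then show ?thesis using assms(1,3) by (metis Pi_iff image_subsetI continuous_on_compose2)
qed

section \<open>Calculus of iterated partial derivatives\<close>

lemma Ck_0_iff: "n_domain n U \<Longrightarrow> Ck 0 n U f \<longleftrightarrow> continuous_on U f"
  by (simp add: continuous_map_subtop_iff n_domain_subset)

lemma Ck_Suc_iff:
  assumes "n_domain n U"
  shows "Ck (Suc k) n U f \<longleftrightarrow> continuous_on U f \<and>
    (\<forall>i<n. (\<forall>x\<in>U. ((\<lambda>t. f (x(i := t))) has_field_derivative partial i f x) (at (x i))) \<and> Ck k n U (partial i f))"
  using assms
  by (simp add: continuous_map_subtop_iff n_domain_subset partial_def DERIV_deriv_iff_field_differentiable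
      del: fun_upd_apply)

declare Ck.simps [simp del]

lemma Ck_continuous: "n_domain n U \<Longrightarrow> Ck k n U f \<Longrightarrow> continuous_on U f"
  by (cases k) (simp_all add: Ck_0_iff Ck_Suc_iff)

lemma Ck_SucD_deriv:
  "n_domain n U \<Longrightarrow> Ck (Suc k) n U f \<Longrightarrow> i < n \<Longrightarrow> x \<in> U \<Longrightarrow>
    ((\<lambda>t. f (x(i := t))) has_field_derivative partial i f x) (at (x i))"
  by (simp add: Ck_Suc_iff)

lemma Ck_SucD_partial: "n_domain n U \<Longrightarrow> Ck (Suc k) n U f \<Longrightarrow> i < n \<Longrightarrow> Ck k n U (partial i f)"
  by (simp add: Ck_Suc_iff)

lemma partial_cong:
  assumes "n_domain n U" "\<And>x. x \<in> U \<Longrightarrow> f x = g x" "x \<in> U" "i < n"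
  shows "partial i f x = partial i g x"
  unfolding partial_def using eventually_upd_in[OF assms(1,3,4)]
  by (intro deriv_cong_ev) (auto elim: eventually_mono intro: assms(2))

text \<open>The functions are generalised in the induction because the step passes to their partial
  derivatives, which agree on \<open>U\<close> again.\<close>

lemma Ck_cong_imp:
  assumes "n_domain n U" "\<And>x. x \<in> U \<Longrightarrow> f x = g x" "Ck k n U f"
  shows "Ck k n U g"
  using assms(2,3)
proof (induction k arbitrary: f g)
  case 0
  then show ?case using assms(1) by (simp add: Ck_0_iff cong: continuous_on_cong)
next
  case (Suc k)
  have "continuous_on U g" using Suc.prems assms(1) by (simp add: Ck_Suc_iff cong: continuous_on_cong)
  moreover have "((\<lambda>t. g (x(i := t))) has_field_derivative partial i g x) (at (x i))"
    if "i < n" "x \<in> U" for i x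
  proof -
    have "\<forall>\<^sub>F t in nhds (x i). f (x(i := t)) = g (x(i := t))"
      using eventually_upd_in[OF assms(1) that(2,1)] by (rule eventually_mono) (rule Suc.prems(1))
    moreover have "partial i f x = partial i g x"
      using partial_cong[OF assms(1)] Suc.prems(1) that by blast
    moreover have "((\<lambda>t. f (x(i := t))) has_field_derivative partial i f x) (at (x i))"
      using Ck_SucD_deriv[OF assms(1) Suc.prems(2) that] .
    ultimately show ?thesis
      using DERIV_cong_ev[OF refl, of "\<lambda>t. f (x(i := t))" "\<lambda>t. g (x(i := t))"] by blast
  qed
  moreover have "Ck k n U (partial i g)" if "i < n" for i
  proof (rule Suc.IH)
    show "partial i f x = partial i g x" if "x \<in> U" for x
      using partial_cong[OF assms(1)] Suc.prems(1) that \<open>i < n\<close> by blast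
    show "Ck k n U (partial i f)"
      using Suc.prems(2) that by (rule Ck_SucD_partial[OF assms(1)])
  qed
  ultimately show ?case using assms(1) by (simp add: Ck_Suc_iff)
qed

text \<open>Introduction rule for derivatives given by a formula: \<open>D i\<close> has to match
  the partial derivative on \<open>U\<close> only, and \<open>Ck_cong_imp\<close> carries its
  regularity over.\<close>

lemma Ck_SucI:
  assumes "n_domain n U" "continuous_on U f"
    "\<And>i x. i < n \<Longrightarrow> x \<in> U \<Longrightarrow> ((\<lambda>t. f (x(i := t))) has_field_derivative D i x) (at (x i))"
    "\<And>i. i < n \<Longrightarrow> Ck k n U (D i)"
  shows "Ck (Suc k) n U f"
proof -
  have *: "D i x = partial i f x" if "i < n" "x \<in> U" for i x
    using assms(3)[OF that] unfolding partial_def by (rule DERIV_imp_deriv[symmetric])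
  have "Ck k n U (partial i f)" if "i < n" for i
    by (rule Ck_cong_imp[OF assms(1) _ assms(4)[OF that]]) (rule *[OF that])
  then show ?thesis using assms * by (simp add: Ck_Suc_iff)
qed

section \<open>Stability of \<open>Ck\<close> under restriction and arithmetic\<close>

lemma Ck_subset:
  assumes "n_domain n V" "n_domain n U" "V \<subseteq> U" "Ck k n U f"
  shows "Ck k n V f"
  using assms(4)
proof (induction k arbitrary: f)
  case 0 then show ?case using assms by (auto simp: Ck_0_iff intro: continuous_on_subset)
next
  case (Suc k)
  then have "continuous_on V f" using assms by (auto simp: Ck_Suc_iff intro: continuous_on_subset)
  then show ?case using Suc assms by (auto simp: Ck_Suc_iff)
qed

lemma Ck_Suc_imp:
  assumes "n_domain n U"
  shows "Ck (Suc k) n U f \<Longrightarrow> Ck k n U f"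
proof (induction k arbitrary: f)
  case 0 then show ?case using assms by (simp add: Ck_0_iff Ck_Suc_iff)
next
  case (Suc k)
  then show ?case using assms by (subst Ck_Suc_iff) (auto simp: Ck_Suc_iff[OF assms, of "Suc k"])
qed

lemma Ck_const [simp]: "n_domain n U \<Longrightarrow> Ck k n U (\<lambda>x. c)"
proof (induction k arbitrary: c)
  case (Suc k) then show ?case by (intro Ck_SucI[where D = "\<lambda>i x. 0"]) auto
qed (simp add: Ck_0_iff)

lemma continuous_on_coordinate: "continuous_on U (\<lambda>x :: nat \<Rightarrow> real. x j)"
  by (rule continuous_on_subset[OF continuous_on_product_coordinates]) simp

lemma Ck_coordinate:
  assumes "n_domain n U"
  shows "Ck k n U (\<lambda>x. x j)"
proof (cases k)
  case (Suc k')
  show ?thesis unfolding Suc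
    by (rule Ck_SucI[where D = "\<lambda>i x. if i = j then 1 else 0"])
      (use assms in \<open>auto intro!: continuous_on_coordinate derivative_eq_intros\<close>)
qed (simp add: Ck_0_iff assms continuous_on_coordinate)

lemma Ck_add:
  assumes "n_domain n U"
  shows "Ck k n U f \<Longrightarrow> Ck k n U g \<Longrightarrow> Ck k n U (\<lambda>x. f x + g x)"
proof (induction k arbitrary: f g)
  case (Suc k)
  show ?case
    by (rule Ck_SucI[where D = "\<lambda>i x. partial i f x + partial i g x"])
      (use assms Suc in \<open>auto simp: Ck_Suc_iff simp del: fun_upd_apply intro: continuous_on_add DERIV_add\<close>)
qed (auto simp: Ck_0_iff assms intro: continuous_on_add)

text \<open>The product rule multiplies each factor by a partial derivative of the other. Both are
  of class \<open>k\<close> by lowering the order of the factor, so the induction has to range over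
  all pairs of functions.\<close>

lemma Ck_mult:
  assumes "n_domain n U"
  shows "Ck k n U f \<Longrightarrow> Ck k n U g \<Longrightarrow> Ck k n U (\<lambda>x. f x * g x)"
proof (induction k arbitrary: f g)
  case (Suc k)
  show ?case
  proof (rule Ck_SucI[where D = "\<lambda>i x. partial i f x * g x + partial i g x * f x"])
    show "continuous_on U (\<lambda>x. f x * g x)"
      using Suc.prems assms by (auto simp: Ck_Suc_iff intro: continuous_on_mult)
    fix i assume i: "i < n"
    show "((\<lambda>t. f (x(i := t)) * g (x(i := t))) has_field_derivative
        partial i f x * g x + partial i g x * f x) (at (x i))" if "x \<in> U" for x
      using DERIV_mult[OF Ck_SucD_deriv[OF assms Suc.prems(1) i that] Ck_SucD_deriv[OF assms Suc.prems(2) i that]]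
      by (simp del: fun_upd_apply)
    show "Ck k n U (\<lambda>x. partial i f x * g x + partial i g x * f x)"
      using Suc.prems i assms by (intro Ck_add Suc.IH) (auto intro: Ck_Suc_imp Ck_SucD_partial)
  qed fact
qed (auto simp: Ck_0_iff assms intro: continuous_on_mult)

lemma Ck_uminus: "n_domain n U \<Longrightarrow> Ck k n U f \<Longrightarrow> Ck k n U (\<lambda>x. - f x)"
  using Ck_mult[of n U k "\<lambda>x. -1" f] by simp

lemma Ck_diff: "n_domain n U \<Longrightarrow> Ck k n U f \<Longrightarrow> Ck k n U g \<Longrightarrow> Ck k n U (\<lambda>x. f x - g x)"
  using Ck_add[of n U k f "\<lambda>x. - g x"] Ck_uminus by simp

lemma Ck_sum:
  assumes "n_domain n U" "finite I" "\<And>j. j \<in> I \<Longrightarrow> Ck k n U (f j)"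
  shows "Ck k n U (\<lambda>x. \<Sum>j\<in>I. f j x)"
  using assms(2,3) by (induction I rule: finite_induct) (auto intro: Ck_add assms(1) simp: assms(1))

text \<open>The derivative of the reciprocal is written with the reciprocal itself, so the induction
  hypothesis for the same \<open>f\<close> at order \<open>k\<close> yields order
  \<open>k + 1\<close>.\<close>

lemma Ck_inverse:
  assumes "n_domain n U" "\<And>x. x \<in> U \<Longrightarrow> f x \<noteq> 0"
  shows "Ck k n U f \<Longrightarrow> Ck k n U (\<lambda>x. inverse (f x))"
proof (induction k)
  case (Suc k)
  show ?case
  proof (rule Ck_SucI[where D = "\<lambda>i x. - (inverse (f x) * partial i f x * inverse (f x))"])
    show "continuous_on U (\<lambda>x. inverse (f x))"
      using Suc.prems assms by (auto simp: Ck_Suc_iff intro: continuous_on_inverse)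
    fix i assume i: "i < n"
    show "((\<lambda>t. inverse (f (x(i := t)))) has_field_derivative - (inverse (f x) * partial i f x * inverse (f x))) (at (x i))"
      if "x \<in> U" for x
      using DERIV_inverse'[OF Ck_SucD_deriv[OF assms(1) Suc.prems(1) i that]] assms(2)[OF that]
      by (simp del: fun_upd_apply)
    show "Ck k n U (\<lambda>x. - (inverse (f x) * partial i f x * inverse (f x)))"
      using Suc i assms by (intro Ck_uminus Ck_mult) (auto intro: Ck_Suc_imp Ck_SucD_partial)
  qed (use assms in simp)
qed (auto simp: Ck_0_iff assms intro: continuous_on_inverse)

text \<open>The increment is written as a telescoping sum in which one coordinate changes at a time; each
  difference quotient is then controlled by the mean value theorem in one variable.\<close>

lemma Ck_caratheodory:
  assumes U: "n_domain n U" and f: "Ck (Suc 0) n U f" and x: "x \<in> U"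
  obtains a where "\<And>y. y \<in> Rn n \<Longrightarrow> f y - f x = (\<Sum>i<n. a i y * (y i - x i))"
    "\<And>i. i < n \<Longrightarrow> a i x = partial i f x"
    "\<And>e. e > 0 \<Longrightarrow> \<exists>d>0. \<forall>y\<in>cube n x d. \<forall>i<n. \<bar>a i y - partial i f x\<bar> \<le> e"
proof -
  \<comment> \<open>The points \<open>m 0 y\<close>, ..., \<open>m n y\<close> are the corners of a
    path from \<open>x\<close> to \<open>y\<close> along the coordinate directions.\<close>
  define m where "m i y = (\<lambda>j. if j < i then y j else x j)" for i :: nat and y
  \<comment> \<open>The slope along the \<open>i\<close>-th edge of the path. On a degenerate edge
    the quotient has no meaning, and \<open>partial i f x\<close> is the value that keeps
    \<open>a i\<close> continuous at \<open>x\<close>.\<close>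
  define a where "a i y = (if y i = x i then partial i f x
    else (f (m (Suc i) y) - f (m i y)) / (y i - x i))" for i y
  have xR: "x \<in> Rn n" using n_domain_RnD[OF U x] .
  have m_Suc: "m (Suc i) y = (m i y)(i := y i)" for i y
    by (auto simp: m_def)
  have step: "f (m (Suc i) y) - f (m i y) = a i y * (y i - x i)" for i y
  proof (cases "y i = x i")
    case True
    then have "m (Suc i) y = m i y" by (auto simp: m_def less_Suc_eq)
    then show ?thesis using True by simp
  qed (simp add: a_def)
  show thesis
  proof
    fix y assume y: "y \<in> Rn n"
    have "m n y = y" using y xR by (intro ext) (auto simp: m_def Rn_iff)
    moreover have "m 0 y = x" by (simp add: m_def)
    moreover have "(\<Sum>i<n. f (m (Suc i) y) - f (m i y)) = f (m n y) - f (m 0 y)"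
      by (rule sum_lessThan_telescope)
    ultimately show "f y - f x = (\<Sum>i<n. a i y * (y i - x i))" by (simp add: step)
  next
    fix i show "a i x = partial i f x" by (simp add: a_def)
  next
    fix e :: real assume e: "e > 0"
    have "\<exists>d>0. \<forall>i<n. cube n x d \<subseteq> U \<and> (\<forall>z\<in>cube n x d. \<bar>partial i f z - partial i f x\<bar> \<le> e)"
    proof (rule exists_common_radius)
      fix i assume i: "i < n"
      have "continuous_on U (partial i f)"
        using Ck_SucD_partial[OF U f i] U by (simp add: Ck_0_iff)
      then obtain d1 where d1: "d1 > 0" "\<forall>y\<in>cube n x d1. y \<in> U \<longrightarrow> \<bar>partial i f y - partial i f x\<bar> < e"
        unfolding continuous_on_iff_cube[OF U] using x e by blast
      obtain d2 where d2: "d2 > 0" "cube n x d2 \<subseteq> U" using n_domain_cubeE[OF U x] .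
      have "cube n x (min d1 d2) \<subseteq> cube n x d1" "cube n x (min d1 d2) \<subseteq> cube n x d2"
        by (simp_all add: cube_mono)
      then show "\<exists>d>0. cube n x d \<subseteq> U \<and> (\<forall>z\<in>cube n x d. \<bar>partial i f z - partial i f x\<bar> \<le> e)"
        using d1 d2 by (intro exI[of _ "min d1 d2"]) (auto simp: less_imp_le subset_iff)
    next
      fix i d d' assume "cube n x d \<subseteq> U \<and> (\<forall>z\<in>cube n x d. \<bar>partial i f z - partial i f x\<bar> \<le> e)" "d' \<le> d"
      then show "cube n x d' \<subseteq> U \<and> (\<forall>z\<in>cube n x d'. \<bar>partial i f z - partial i f x\<bar> \<le> e)"
        using cube_mono[of d' d n x] by blast
    qed
    then obtain d where d: "d > 0" "\<And>i. i < n \<Longrightarrow> cube n x d \<subseteq> U"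
      "\<And>i z. i < n \<Longrightarrow> z\<in>cube n x d \<Longrightarrow> \<bar>partial i f z - partial i f x\<bar> \<le> e" by blast
    have "\<bar>a i y - partial i f x\<bar> \<le> e" if y: "y \<in> cube n x d" and i: "i < n" for y i
    proof (cases "y i = x i")
      case True then show ?thesis using e by (simp add: a_def)
    next
      case False
      \<comment> \<open>Once the linear part is subtracted, the derivative of \<open>g\<close> is
        the variation of \<open>partial i f\<close>, hence at most \<open>e\<close> on the segment,
        and the mean value theorem bounds the increment of \<open>g\<close>.\<close>
      define g where "g t = f ((m i y)(i := t)) - partial i f x * t" for t
      define S where "S = closed_segment (x i) (y i)"
      have in_cube: "(m i y)(i := t) \<in> cube n x d" if "t \<in> S" for t
      proof -
        have "\<bar>t - x i\<bar> \<le> \<bar>y i - x i\<bar>" using that unfolding S_def closed_segment_eq_real_ivl by (auto split: if_splits)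
        also have "\<dots> < d" using y i by (simp add: cube_def)
        finally have "\<bar>t - x i\<bar> < d" .
        then show ?thesis using y i xR d(1) by (auto simp: cube_def m_def Rn_iff)
      qed
      have "norm (g (y i) - g (x i)) \<le> e * norm (y i - x i)"
      proof (rule field_differentiable_bound)
        show "convex S" "y i \<in> S" "x i \<in> S" by (simp_all add: S_def)
        fix t assume t: "t \<in> S"
        let ?z = "(m i y)(i := t)"
        have "((\<lambda>s. f (?z(i := s))) has_field_derivative partial i f ?z) (at (?z i))"
          using in_cube[OF t] d(2)[OF i] by (intro Ck_SucD_deriv[OF U f i]) blast
        then have "((\<lambda>s. f ((m i y)(i := s))) has_field_derivative partial i f ?z) (at t)" by simp
        then have "(g has_field_derivative partial i f ?z - partial i f x) (at t)"
          unfolding g_def by (auto intro!: derivative_eq_intros)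
        then show "(g has_field_derivative partial i f ?z - partial i f x) (at t within S)"
          by (rule has_field_derivative_at_within)
        show "norm (partial i f ?z - partial i f x) \<le> e"
          using d(3)[OF i in_cube[OF t]] by simp
      qed
      moreover have "(m i y)(i := x i) = m i y" by (auto simp: m_def)
      ultimately have "\<bar>(f (m (Suc i) y) - f (m i y)) - partial i f x * (y i - x i)\<bar> \<le> e * \<bar>y i - x i\<bar>"
        by (simp add: g_def m_Suc algebra_simps)
      moreover have "a i y - partial i f x = ((f (m (Suc i) y) - f (m i y)) - partial i f x * (y i - x i)) / (y i - x i)"
        using False by (simp add: a_def field_simps)
      ultimately show ?thesis using False by (simp add: divide_le_eq)
    qed
    then show "\<exists>d>0. \<forall>y\<in>cube n x d. \<forall>i<n. \<bar>a i y - partial i f x\<bar> \<le> e" using d(1) by blast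
  qed
qed

section \<open>Slopes along curves and the chain rule\<close>

lemma eventually_in_cube:
  fixes c :: "real \<Rightarrow> nat \<Rightarrow> real"
  assumes c: "\<And>j. j < n \<Longrightarrow> ((\<lambda>t. c t j) \<longlongrightarrow> x j) F" and R: "\<forall>\<^sub>F t in F. c t \<in> Rn n" and "d > 0"
  shows "\<forall>\<^sub>F t in F. c t \<in> cube n x d"
proof -
  have "\<forall>\<^sub>F t in F. \<forall>j\<in>{..<n}. \<bar>c t j - x j\<bar> < d"
    using tendstoD[OF c \<open>d > 0\<close>] by (intro eventually_ball_finite) (auto simp: dist_real_def)
  with R show ?thesis by eventually_elim (auto simp: cube_def)
qed

text \<open>Only convergence of the family \<open>c\<close> is required, not a derivative. Hence the
  slopes can be followed along the graph of an implicit function that is so far only known to be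
  continuous.\<close>

lemma Ck_caratheodory_tendsto:
  assumes U: "n_domain n U" and f: "Ck (Suc 0) n U f" and x: "x \<in> U"
  shows "\<exists>a. (\<forall>y\<in>Rn n. f y - f x = (\<Sum>i<n. a i y * (y i - x i))) \<and>
    (\<forall>i<n. \<forall>(c :: real \<Rightarrow> nat \<Rightarrow> real) F. (\<forall>j<n. ((\<lambda>t. c t j) \<longlongrightarrow> x j) F) \<longrightarrow>
      (\<forall>\<^sub>F t in F. c t \<in> Rn n) \<longrightarrow> ((\<lambda>t. a i (c t)) \<longlongrightarrow> partial i f x) F)"
proof -
  obtain a where a: "\<And>y. y \<in> Rn n \<Longrightarrow> f y - f x = (\<Sum>i<n. a i y * (y i - x i))"
    "\<And>i. i < n \<Longrightarrow> a i x = partial i f x"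
    "\<And>e. e > 0 \<Longrightarrow> \<exists>d>0. \<forall>y\<in>cube n x d. \<forall>i<n. \<bar>a i y - partial i f x\<bar> \<le> e"
    by (rule Ck_caratheodory[OF U f x]) (rule that)
  have lim_a: "((\<lambda>t. a i (c t)) \<longlongrightarrow> partial i f x) F"
    if i: "i < n" and c: "\<And>j. j < n \<Longrightarrow> ((\<lambda>t. c t j) \<longlongrightarrow> x j) F" and R: "\<forall>\<^sub>F t in F. c t \<in> Rn n"
    for i and c :: "real \<Rightarrow> nat \<Rightarrow> real" and F
  proof (rule tendstoI)
    fix e :: real assume e: "e > 0"
    obtain d where d: "d > 0" "\<forall>y\<in>cube n x d. \<forall>i<n. \<bar>a i y - partial i f x\<bar> \<le> e / 2"
      using a(3)[of "e / 2"] e by auto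
    have "\<forall>\<^sub>F t in F. c t \<in> cube n x d"
      by (rule eventually_in_cube[OF c R d(1)])
    then show "\<forall>\<^sub>F t in F. dist (a i (c t)) (partial i f x) < e"
    proof eventually_elim
      case (elim t)
      then have "\<bar>a i (c t) - partial i f x\<bar> \<le> e / 2" using d(2) i by blast
      then show ?case using e by (simp add: dist_real_def)
    qed
  qed
  show ?thesis using a(1) lim_a by (intro exI[of _ a]) simp
qed

text \<open>Dividing the slope identity by \<open>t - t0\<close> leaves slopes, which converge to
  the partial derivatives, times difference quotients of the coordinates of the curve.\<close>

lemma chain_rule_curve:
  fixes c :: "real \<Rightarrow> nat \<Rightarrow> real"
  assumes U: "n_domain n U" and f: "Ck (Suc 0) n U f" and x: "c t0 \<in> U"
    and c: "\<And>j. j < n \<Longrightarrow> ((\<lambda>t. c t j) has_field_derivative c' j) (at t0)"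
    and R: "\<forall>\<^sub>F t in nhds t0. c t \<in> Rn n"
  shows "((\<lambda>t. f (c t)) has_field_derivative (\<Sum>j<n. partial j f (c t0) * c' j)) (at t0)"
proof -
  obtain a where a1: "\<forall>y\<in>Rn n. f y - f (c t0) = (\<Sum>i<n. a i y * (y i - c t0 i))"
    and a2: "\<forall>i<n. \<forall>(c' :: real \<Rightarrow> nat \<Rightarrow> real) F. (\<forall>j<n. ((\<lambda>t. c' t j) \<longlongrightarrow> c t0 j) F) \<longrightarrow>
      (\<forall>\<^sub>F t in F. c' t \<in> Rn n) \<longrightarrow> ((\<lambda>t. a i (c' t)) \<longlongrightarrow> partial i f (c t0)) F"
    using Ck_caratheodory_tendsto[OF U f x] by (elim exE conjE) (rule that)
  have cont: "((\<lambda>t. c t j) \<longlongrightarrow> c t0 j) (at t0)" if "j < n" for j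
    using DERIV_isCont[OF c[OF that]] by (simp only: isCont_def)
  have R': "\<forall>\<^sub>F t in at t0. c t \<in> Rn n" using R by (simp add: eventually_nhds_conv_at)
  have lim_a: "((\<lambda>t. a i (c t)) \<longlongrightarrow> partial i f (c t0)) (at t0)" if "i < n" for i
    using that by (intro a2[rule_format] cont R')
  have "((\<lambda>t. \<Sum>i<n. a i (c t) * ((c t i - c t0 i) / (t - t0))) \<longlongrightarrow> (\<Sum>j<n. partial j f (c t0) * c' j)) (at t0)"
    using c by (intro tendsto_sum tendsto_mult lim_a) (auto simp: has_field_derivative_iff)
  moreover have "\<forall>\<^sub>F t in at t0. (\<Sum>i<n. a i (c t) * ((c t i - c t0 i) / (t - t0))) = (f (c t) - f (c t0)) / (t - t0)"
    using R' by eventually_elim (simp add: a1 sum_divide_distrib)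
  ultimately show ?thesis
    unfolding has_field_derivative_iff by (blast intro: Lim_transform_eventually)
qed

lemma smooth_deriv_comp:
  assumes U: "n_domain n U" and f: "Ck (Suc 0) n U f" and V: "n_domain m V"
    and G: "G \<in> V \<rightarrow> U" "\<And>j. j < n \<Longrightarrow> Ck (Suc 0) m V (\<lambda>x. G x j)" and x: "x \<in> V" and i: "i < m"
  shows "((\<lambda>t. f (G (x(i := t)))) has_field_derivative
    (\<Sum>j<n. partial j f (G x) * partial i (\<lambda>x. G x j) x)) (at (x i))"
proof -
  have "((\<lambda>t. f (G (x(i := t)))) has_field_derivative
    (\<Sum>j<n. partial j f (G (x(i := x i))) * partial i (\<lambda>x. G x j) x)) (at (x i))"
  proof (rule chain_rule_curve[OF U f])
    show "G (x(i := x i)) \<in> U" using G(1) x by auto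
    show "((\<lambda>t. G (x(i := t)) j) has_field_derivative partial i (\<lambda>x. G x j) x) (at (x i))" if "j < n" for j
      using Ck_SucD_deriv[OF V G(2)[OF that] i x] .
    show "\<forall>\<^sub>F t in nhds (x i). G (x(i := t)) \<in> Rn n"
      using eventually_upd_in[OF V x i] by eventually_elim (use G(1) n_domain_subset[OF U] in auto)
  qed
  then show ?thesis by simp
qed

lemma partial_comp:
  assumes U: "n_domain n U" and f: "Ck (Suc 0) n U f" and V: "n_domain m V"
    and G: "G \<in> V \<rightarrow> U" "\<And>j. j < n \<Longrightarrow> Ck (Suc 0) m V (\<lambda>x. G x j)" and x: "x \<in> V" and i: "i < m"
  shows "partial i (\<lambda>x. f (G x)) x = (\<Sum>j<n. partial j f (G x) * partial i (\<lambda>x. G x j) x)"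
  using smooth_deriv_comp[OF assms] unfolding partial_def[of i "\<lambda>x. f (G x)"] by (rule DERIV_imp_deriv)

text \<open>The induction keeps \<open>G\<close> fixed and varies \<open>f\<close>: by the chain
  rule the derivatives of the composite are sums of products of a \<open>partial j f\<close>
  composed with \<open>G\<close> and a partial derivative of \<open>G\<close>.\<close>

lemma Ck_comp:
  assumes U: "n_domain n U" and V: "n_domain m V" and G: "G \<in> V \<rightarrow> U"
  shows "Ck k n U f \<Longrightarrow> (\<And>j. j < n \<Longrightarrow> Ck k m V (\<lambda>x. G x j)) \<Longrightarrow> Ck k m V (\<lambda>x. f (G x))"
proof (induction k arbitrary: f)
  case 0
  then show ?case using assms n_domain_subset[OF U]
    by (auto simp: Ck_0_iff intro: continuous_on_comp_coords[where n = n])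
next
  case (Suc k)
  have Suc0: "Ck (Suc k) l W h \<Longrightarrow> Ck (Suc 0) l W h" if "n_domain l W" for l W h
    using that by (induction k) (auto intro: Ck_Suc_imp)
  show ?case
  proof (rule Ck_SucI[OF V])
    show "continuous_on V (\<lambda>x. f (G x))"
    proof (rule continuous_on_comp_coords[where n = n and f = f and F = G and U = U])
      show "continuous_on U f" by (rule Ck_continuous[OF U Suc.prems(1)])
      show "continuous_on V (\<lambda>x. G x j)" if "j < n" for j
        by (rule Ck_continuous[OF V Suc.prems(2)[OF that]])
    qed (use G n_domain_subset[OF U] in auto)
    show "((\<lambda>t. f (G (x(i := t)))) has_field_derivative
        (\<Sum>j<n. partial j f (G x) * partial i (\<lambda>x. G x j) x)) (at (x i))" if "i < m" "x \<in> V" for i x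
      using Suc.prems Suc0 U V by (intro smooth_deriv_comp[OF U _ V G _ that(2,1)]) auto
    show "Ck k m V (\<lambda>x. \<Sum>j<n. partial j f (G x) * partial i (\<lambda>x. G x j) x)" if "i < m" for i
    proof (intro Ck_sum Ck_mult V)
      fix j assume "j \<in> {..<n}"
      then have j: "j < n" by simp
      show "Ck k m V (\<lambda>x. partial j f (G x))"
        by (rule Suc.IH[OF Ck_SucD_partial[OF U Suc.prems(1) j] Ck_Suc_imp[OF V Suc.prems(2)]])
      show "Ck k m V (partial i (\<lambda>x. G x j))"
        by (rule Ck_SucD_partial[OF V Suc.prems(2)[OF j] that])
    qed simp
  qed
qed

lemma n_domain_greater:
  fixes f :: "(nat \<Rightarrow> real) \<Rightarrow> real"
  assumes "n_domain n U" "continuous_on U f"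
  shows "n_domain n {x \<in> U. f x > c}"
proof -
  have "openin (top_of_set U) (U \<inter> f -` {c<..})"
    by (rule continuous_openin_preimage_gen[OF assms(2)]) simp
  then have "openin (top_of_set (Rn n)) (U \<inter> f -` {c<..})"
    using assms(1) unfolding n_domain_openin by (rule openin_trans)
  moreover have "U \<inter> f -` {c<..} = {x \<in> U. f x > c}" by auto
  ultimately show ?thesis by (simp only: n_domain_openin)
qed

section \<open>The implicit function theorem in one unknown\<close>

definition front :: "nat \<Rightarrow> (nat \<Rightarrow> real) \<Rightarrow> nat \<Rightarrow> real"
  where "front p x = (\<lambda>i. if i < p then x i else 0)"

lemma front_Rn [simp]: "front p x \<in> Rn p" by (simp add: front_def Rn_iff)

lemma front_id: "x \<in> Rn p \<Longrightarrow> front p x = x" by (auto simp: front_def Rn_iff)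

lemma front_apply: "i < p \<Longrightarrow> front p x i = x i" by (simp add: front_def)

lemma front_front: "p \<le> q \<Longrightarrow> front p (front q x) = front p x" by (auto simp: front_def)

lemma front_Suc_upd: "x \<in> Rn (Suc q) \<Longrightarrow> (front q x)(q := x q) = x"
  by (auto simp: front_def Rn_iff fun_eq_iff)

lemma front_upd: "x \<in> Rn q \<Longrightarrow> front q (x(q := t)) = x"
  by (auto simp: front_def Rn_iff fun_eq_iff)

text \<open>A positive derivative in the last variable makes \<open>F\<close> strictly increasing
  there. Opposite signs at two fixed levels above and below \<open>x0 q\<close> persist for nearby
  \<open>x\<close>, so the intermediate value theorem gives a zero, and monotonicity makes it the
  only one.\<close>

lemma implicit_function_1:
  assumes D: "n_domain (Suc q) D" and F: "\<And>k. Ck k (Suc q) D F" and x0: "x0 \<in> D"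
    and F0: "F x0 = 0" and pos: "partial q F x0 > 0"
  obtains A e g where "n_domain q A" "front q x0 \<in> A" "e > 0" "\<And>k. Ck k q A g"
    "\<And>x t. x \<in> A \<Longrightarrow> \<bar>t - x0 q\<bar> < e \<Longrightarrow> x(q := t) \<in> D \<and> (F (x(q := t)) = 0 \<longleftrightarrow> t = g x)"
    "\<And>x. x \<in> A \<Longrightarrow> \<bar>g x - x0 q\<bar> < e"
    "\<And>x i. x \<in> A \<Longrightarrow> i < q \<Longrightarrow>
      partial i g x = - partial i F (x(q := g x)) * inverse (partial q F (x(q := g x)))"
proof -
  have x0R: "x0 \<in> Rn (Suc q)" using n_domain_RnD[OF D x0] .
  have q: "q < Suc q" by simp
  have contq: "continuous_on D (partial q F)"
    using Ck_continuous[OF D Ck_SucD_partial[OF D F[of "Suc 0"] q]] .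
  have "n_domain (Suc q) {x \<in> D. partial q F x > 0}" by (rule n_domain_greater[OF D contq])
  moreover have "x0 \<in> {x \<in> D. partial q F x > 0}" using x0 pos by simp
  ultimately obtain r where r: "r > 0" "cube (Suc q) x0 r \<subseteq> {x \<in> D. partial q F x > 0}"
    by (rule n_domain_cubeE)
  \<comment> \<open>Half the radius, so that the closed interval of radius \<open>e\<close>, whose
    ends are evaluated, lies in the open interval of radius \<open>r\<close> where \<open>F\<close>
    is monotone.\<close>
  define e where "e = r / 2"
  have e: "e > 0" "e < r" using r(1) by (simp_all add: e_def)
  define A0 where "A0 = cube q (front q x0) r"
  have A0: "n_domain q A0" by (simp add: A0_def)
  have in_cube: "x(q := t) \<in> cube (Suc q) x0 r" if "x \<in> A0" "\<bar>t - x0 q\<bar> < r" for x t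
    using that by (auto simp: A0_def cube_def front_def less_Suc_eq Rn_iff)
  have inD: "x(q := t) \<in> D" "partial q F (x(q := t)) > 0" if "x \<in> A0" "\<bar>t - x0 q\<bar> < r" for x t
    using in_cube[OF that] r(2) by auto
  have mono: "F (x(q := s)) < F (x(q := t))"
    if x: "x \<in> A0" and st: "\<bar>s - x0 q\<bar> < r" "\<bar>t - x0 q\<bar> < r" "s < t" for x s t
  proof (rule DERIV_pos_imp_increasing[OF st(3)])
    fix u assume u: "s \<le> u" "u \<le> t"
    then have u': "\<bar>u - x0 q\<bar> < r" using st by auto
    have "((\<lambda>v. F ((x(q := u))(q := v))) has_field_derivative partial q F (x(q := u))) (at ((x(q := u)) q))"
      by (rule Ck_SucD_deriv[OF D F q inD(1)[OF x u']])
    then show "\<exists>y. ((\<lambda>v. F (x(q := v))) has_real_derivative y) (at u) \<and> y > 0"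
      using inD(2)[OF x u'] by (intro exI[of _ "partial q F (x(q := u))"]) simp
  qed
  have contF: "continuous_on D F" by (rule Ck_continuous[OF D F])
  have cont: "continuous_on A0 (\<lambda>x. F (x(q := t)))" if "\<bar>t - x0 q\<bar> < r" for t
  proof (rule continuous_on_comp_coords[where f = F and F = "\<lambda>x. x(q := t)" and n = "Suc q" and U = D])
    show "continuous_on A0 (\<lambda>x. (x(q := t)) j)" for j
      by (cases "j = q") (auto intro: continuous_on_coordinate)
    show "(\<lambda>x. x(q := t)) \<in> A0 \<rightarrow> D" using inD(1) that by blast
  qed (use contF n_domain_subset[OF D] in auto)
  \<comment> \<open>Points over which \<open>F\<close> is positive at the upper end of the window
    and negative at the lower end; both are open conditions on \<open>x\<close>.\<close>
  define A where "A = {x \<in> A0. F (x(q := x0 q + e)) > 0} \<inter> {x \<in> A0. - F (x(q := x0 q - e)) > 0}"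
  have A: "n_domain q A"
    unfolding A_def using e
    by (intro n_domain_Int n_domain_greater A0 continuous_on_minus cont) auto
  have AA0: "x \<in> A0" if "x \<in> A" for x using that by (simp add: A_def)
  have x0upd: "(front q x0)(q := x0 q) = x0" using x0R by (rule front_Suc_upd)
  have x0A0: "front q x0 \<in> A0" using r(1) by (simp add: A0_def)
  have x0A: "front q x0 \<in> A"
    using mono[OF x0A0, of "x0 q" "x0 q + e"] mono[OF x0A0, of "x0 q - e" "x0 q"] e x0A0
    by (simp add: A_def x0upd F0)
  have ex: "\<exists>t. \<bar>t - x0 q\<bar> < e \<and> F (x(q := t)) = 0" if x: "x \<in> A" for x
  proof -
    have ends: "F (x(q := x0 q + e)) > 0" "F (x(q := x0 q - e)) < 0" using x by (auto simp: A_def)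
    have "\<exists>t. x0 q - e \<le> t \<and> t \<le> x0 q + e \<and> F (x(q := t)) = 0"
    proof (rule IVT')
      show "continuous_on {x0 q - e..x0 q + e} (\<lambda>t. F (x(q := t)))"
      proof (rule continuous_on_subset[of "{x0 q - r<..<x0 q + r}"])
        show "continuous_on {x0 q - r<..<x0 q + r} (\<lambda>t. F (x(q := t)))"
        proof (rule continuous_at_imp_continuous_on, rule ballI)
          fix u assume "u \<in> {x0 q - r<..<x0 q + r}"
          then have u': "\<bar>u - x0 q\<bar> < r" by auto
          have "((\<lambda>v. F ((x(q := u))(q := v))) has_field_derivative partial q F (x(q := u))) (at ((x(q := u)) q))"
            by (rule Ck_SucD_deriv[OF D F q inD(1)[OF AA0[OF x] u']])
          then show "isCont (\<lambda>t. F (x(q := t))) u"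
            by (intro DERIV_isCont[of _ "partial q F (x(q := u))"]) simp
        qed
      qed (use e in auto)
    qed (use ends e in auto)
    then obtain t where t: "x0 q - e \<le> t" "t \<le> x0 q + e" "F (x(q := t)) = 0" by blast
    then have "t \<noteq> x0 q - e" "t \<noteq> x0 q + e" using ends by auto
    with t show ?thesis by (intro exI[of _ t]) auto
  qed
  have uniq: "s = t" if "x \<in> A" "\<bar>s - x0 q\<bar> < e" "\<bar>t - x0 q\<bar> < e" "F (x(q := s)) = 0" "F (x(q := t)) = 0" for x s t
    using mono[OF AA0[OF that(1)], of s t] mono[OF AA0[OF that(1)], of t s] that e by (cases s t rule: linorder_cases) auto
  define g where "g x = (SOME t. \<bar>t - x0 q\<bar> < e \<and> F (x(q := t)) = 0)" for x
  have g: "\<bar>g x - x0 q\<bar> < e" "F (x(q := g x)) = 0" if "x \<in> A" for x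
    using someI_ex[OF ex[OF that]] unfolding g_def by blast+
  have gr: "\<bar>g x - x0 q\<bar> < r" if "x \<in> A" for x using g(1)[OF that] e by simp
  have gD: "x(q := g x) \<in> D" if "x \<in> A" for x using inD(1)[OF AA0[OF that] gr[OF that]] .
  have g_cont: "continuous_on A g"
    unfolding continuous_on_iff_cube[OF A]
  proof (intro ballI allI impI)
    fix x and eps :: real assume x: "x \<in> A" and eps: "eps > 0"
    \<comment> \<open>The signs of \<open>F\<close> at the levels \<open>g x - d\<close> and
      \<open>g x + d\<close> persist near \<open>x\<close> and trap \<open>g y\<close> between them.
      The choice of \<open>d\<close> keeps both levels in the window and their distance from
      \<open>g x\<close> below \<open>eps\<close>.\<close>
    define d where "d = min (eps / 2) (e - \<bar>g x - x0 q\<bar>) / 2"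
    have d: "d > 0" "d < eps" "\<bar>g x + d - x0 q\<bar> < e" "\<bar>g x - d - x0 q\<bar> < e"
      using eps g(1)[OF x] by (auto simp: d_def min_def abs_if field_simps)
    let ?B = "A \<inter> ({y \<in> A0. F (y(q := g x + d)) > 0} \<inter> {y \<in> A0. - F (y(q := g x - d)) > 0})"
    have "n_domain q ?B"
      using d e by (intro n_domain_Int n_domain_greater A A0 continuous_on_minus cont) auto
    moreover have "x \<in> ?B"
      using mono[OF AA0[OF x], of "g x" "g x + d"] mono[OF AA0[OF x], of "g x - d" "g x"] d e x AA0[OF x] g[OF x]
      by auto
    ultimately obtain dd where dd: "dd > 0" "cube q x dd \<subseteq> ?B" by (rule n_domain_cubeE)
    have "\<bar>g y - g x\<bar> < eps" if y: "y \<in> ?B" for y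
    proof -
      have yA: "y \<in> A" using y by blast
      have "g y < g x + d"
      proof (rule ccontr)
        assume "\<not> g y < g x + d"
        then have "g x + d = g y \<or> g x + d < g y" by auto
        then have "F (y(q := g x + d)) \<le> F (y(q := g y))"
          using mono[OF AA0[OF yA], of "g x + d" "g y"] d e gr[OF yA] by auto
        then show False using y g(2)[OF yA] by simp
      qed
      moreover have "g y > g x - d"
      proof (rule ccontr)
        assume "\<not> g y > g x - d"
        then have "g x - d = g y \<or> g y < g x - d" by auto
        then have "F (y(q := g y)) \<le> F (y(q := g x - d))"
          using mono[OF AA0[OF yA], of "g y" "g x - d"] d e gr[OF yA] by auto
        then show False using y g(2)[OF yA] by simp
      qed
      ultimately show ?thesis using d(2) by (simp add: abs_if)
    qed
    then show "\<exists>d>0. \<forall>y\<in>cube q x d. y \<in> A \<longrightarrow> \<bar>g y - g x\<bar> < eps" using dd by blast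
  qed
  have g_deriv: "((\<lambda>t. g (x(i := t))) has_field_derivative
      - partial i F (x(q := g x)) * inverse (partial q F (x(q := g x)))) (at (x i))"
    if x: "x \<in> A" and i: "i < q" for x i
  proof -
    let ?z = "x(q := g x)"
    \<comment> \<open>A coordinate line lifted to the graph of \<open>g\<close>. Both
      \<open>F\<close> along it and \<open>F\<close> at \<open>?z\<close> vanish, and
      \<open>c\<close> moves only in the coordinates \<open>i\<close> and \<open>q\<close>, so the
      slope identity determines the difference quotient of \<open>g\<close>.\<close>
    define c where "c t = (x(i := t))(q := g (x(i := t)))" for t
    obtain a where a1: "\<forall>y\<in>Rn (Suc q). F y - F ?z = (\<Sum>i<Suc q. a i y * (y i - ?z i))"
      and a2: "\<forall>i<Suc q. \<forall>(c :: real \<Rightarrow> nat \<Rightarrow> real) G. (\<forall>j<Suc q. ((\<lambda>t. c t j) \<longlongrightarrow> ?z j) G) \<longrightarrow>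
        (\<forall>\<^sub>F t in G. c t \<in> Rn (Suc q)) \<longrightarrow> ((\<lambda>t. a i (c t)) \<longlongrightarrow> partial i F ?z) G"
      using Ck_caratheodory_tendsto[OF D F gD[OF x]] by (elim exE conjE) (rule that)
    have evA: "\<forall>\<^sub>F t in at (x i). x(i := t) \<in> A"
      using eventually_upd_in[OF A x i] by (simp add: eventually_nhds_conv_at)
    have c_D: "\<forall>\<^sub>F t in at (x i). c t \<in> D"
      using evA by eventually_elim (simp only: c_def gD)
    then have c_R: "\<forall>\<^sub>F t in at (x i). c t \<in> Rn (Suc q)"
      by eventually_elim (rule n_domain_RnD[OF D])
    have c_0: "\<forall>\<^sub>F t in at (x i). F (c t) = 0"
      using evA by eventually_elim (simp only: c_def g)
    have g_lim: "((\<lambda>t. g (x(i := t))) \<longlongrightarrow> g x) (at (x i))"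
    proof (rule tendstoI)
      fix eps :: real assume eps: "eps > 0"
      then obtain d where d: "d > 0" "\<forall>y\<in>cube q x d. y \<in> A \<longrightarrow> \<bar>g y - g x\<bar> < eps"
        using g_cont x unfolding continuous_on_iff_cube[OF A] by blast
      have "x \<in> cube q x d" using n_domain_RnD[OF A x] d(1) by simp
      then have "\<forall>\<^sub>F t in nhds (x i). x(i := t) \<in> cube q x d"
        by (intro eventually_upd_in[OF n_domain_cube _ i])
      then have "\<forall>\<^sub>F t in at (x i). x(i := t) \<in> cube q x d" by (simp add: eventually_nhds_conv_at)
      with evA show "\<forall>\<^sub>F t in at (x i). dist (g (x(i := t))) (g x) < eps"
        by eventually_elim (use d(2) in \<open>auto simp: dist_real_def simp del: fun_upd_apply\<close>)
    qed
    have c_lim: "((\<lambda>t. c t j) \<longlongrightarrow> ?z j) (at (x i))" for j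
      using g_lim by (cases "j = q"; cases "j = i") (simp_all add: c_def del: fun_upd_apply add: fun_upd_same fun_upd_other)
    have lim_i: "((\<lambda>t. a i (c t)) \<longlongrightarrow> partial i F ?z) (at (x i))"
      using i by (intro a2[rule_format] c_lim c_R) simp
    have lim_q: "((\<lambda>t. a q (c t)) \<longlongrightarrow> partial q F ?z) (at (x i))"
      by (intro a2[rule_format] c_lim c_R) simp
    have pq: "partial q F ?z > 0" using inD(2)[OF AA0[OF x] gr[OF x]] .
    have ne: "\<forall>\<^sub>F t in at (x i). a q (c t) > 0"
      using order_tendstoD(1)[OF lim_q pq] .
    have neq: "\<forall>\<^sub>F t in at (x i). t \<noteq> x i" by (simp add: eventually_at_filter)
    have "\<forall>\<^sub>F t in at (x i). - a i (c t) * inverse (a q (c t)) = (g (x(i := t)) - g x) / (t - x i)"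
      using c_R c_0 ne neq
    proof eventually_elim
      case (elim t)
      have "0 = (\<Sum>j<Suc q. a j (c t) * (c t j - ?z j))"
        using a1[rule_format, OF elim(1)] elim(2) g(2)[OF x] by simp
      also have "\<dots> = (\<Sum>j<q. a j (c t) * (c t j - ?z j)) + a q (c t) * (g (x(i := t)) - g x)"
        by (simp add: c_def)
      also have "(\<Sum>j<q. a j (c t) * (c t j - ?z j)) = (\<Sum>j<q. if j = i then a i (c t) * (t - x i) else 0)"
        by (intro sum.cong) (auto simp: c_def)
      also have "\<dots> = a i (c t) * (t - x i)" using i by simp
      finally have eq: "a q (c t) * (g (x(i := t)) - g x) = - a i (c t) * (t - x i)"
        by (simp del: fun_upd_apply)
      have "a q (c t) * ((g (x(i := t)) - g x) / (t - x i)) = - a i (c t)"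
        using elim(4) eq by (simp add: times_divide_eq_right del: fun_upd_apply)
      then show ?case using elim(3) by (simp add: field_simps del: fun_upd_apply)
    qed
    moreover have "((\<lambda>t. - a i (c t) * inverse (a q (c t))) \<longlongrightarrow>
        - partial i F ?z * inverse (partial q F ?z)) (at (x i))"
      using pq by (intro tendsto_intros lim_i lim_q) simp
    ultimately have "((\<lambda>t. (g (x(i := t)) - g x) / (t - x i)) \<longlongrightarrow>
        - partial i F ?z * inverse (partial q F ?z)) (at (x i))"
      by (rule Lim_transform_eventually[rotated])
    then show ?thesis by (simp add: has_field_derivative_iff del: fun_upd_apply)
  qed
  \<comment> \<open>The formula for the derivative involves only \<open>g\<close> and partial
    derivatives of \<open>F\<close>, so \<open>g\<close> of class \<open>k\<close> has derivatives
    of class \<open>k\<close> and is of class \<open>k + 1\<close>.\<close>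
  have "Ck k q A g" for k
  proof (induction k)
    case 0 show ?case using g_cont A by (simp add: Ck_0_iff)
  next
    case (Suc k)
    have comp: "Ck k q A (\<lambda>x. h (x(q := g x)))" if "Ck k (Suc q) D h" for h
    proof (rule Ck_comp[OF D A _ that])
      show "(\<lambda>x. x(q := g x)) \<in> A \<rightarrow> D" using gD by blast
      show "Ck k q A (\<lambda>x. (x(q := g x)) j)" for j
        using Suc.IH Ck_coordinate[OF A] by (cases "j = q") simp_all
    qed
    show ?case
    proof (rule Ck_SucI[OF A g_cont g_deriv])
      fix i assume "i < q"
      then have i: "i < Suc q" by simp
      show "Ck k q A (\<lambda>x. - partial i F (x(q := g x)) * inverse (partial q F (x(q := g x))))"
      proof (intro Ck_mult Ck_uminus Ck_inverse A comp Ck_SucD_partial[OF D F] i q)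
        show "partial q F (x(q := g x)) \<noteq> 0" if "x \<in> A" for x
          using inD(2)[OF AA0[OF that] gr[OF that]] by simp
      qed
    qed
  qed
  moreover have "partial i g x = - partial i F (x(q := g x)) * inverse (partial q F (x(q := g x)))"
    if "x \<in> A" "i < q" for x i
    unfolding partial_def[of i g] by (rule DERIV_imp_deriv[OF g_deriv[OF that]])
  moreover have "x(q := t) \<in> D \<and> (F (x(q := t)) = 0 \<longleftrightarrow> t = g x)" if "x \<in> A" "\<bar>t - x0 q\<bar> < e" for x t
    using inD(1)[OF AA0[OF that(1)], of t] that(2) e uniq[OF that(1) that(2) g(1)[OF that(1)]] g(2)[OF that(1)]
    by auto
  ultimately show thesis using A x0A e(1) g(1) by (intro that[of A e g]) auto
qed


section \<open>Smooth maps between domains\<close>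

lemma smooth_domain_mapI:
  "n_domain m V \<Longrightarrow> n_domain n U \<Longrightarrow> F \<in> V \<rightarrow> U \<Longrightarrow> (\<And>j k. j < n \<Longrightarrow> Ck k m V (\<lambda>x. F x j)) \<Longrightarrow>
    smooth_domain_map m V n U F"
  by (simp add: smooth_domain_map_def)

lemma smooth_domain_mapD:
  assumes "smooth_domain_map m V n U F"
  shows "n_domain m V" "n_domain n U" "F \<in> V \<rightarrow> U" "\<And>j k. j < n \<Longrightarrow> Ck k m V (\<lambda>x. F x j)"
  using assms by (auto simp: smooth_domain_map_def)

lemma smooth_domain_map_mem: "smooth_domain_map m V n U F \<Longrightarrow> x \<in> V \<Longrightarrow> F x \<in> U"
  using smooth_domain_mapD(3) by blast

lemma smooth_domain_map_mem_Rn: "smooth_domain_map m V n U F \<Longrightarrow> x \<in> V \<Longrightarrow> F x \<in> Rn n"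
  using smooth_domain_map_mem smooth_domain_mapD(2) n_domain_RnD by blast

text \<open>From index \<open>n\<close> on the coordinates vanish on \<open>V\<close>, so later
  arguments can range over all \<open>j\<close>.\<close>

lemma smooth_domain_map_Ck:
  assumes "smooth_domain_map m V n U F"
  shows "Ck k m V (\<lambda>x. F x j)"
proof (cases "j < n")
  case False
  show ?thesis
  proof (rule Ck_cong_imp[OF smooth_domain_mapD(1)[OF assms], of "\<lambda>x. 0"])
    show "0 = F x j" if "x \<in> V" for x
      using smooth_domain_map_mem_Rn[OF assms that] False by (simp add: Rn_iff)
  qed (simp add: smooth_domain_mapD(1)[OF assms])
qed (use smooth_domain_mapD[OF assms] in blast)

lemma smooth_domain_map_cong:
  assumes "smooth_domain_map m V n U F" "\<And>x. x \<in> V \<Longrightarrow> F x = G x"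
  shows "smooth_domain_map m V n U G"
proof (rule smooth_domain_mapI)
  show "n_domain m V" "n_domain n U" by (rule smooth_domain_mapD[OF assms(1)])+
  show "G \<in> V \<rightarrow> U"
    by (rule Pi_I) (simp add: assms(2)[symmetric] smooth_domain_map_mem[OF assms(1)])
  show "Ck k m V (\<lambda>x. G x j)" for j k
    by (rule Ck_cong_imp[OF smooth_domain_mapD(1)[OF assms(1)] _ smooth_domain_map_Ck[OF assms(1)]])
      (simp add: assms(2))
qed

lemma smooth_domain_map_restrict:
  assumes "smooth_domain_map m V n U F" "n_domain m V'" "V' \<subseteq> V" "n_domain n U'" "F \<in> V' \<rightarrow> U'"
  shows "smooth_domain_map m V' n U' F"
  using assms Ck_subset[OF assms(2) smooth_domain_mapD(1)[OF assms(1)] assms(3)] smooth_domain_map_Ck[OF assms(1)]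
  by (auto intro!: smooth_domain_mapI)

lemma smooth_domain_map_comp:
  assumes F: "smooth_domain_map m V n U F" and G: "smooth_domain_map n U l W G"
  shows "smooth_domain_map m V l W (\<lambda>x. G (F x))"
proof (rule smooth_domain_mapI)
  show "n_domain m V" "n_domain l W" "(\<lambda>x. G (F x)) \<in> V \<rightarrow> W"
    using smooth_domain_mapD(1-3)[OF F] smooth_domain_mapD(1-3)[OF G] by auto
  show "Ck k m V (\<lambda>x. G (F x) j)" for j k
    by (rule Ck_comp[OF smooth_domain_mapD(1)[OF G] smooth_domain_mapD(1,3)[OF F]
        smooth_domain_map_Ck[OF G] smooth_domain_map_Ck[OF F]])
qed

lemma smooth_domain_map_id: "n_domain m V \<Longrightarrow> n_domain m U \<Longrightarrow> V \<subseteq> U \<Longrightarrow> smooth_domain_map m V m U (\<lambda>x. x)"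
  by (rule smooth_domain_mapI) (auto intro: Ck_coordinate)

lemma smooth_domain_map_const: "n_domain m V \<Longrightarrow> n_domain n U \<Longrightarrow> u \<in> U \<Longrightarrow> smooth_domain_map m V n U (\<lambda>x. u)"
  by (rule smooth_domain_mapI) auto

lemma smooth_domain_map_front: "p \<le> m \<Longrightarrow> n_domain m V \<Longrightarrow> smooth_domain_map m V p (Rn p) (front p)"
  by (rule smooth_domain_mapI) (auto intro: Ck_coordinate simp: front_apply)

lemma smooth_preimage:
  assumes F: "smooth_domain_map m V n U F" and U': "n_domain n U'"
  shows "n_domain m {x \<in> V. F x \<in> U'}"
proof (rule n_domain_preimage[OF smooth_domain_mapD(1)[OF F] U'])
  show "continuous_on V (\<lambda>x. F x j)" for j
    by (rule Ck_continuous[OF smooth_domain_mapD(1)[OF F] smooth_domain_map_Ck[OF F]])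
  show "F \<in> V \<rightarrow> Rn n" using smooth_domain_mapD(2,3)[OF F] n_domain_subset by blast
qed

lemma smooth_partial_comp:
  assumes F: "smooth_domain_map m V n U F" and h: "Ck (Suc 0) n U h" and x: "x \<in> V" "i < m"
  shows "partial i (\<lambda>x. h (F x)) x = (\<Sum>j<n. partial j h (F x) * partial i (\<lambda>x. F x j) x)"
  by (rule partial_comp[OF smooth_domain_mapD(2)[OF F] h smooth_domain_mapD(1,3)[OF F] smooth_domain_map_Ck[OF F] x])

lemma differential_comp:
  assumes F: "smooth_domain_map m V n U F" and G: "smooth_domain_map n U l W G" and x: "x \<in> V"
  shows "differential m (\<lambda>x. G (F x)) x v = differential n G (F x) (differential m F x v)"
proof
  fix j
  have "differential m (\<lambda>x. G (F x)) x v j = (\<Sum>i<m. (\<Sum>k<n. partial k (\<lambda>y. G y j) (F x) * partial i (\<lambda>x. F x k) x) * v i)"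
    unfolding differential_def
    by (intro sum.cong refl arg_cong2[where f = "(*)"] smooth_partial_comp[OF F smooth_domain_map_Ck[OF G] x]) simp
  also have "\<dots> = (\<Sum>i<m. \<Sum>k<n. partial k (\<lambda>y. G y j) (F x) * (partial i (\<lambda>x. F x k) x * v i))"
    by (simp add: sum_distrib_right mult.assoc)
  also have "\<dots> = (\<Sum>k<n. \<Sum>i<m. partial k (\<lambda>y. G y j) (F x) * (partial i (\<lambda>x. F x k) x * v i))"
    by (rule sum.swap)
  also have "\<dots> = differential n G (F x) (differential m F x v) j"
    by (simp add: differential_def sum_distrib_left)
  finally show "differential m (\<lambda>x. G (F x)) x v j = differential n G (F x) (differential m F x v) j" .
qed

lemma differential_cong:
  assumes "n_domain m V" "x \<in> V" "\<And>y. y \<in> V \<Longrightarrow> F y = G y"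
  shows "differential m F x = differential m G x"
  unfolding differential_def
  by (intro ext sum.cong refl arg_cong2[where f = "(*)"] partial_cong[OF assms(1) _ assms(2)])
    (auto simp: assms(3))

lemma partial_coordinate: "partial i (\<lambda>y. y j) x = (if i = j then 1 else 0)"
  unfolding partial_def by (rule DERIV_imp_deriv) (auto intro!: derivative_eq_intros)

lemma partial_const: "partial i (\<lambda>y. c) x = 0"
  unfolding partial_def by simp

lemma differential_id:
  assumes "v \<in> Rn m"
  shows "differential m (\<lambda>y. y) x v = v"
proof
  fix j
  have "differential m (\<lambda>y. y) x v j = (\<Sum>i<m. if i = j then v i else 0)"
    unfolding differential_def partial_coordinate by (intro sum.cong) auto
  then show "differential m (\<lambda>y. y) x v j = v j" using assms by (simp add: Rn_iff)
qed

lemma differential_Rn: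
  assumes F: "smooth_domain_map m V n U F" and x: "x \<in> V"
  shows "differential m F x v \<in> Rn n"
  unfolding Rn_iff
proof (intro allI impI)
  fix j assume j: "n \<le> j"
  have "partial i (\<lambda>y. F y j) x = 0" if "i < m" for i
  proof -
    have "partial i (\<lambda>y. F y j) x = partial i (\<lambda>y. 0) x"
    proof (rule partial_cong[OF smooth_domain_mapD(1)[OF F] _ x that])
      fix y assume "y \<in> V"
      then have "F y \<in> Rn n" by (rule smooth_domain_map_mem_Rn[OF F])
      then show "F y j = 0" using j by (simp add: Rn_iff)
    qed
    then show ?thesis by (simp add: partial_const)
  qed
  then show "differential m F x v j = 0" by (simp add: differential_def)
qed

section \<open>The implicit function theorem\<close>

lemma smooth_domain_map_graph:
  assumes A: "n_domain q A" and D: "n_domain (Suc q) D" and g: "\<And>k. Ck k q A g"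
    and gD: "\<And>x. x \<in> A \<Longrightarrow> x(q := g x) \<in> D"
  shows "smooth_domain_map q A (Suc q) D (\<lambda>x. x(q := g x))"
proof (rule smooth_domain_mapI[OF A D])
  show "Ck k q A (\<lambda>x. (x(q := g x)) j)" for j k
    using g Ck_coordinate[OF A] by (cases "j = q") simp_all
qed (use gD in auto)

text \<open>The unknowns are eliminated one at a time, starting with the last: as the Jacobian is the
  identity, the eliminated coordinate has vanishing derivatives in the remaining unknowns, so the
  reduced system is again normalised.\<close>

lemma implicit_function_normalised:
  assumes "n_domain (p + n) D" and "\<And>a k. a < n \<Longrightarrow> Ck k (p + n) D (F a)" and "x0 \<in> D"
    and "\<And>a. a < n \<Longrightarrow> F a x0 = 0"
    and "\<And>a b. a < n \<Longrightarrow> b < n \<Longrightarrow> partial (p + b) (F a) x0 = (if a = b then 1 else 0)"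
  shows "\<exists>A E G. smooth_domain_map p A (p + n) E G \<and> front p x0 \<in> A \<and> x0 \<in> E \<and> E \<subseteq> D \<and>
    (\<forall>x\<in>A. front p (G x) = x) \<and>
    (\<forall>x\<in>E. front p x \<in> A \<and> ((\<forall>a<n. F a x = 0) \<longleftrightarrow> x = G (front p x)))"
  using assms
proof (induction n arbitrary: D F x0)
  case 0
  then have *: "front p x = x" if "x \<in> D" for x using n_domain_RnD[OF 0(1)] that by (intro front_id) simp
  show ?case
    by (rule exI[of _ D], rule exI[of _ D], rule exI[of _ "\<lambda>x. x"])
      (use 0 * in \<open>auto intro: smooth_domain_map_id\<close>)
next
  case (Suc n)
  define q where "q = p + n"
  have D: "n_domain (Suc q) D" using Suc.prems(1) by (simp add: q_def)
  have FC: "Ck k (Suc q) D (F a)" if "a < Suc n" for a k using Suc.prems(2)[OF that] by (simp add: q_def)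
  have pq: "partial q (F n) x0 = 1" using Suc.prems(5)[of n n] by (simp add: q_def)
  obtain A1 e g where A1: "n_domain q A1" "front q x0 \<in> A1" "e > 0" "\<And>k. Ck k q A1 g"
    and sol: "\<And>x t. x \<in> A1 \<Longrightarrow> \<bar>t - x0 q\<bar> < e \<Longrightarrow> x(q := t) \<in> D \<and> (F n (x(q := t)) = 0 \<longleftrightarrow> t = g x)"
    and ge: "\<And>x. x \<in> A1 \<Longrightarrow> \<bar>g x - x0 q\<bar> < e"
    and dg: "\<And>x i. x \<in> A1 \<Longrightarrow> i < q \<Longrightarrow>
      partial i g x = - partial i (F n) (x(q := g x)) * inverse (partial q (F n) (x(q := g x)))"
    using implicit_function_1[OF D FC[of n] Suc.prems(3), of thesis] Suc.prems(4)[of n] pq by (metis lessI zero_less_one)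
  \<comment> \<open>\<open>Gam\<close> parametrises the zeros of the last equation by the other
    coordinates; composing with it leaves a system of \<open>n\<close> equations in one variable
    fewer.\<close>
  define Gam where "Gam x = x(q := g x)" for x
  have GamD: "Gam x \<in> D" "F n (Gam x) = 0" if "x \<in> A1" for x
    using sol[OF that ge[OF that]] by (simp_all add: Gam_def)
  have Gam: "smooth_domain_map q A1 (Suc q) D Gam"
    unfolding Gam_def by (rule smooth_domain_map_graph[OF A1(1) D A1(4)]) (use GamD in \<open>simp add: Gam_def\<close>)
  have x0R: "x0 \<in> Rn (Suc q)" using n_domain_RnD[OF D Suc.prems(3)] .
  have g0: "g (front q x0) = x0 q"
    using sol[OF A1(2), of "x0 q"] A1(3) Suc.prems(4)[of n] front_Suc_upd[OF x0R] by simp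
  then have Gam0: "Gam (front q x0) = x0" using front_Suc_upd[OF x0R] by (simp add: Gam_def)
  have partial_g: "partial (p + b) g (front q x0) = 0" if "b < n" for b
    using dg[OF A1(2), of "p + b"] Gam0 Suc.prems(5)[of n b] that by (simp add: q_def Gam_def)
  have "\<exists>A E G. smooth_domain_map p A (p + n) E G \<and> front p (front q x0) \<in> A \<and> front q x0 \<in> E \<and> E \<subseteq> A1 \<and>
    (\<forall>x\<in>A. front p (G x) = x) \<and>
    (\<forall>x\<in>E. front p x \<in> A \<and> ((\<forall>a<n. F a (Gam x) = 0) \<longleftrightarrow> x = G (front p x)))"
  proof (rule Suc.IH)
    show "n_domain (p + n) A1" "front q x0 \<in> A1" using A1 by (simp_all add: q_def)
    show "F a (Gam (front q x0)) = 0" if "a < n" for a using Suc.prems(4)[of a] that Gam0 by simp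
    show "Ck k (p + n) A1 (\<lambda>x. F a (Gam x))" if "a < n" for a k
      unfolding q_def[symmetric]
      by (rule Ck_comp[OF D A1(1) smooth_domain_mapD(3)[OF Gam] FC smooth_domain_map_Ck[OF Gam]])
        (use that in simp)
    fix a b assume a: "a < n" and b: "b < n"
    have "partial (p + b) (\<lambda>x. F a (Gam x)) (front q x0)
      = (\<Sum>j<Suc q. partial j (F a) x0 * partial (p + b) (\<lambda>x. Gam x j) (front q x0))"
      using smooth_partial_comp[OF Gam FC[of a] A1(2), of "p + b"] a b Gam0 by (simp add: q_def)
    also have "\<dots> = (\<Sum>j<Suc q. if j = p + b then partial (p + b) (F a) x0 else 0)"
    proof (intro sum.cong refl)
      fix j assume "j \<in> {..<Suc q}"
      show "partial j (F a) x0 * partial (p + b) (\<lambda>x. Gam x j) (front q x0) = (if j = p + b then partial (p + b) (F a) x0 else 0)"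
      proof (cases "j = q")
        case True
        then have "(\<lambda>x. Gam x j) = g" by (simp add: Gam_def)
        then show ?thesis using partial_g[OF b] True b by (simp add: q_def)
      next
        case False
        then have "(\<lambda>x. Gam x j) = (\<lambda>x. x j)" by (simp add: Gam_def)
        then show ?thesis by (simp add: partial_coordinate)
      qed
    qed
    also have "\<dots> = partial (p + b) (F a) x0" using b by (simp add: q_def)
    also have "\<dots> = (if a = b then 1 else 0)" using Suc.prems(5)[of a b] a b by simp
    finally show "partial (p + b) (\<lambda>x. F a (Gam x)) (front q x0) = (if a = b then 1 else 0)" .
  qed
  then obtain A E G where G: "smooth_domain_map p A q E G" and A: "front p (front q x0) \<in> A"
    and E: "front q x0 \<in> E" "E \<subseteq> A1" and frontG: "\<forall>x\<in>A. front p (G x) = x"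
    and EG: "\<forall>x\<in>E. front p x \<in> A \<and> ((\<forall>a<n. F a (Gam x) = 0) \<longleftrightarrow> x = G (front p x))"
    unfolding q_def by blast
  have pq_le: "p \<le> q" by (simp add: q_def)
  \<comment> \<open>The bound on \<open>x q - x0 q\<close> is split into two strict inequalities of
    continuous functions, to exhibit it as open. Within it, \<open>F n x = 0\<close> means exactly
    that \<open>x\<close> lies on the graph of \<open>g\<close>.\<close>
  define E' where "E' = {x \<in> D. front q x \<in> E} \<inter> ({x \<in> D. x q - x0 q > - e} \<inter> {x \<in> D. x0 q - x q > - e})"
  have E': "n_domain (Suc q) E'"
    unfolding E'_def
    by (intro n_domain_Int n_domain_greater D continuous_on_diff continuous_on_const continuous_on_coordinate
        smooth_preimage[OF smooth_domain_map_front[of q "Suc q"]] smooth_domain_mapD(2)[OF G]) simp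
  have GE: "G x \<in> E" if "x \<in> A" for x using smooth_domain_mapD(3)[OF G] that by blast
  have GA1: "G x \<in> A1" if "x \<in> A" for x using GE[OF that] E(2) by blast
  have frontGam: "front q (Gam y) = y" if "y \<in> A1" for y
    unfolding Gam_def using n_domain_RnD[OF A1(1) that] by (rule front_upd)
  have GamE': "Gam (G x) \<in> E'" if "x \<in> A" for x
    using GamD[OF GA1[OF that]] frontGam[OF GA1[OF that]] GE[OF that] ge[OF GA1[OF that]]
    by (auto simp: E'_def Gam_def)
  have sm: "smooth_domain_map p A (Suc q) E' (\<lambda>x. Gam (G x))"
  proof -
    have "smooth_domain_map p A q A1 G"
      by (rule smooth_domain_map_restrict[OF G smooth_domain_mapD(1)[OF G] order_refl A1(1)]) (use GA1 in blast)
    then have "smooth_domain_map p A (Suc q) D (\<lambda>x. Gam (G x))"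
      by (rule smooth_domain_map_comp[OF _ Gam])
    then show ?thesis
      by (rule smooth_domain_map_restrict[OF _ smooth_domain_mapD(1)[OF G] order_refl E']) (use GamE' in blast)
  qed
  have sol': "front p x \<in> A \<and> ((\<forall>a<Suc n. F a x = 0) \<longleftrightarrow> x = Gam (G (front p x)))" if x: "x \<in> E'" for x
  proof -
    have x': "x \<in> D" "front q x \<in> E" "\<bar>x q - x0 q\<bar> < e" using x by (auto simp: E'_def)
    have xR: "x \<in> Rn (Suc q)" using n_domain_RnD[OF D x'(1)] .
    have cx: "front p (front q x) = front p x" using pq_le by (rule front_front)
    then have cA: "front p x \<in> A" using EG x'(2) by metis
    have A1x: "front q x \<in> A1" using x'(2) E(2) by blast
    have n0: "F n x = 0 \<longleftrightarrow> x = Gam (front q x)"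
    proof -
      have "F n x = 0 \<longleftrightarrow> x q = g (front q x)"
        using sol[OF A1x x'(3)] front_Suc_upd[OF xR] by simp
      also have "\<dots> \<longleftrightarrow> x = Gam (front q x)"
        using front_Suc_upd[OF xR] unfolding Gam_def by (metis fun_upd_same)
      finally show ?thesis .
    qed
    have rest: "(\<forall>a<n. F a (Gam (front q x)) = 0) \<longleftrightarrow> front q x = G (front p x)"
      using EG x'(2) cx by metis
    have "(\<forall>a<Suc n. F a x = 0) \<longleftrightarrow> F n x = 0 \<and> (\<forall>a<n. F a x = 0)" by (auto simp: less_Suc_eq)
    also have "\<dots> \<longleftrightarrow> x = Gam (front q x) \<and> front q x = G (front p x)" using n0 rest by metis
    also have "\<dots> \<longleftrightarrow> x = Gam (G (front p x))" using frontGam[OF GA1[OF cA]] by metis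
    finally show ?thesis using cA by simp
  qed
  show ?case
  proof (intro exI conjI ballI)
    show "smooth_domain_map p A (p + Suc n) E' (\<lambda>x. Gam (G x))" using sm by (simp add: q_def)
    show "front p x0 \<in> A" using A front_front[OF pq_le] by simp
    show "x0 \<in> E'" using E(1) Suc.prems(3) A1(3) by (simp add: E'_def)
    show "E' \<subseteq> D" by (auto simp: E'_def)
    show "front p (Gam (G x)) = x" if "x \<in> A" for x
      using frontG that frontGam[OF GA1[OF that]] front_front[OF pq_le, of "Gam (G x)"] by simp
    show "front p x \<in> A" if "x \<in> E'" for x using sol'[OF that] by blast
    show "(\<forall>a<Suc n. F a x = 0) \<longleftrightarrow> x = Gam (G (front p x))" if "x \<in> E'" for x using sol'[OF that] by blast
  qed
qed

section \<open>Systems whose Jacobian in the unknowns is invertible\<close>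

lemma partial_sum_mult:
  fixes l :: nat
  assumes U: "n_domain n U" and F: "\<And>c. c < l \<Longrightarrow> Ck (Suc 0) n U (F c)" and x: "x \<in> U" and i: "i < n"
  shows "partial i (\<lambda>y. \<Sum>c<l. b c * F c y) x = (\<Sum>c<l. b c * partial i (F c) x)"
  unfolding partial_def[of i "\<lambda>y. \<Sum>c<l. b c * F c y"]
  by (intro DERIV_imp_deriv DERIV_sum DERIV_cmult Ck_SucD_deriv[OF U F i x]) simp

text \<open>\<open>b\<close> is an \<open>n\<close> by \<open>l\<close> matrix and \<open>J\<close>
  an \<open>l\<close> by \<open>n\<close> matrix. The first clause makes \<open>b\<close> surjective
  onto \<open>\<real>\<^sup>n\<close>, the second makes it injective on
  \<open>\<real>\<^sup>l\<close>; together they encode invertibility with no mention of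
  \<open>n = l\<close>.\<close>

definition inverse_matrix :: "nat \<Rightarrow> nat \<Rightarrow> (nat \<Rightarrow> nat \<Rightarrow> real) \<Rightarrow> (nat \<Rightarrow> nat \<Rightarrow> real) \<Rightarrow> bool"
  where "inverse_matrix n l b J \<longleftrightarrow>
    (\<forall>a<n. \<forall>i<n. (\<Sum>c<l. b a c * J c i) = (if a = i then 1 else 0)) \<and>
    (\<forall>v. (\<forall>a<n. (\<Sum>c<l. b a c * v c) = 0) \<longrightarrow> (\<forall>c<l. v c = 0))"

text \<open>A left inverse \<open>b\<close> of the Jacobian in the last \<open>n\<close> coordinates, injective on \<open>\<real>\<^sup>l\<close>, turns the
  \<open>l\<close> equations into \<open>n\<close> normalised ones, so that \<open>n = l\<close> need not be known.\<close>

lemma implicit_function: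
  assumes D: "n_domain (p + n) D" and F: "\<And>c k. c < l \<Longrightarrow> Ck k (p + n) D (F c)" and x0: "x0 \<in> D"
    and F0: "\<And>c. c < l \<Longrightarrow> F c x0 = 0"
    and inv: "inverse_matrix n l b (\<lambda>c i. partial (p + i) (F c) x0)"
  obtains A E G where "smooth_domain_map p A (p + n) E G" "front p x0 \<in> A" "x0 \<in> E" "E \<subseteq> D"
    "\<And>x. x \<in> A \<Longrightarrow> front p (G x) = x" "\<And>x. x \<in> E \<Longrightarrow> front p x \<in> A"
    "\<And>x. x \<in> E \<Longrightarrow> (\<forall>c<l. F c x = 0) \<longleftrightarrow> x = G (front p x)"
proof -
  have eq: "(\<forall>a<n. (\<Sum>c<l. b a c * F c x) = 0) \<longleftrightarrow> (\<forall>c<l. F c x = 0)" for x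
    using inv[unfolded inverse_matrix_def, THEN conjunct2, THEN spec, of "\<lambda>c. F c x"] by auto
  have "\<exists>A E G. smooth_domain_map p A (p + n) E G \<and> front p x0 \<in> A \<and> x0 \<in> E \<and> E \<subseteq> D \<and>
    (\<forall>x\<in>A. front p (G x) = x) \<and>
    (\<forall>x\<in>E. front p x \<in> A \<and> ((\<forall>a<n. (\<Sum>c<l. b a c * F c x) = 0) \<longleftrightarrow> x = G (front p x)))"
  proof (rule implicit_function_normalised[OF D _ x0])
    show "Ck k (p + n) D (\<lambda>x. \<Sum>c<l. b a c * F c x)" for a k
      by (intro Ck_sum Ck_mult Ck_const D F finite_lessThan) simp_all
    show "(\<Sum>c<l. b a c * F c x0) = 0" for a by (simp add: F0)
    show "partial (p + i) (\<lambda>x. \<Sum>c<l. b a c * F c x) x0 = (if a = i then 1 else 0)" if "a < n" "i < n" for a i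
      using partial_sum_mult[OF D F x0, where i = "p + i" and b = "b a"] inv that by (simp add: inverse_matrix_def)
  qed
  then show thesis unfolding eq using that by blast
qed

section \<open>Plots and lifts of plots\<close>

text \<open>Axiom D2 together with the typing of plots. The arguments about lifts run on this
  fragment, which is checked directly for domains and products.\<close>

definition precomp_closed :: "'a dspace \<Rightarrow> bool"
  where "precomp_closed X \<longleftrightarrow> plots X \<subseteq> parametrizations (points X) \<and>
    (\<forall>n U P m V F. (n, U, P) \<in> plots X \<longrightarrow> smooth_domain_map m V n U F \<longrightarrow> (m, V, compose V P F) \<in> plots X)"

lemma diffeological_space_precomp_closed: "diffeological_space X \<Longrightarrow> precomp_closed X"
  by (simp add: diffeological_space_def diffeology_def precomp_closed_def)

lemma plots_n_domain: "precomp_closed X \<Longrightarrow> (n, U, P) \<in> plots X \<Longrightarrow> n_domain n U"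
  by (auto simp: precomp_closed_def parametrizations_def)

lemma plots_funcset: "precomp_closed X \<Longrightarrow> (n, U, P) \<in> plots X \<Longrightarrow> P \<in> U \<rightarrow>\<^sub>E points X"
  by (auto simp: precomp_closed_def parametrizations_def)

lemma plots_mem: "precomp_closed X \<Longrightarrow> (n, U, P) \<in> plots X \<Longrightarrow> u \<in> U \<Longrightarrow> P u \<in> points X"
  using plots_funcset by (rule PiE_mem)

lemma plots_restrict_eq: "precomp_closed X \<Longrightarrow> (n, U, P) \<in> plots X \<Longrightarrow> restrict P U = P"
  using plots_funcset PiE_restrict by metis

lemma plots_precomp:
  "precomp_closed X \<Longrightarrow> (n, U, P) \<in> plots X \<Longrightarrow> smooth_domain_map m V n U F \<Longrightarrow> (m, V, \<lambda>r\<in>V. P (F r)) \<in> plots X"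
  unfolding precomp_closed_def compose_def by blast

lemma plots_restrict:
  "precomp_closed X \<Longrightarrow> (n, U, P) \<in> plots X \<Longrightarrow> n_domain n V \<Longrightarrow> V \<subseteq> U \<Longrightarrow> (n, V, restrict P V) \<in> plots X"
  by (rule plots_precomp[OF _ _ smooth_domain_map_id]) (auto intro: plots_n_domain)

text \<open>The covering axiom provides a plot through \<open>x\<close>; precomposing it with a
  constant map gives the constant plot.\<close>

lemma const_plots:
  assumes X: "diffeological_space X" and x: "x \<in> points X" and V: "n_domain m V"
  shows "(m, V, \<lambda>r\<in>V. x) \<in> plots X"
proof -
  have "(\<Union>(n, U, P)\<in>plots X. P ` U) = points X"
    using X by (simp add: diffeological_space_def diffeology_def)
  then obtain n U P u where P: "(n, U, P) \<in> plots X" "u \<in> U" "x = P u" using x by blast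
  note pc = diffeological_space_precomp_closed[OF X]
  show ?thesis
    using plots_precomp[OF pc P(1) smooth_domain_map_const[OF V plots_n_domain[OF pc P(1)] P(2)]] P(3) by simp
qed

section \<open>Plots of products, domains, subspaces and pullbacks\<close>

lemma points_prod [simp]: "points (prod_dspace X Y) = points X \<times> points Y"
  by (simp add: prod_dspace_def)

lemma plots_prod_iff:
  "(n, U, R) \<in> plots (prod_dspace X Y) \<longleftrightarrow>
    (\<exists>P Q. (n, U, P) \<in> plots X \<and> (n, U, Q) \<in> plots Y \<and> R = (\<lambda>r\<in>U. (P r, Q r)))"
  by (auto simp: prod_dspace_def)

lemma precomp_closed_prod:
  assumes X: "precomp_closed X" and Y: "precomp_closed Y"
  shows "precomp_closed (prod_dspace X Y)"
  unfolding precomp_closed_def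
proof (intro conjI allI impI subsetI)
  fix p assume p: "p \<in> plots (prod_dspace X Y)"
  obtain n U R where pe: "p = (n, U, R)" by (cases p)
  then obtain P Q where R: "(n, U, P) \<in> plots X" "(n, U, Q) \<in> plots Y" "R = (\<lambda>r\<in>U. (P r, Q r))"
    using p plots_prod_iff by blast
  then show "p \<in> parametrizations (points (prod_dspace X Y))"
    using plots_n_domain[OF X] plots_mem[OF X] plots_mem[OF Y] by (auto simp: pe parametrizations_def)
next
  fix n U R m V F
  assume "(n, U, R) \<in> plots (prod_dspace X Y)" and F: "smooth_domain_map m V n U F"
  then obtain P Q where R: "(n, U, P) \<in> plots X" "(n, U, Q) \<in> plots Y" "R = (\<lambda>r\<in>U. (P r, Q r))"
    using plots_prod_iff by blast
  have "compose V R F = (\<lambda>r\<in>V. ((\<lambda>r\<in>V. P (F r)) r, (\<lambda>r\<in>V. Q (F r)) r))"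
    using smooth_domain_map_mem[OF F] by (auto simp: compose_def R(3) fun_eq_iff)
  then show "(m, V, compose V R F) \<in> plots (prod_dspace X Y)"
    unfolding plots_prod_iff using plots_precomp[OF X R(1) F] plots_precomp[OF Y R(2) F] by blast
qed

lemma points_domain [simp]: "points (domain_dspace n U) = U"
  by (simp add: domain_dspace_def)

lemma plots_domain_iff:
  "(m, V, F) \<in> plots (domain_dspace n U) \<longleftrightarrow> F \<in> extensional V \<and> smooth_domain_map m V n U F"
  by (simp add: domain_dspace_def)

lemma plots_domainI: "smooth_domain_map m V n U F \<Longrightarrow> (m, V, restrict F V) \<in> plots (domain_dspace n U)"
  by (auto simp: plots_domain_iff intro: smooth_domain_map_cong)

lemma precomp_closed_domain: "precomp_closed (domain_dspace n U)"
  unfolding precomp_closed_def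
proof (intro conjI allI impI subsetI)
  fix p assume p: "p \<in> plots (domain_dspace n U)"
  obtain m V F where "p = (m, V, F)" by (cases p)
  then show "p \<in> parametrizations (points (domain_dspace n U))"
    using p by (auto simp: plots_domain_iff parametrizations_def PiE_def
        dest: smooth_domain_mapD(1) smooth_domain_map_mem)
next
  fix m V F l W G
  assume "(m, V, F) \<in> plots (domain_dspace n U)" and G: "smooth_domain_map l W m V G"
  then show "(l, W, compose W F G) \<in> plots (domain_dspace n U)"
    unfolding compose_def by (intro plots_domainI smooth_domain_map_comp[OF G]) (simp add: plots_domain_iff)
qed

lemma points_subspace [simp]: "points (subspace_of X A) = A"
  by (simp add: subspace_of_def)

lemma plots_subspace_iff: "(n, U, P) \<in> plots (subspace_of X A) \<longleftrightarrow> (n, U, P) \<in> plots X \<and> P ` U \<subseteq> A"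
  by (simp add: subspace_of_def)

lemma points_pullback: "points (pullback_dspace Z X g f) = {(z, x) \<in> points Z \<times> points X. g z = f x}"
  by (simp add: pullback_dspace_def)

lemma plots_pullback_iff:
  assumes "precomp_closed Z" "precomp_closed X"
  shows "(m, V, R) \<in> plots (pullback_dspace Z X g f) \<longleftrightarrow>
    (\<exists>F s. (m, V, F) \<in> plots Z \<and> (m, V, s) \<in> plots X \<and> R = (\<lambda>r\<in>V. (F r, s r)) \<and> (\<forall>r\<in>V. g (F r) = f (s r)))"
  (is "?l \<longleftrightarrow> ?r")
proof
  assume ?l
  then have R: "(m, V, R) \<in> plots (prod_dspace Z X)" "R ` V \<subseteq> {(z, x) \<in> points Z \<times> points X. g z = f x}"
    by (simp_all add: pullback_dspace_def plots_subspace_iff)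
  obtain F s where *: "(m, V, F) \<in> plots Z" "(m, V, s) \<in> plots X" "R = (\<lambda>r\<in>V. (F r, s r))"
    using R(1) unfolding plots_prod_iff by (elim exE conjE) (rule that)
  have "g (F r) = f (s r)" if "r \<in> V" for r
  proof -
    have "R r \<in> {(z, x) \<in> points Z \<times> points X. g z = f x}" by (rule subsetD[OF R(2) imageI[OF that]])
    then show ?thesis using *(3) that by simp
  qed
  with * show ?r by blast
next
  assume ?r
  then obtain F s where *: "(m, V, F) \<in> plots Z" "(m, V, s) \<in> plots X" "R = (\<lambda>r\<in>V. (F r, s r))"
    "\<forall>r\<in>V. g (F r) = f (s r)" by blast
  have "R ` V \<subseteq> {(z, x) \<in> points Z \<times> points X. g z = f x}"
    using *(3,4) plots_mem[OF assms(1) *(1)] plots_mem[OF assms(2) *(2)] by auto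
  moreover have "(m, V, R) \<in> plots (prod_dspace Z X)" unfolding plots_prod_iff using * by blast
  ultimately show ?l by (simp add: pullback_dspace_def plots_subspace_iff)
qed

section \<open>Etale maps in terms of lifts\<close>

lemma dsmooth_mem: "dsmooth X Y f \<Longrightarrow> x \<in> points X \<Longrightarrow> f x \<in> points Y"
  by (auto simp: dsmooth_def)

lemma dsmooth_plots: "dsmooth X Y f \<Longrightarrow> (n, U, P) \<in> plots X \<Longrightarrow> (n, U, \<lambda>r\<in>U. f (P r)) \<in> plots Y"
  unfolding dsmooth_def compose_def by blast

text \<open>The graph of such an \<open>s\<close> is a local section of the pullback of
  \<open>f\<close> by \<open>P\<close>, through the prescribed point \<open>(u, x)\<close>.\<close>

definition lifts_exist :: "'a dspace \<Rightarrow> 'b dspace \<Rightarrow> ('a \<Rightarrow> 'b) \<Rightarrow> bool"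
  where "lifts_exist X Y f \<longleftrightarrow> (\<forall>n U P u x. (n, U, P) \<in> plots Y \<longrightarrow> u \<in> U \<longrightarrow> x \<in> points X \<longrightarrow> f x = P u \<longrightarrow>
    (\<exists>V s. (n, V, s) \<in> plots X \<and> u \<in> V \<and> V \<subseteq> U \<and> s u = x \<and> (\<forall>r\<in>V. f (s r) = P r)))"

text \<open>\<open>s\<close> and \<open>t\<close> are two lifts of one plot, namely their common
  composite with \<open>f\<close>, which is left unnamed.\<close>

definition lifts_unique :: "'a dspace \<Rightarrow> ('a \<Rightarrow> 'b) \<Rightarrow> bool"
  where "lifts_unique X f \<longleftrightarrow> (\<forall>n U s t u. (n, U, s) \<in> plots X \<longrightarrow> (n, U, t) \<in> plots X \<longrightarrow> u \<in> U \<longrightarrow>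
    s u = t u \<longrightarrow> (\<forall>r\<in>U. f (s r) = f (t r)) \<longrightarrow>
    (\<exists>V. n_domain n V \<and> u \<in> V \<and> V \<subseteq> U \<and> (\<forall>r\<in>V. s r = t r)))"

text \<open>Near \<open>(u, x)\<close> the projection of the pullback to \<open>U\<close> has a
  smooth inverse. Its first component is the identity, and its second component is the lift.\<close>

lemma etale_lifts_exist:
  assumes X: "precomp_closed X" and Y: "precomp_closed Y" and f: "diffeological_etale X Y f"
  shows "lifts_exist X Y f"
  unfolding lifts_exist_def
proof (intro allI impI)
  fix n U P u x
  assume P: "(n, U, P) \<in> plots Y" and u: "u \<in> U" and x: "x \<in> points X" "f x = P u"
  have U: "n_domain n U" by (rule plots_n_domain[OF Y P])
  let ?Z = "domain_dspace n U"
  let ?B = "pullback_dspace ?Z X P f"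
  have "etale ?B ?Z fst" using f P unfolding diffeological_etale_def by blast
  moreover have "(u, x) \<in> points ?B" using u x by (simp add: points_pullback)
  ultimately obtain A V where A: "(u, x) \<in> A" and V: "D_open ?Z V" "fst (u, x) \<in> V"
    and diff: "diffeomorphism (subspace_of ?B A) (subspace_of ?Z V) fst"
    unfolding etale_def by blast
  define g where "g = inv_into A (fst :: (nat \<Rightarrow> real) \<times> 'a \<Rightarrow> _)"
  have bij: "bij_betw fst A V" and g: "dsmooth (subspace_of ?Z V) (subspace_of ?B A) g"
    using diff by (simp_all add: diffeomorphism_def g_def)
  \<comment> \<open>Testing with the identity plot shows that a D-open subset of a domain is open in
    the ordinary sense.\<close>
  have id: "(n, U, \<lambda>r\<in>U. r) \<in> plots ?Z" by (intro plots_domainI smooth_domain_map_id U) simp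
  have VU: "V \<subseteq> U" using V(1) by (simp add: D_open_def)
  have "n_domain n {r \<in> U. (\<lambda>r\<in>U. r) r \<in> V}" using V(1) id unfolding D_open_def by blast
  moreover have "{r \<in> U. (\<lambda>r\<in>U. r) r \<in> V} = V" using VU by auto
  ultimately have Vd: "n_domain n V" by simp
  have "(n, V, \<lambda>r\<in>V. r) \<in> plots (subspace_of ?Z V)"
    unfolding plots_subspace_iff using VU by (auto intro!: plots_domainI smooth_domain_map_id Vd U)
  then have "(n, V, \<lambda>r\<in>V. g ((\<lambda>r\<in>V. r) r)) \<in> plots (subspace_of ?B A)" by (rule dsmooth_plots[OF g])
  then have "(n, V, \<lambda>r\<in>V. g ((\<lambda>r\<in>V. r) r)) \<in> plots ?B" by (simp add: plots_subspace_iff)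
  then obtain F s where Fs: "(n, V, s) \<in> plots X" "(\<lambda>r\<in>V. g ((\<lambda>r\<in>V. r) r)) = (\<lambda>r\<in>V. (F r, s r))"
     "\<forall>r\<in>V. P (F r) = f (s r)"
    using plots_pullback_iff[OF precomp_closed_domain X] by blast
  have gF: "g r = (F r, s r)" if "r \<in> V" for r
    using fun_cong[OF Fs(2), of r] that by simp
  have "F r = r" if "r \<in> V" for r
    using bij_betw_inv_into_right[OF bij that] gF[OF that] by (simp add: g_def)
  moreover have uV: "u \<in> V" using V(2) by simp
  moreover have "g u = (u, x)"
    using bij_betw_inv_into_left[OF bij A] by (simp add: g_def)
  ultimately have "s u = x" "\<forall>r\<in>V. f (s r) = P r" using gF Fs(3) by auto
  then show "\<exists>V s. (n, V, s) \<in> plots X \<and> u \<in> V \<and> V \<subseteq> U \<and> s u = x \<and> (\<forall>r\<in>V. f (s r) = P r)"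
    using Fs(1) uV VU by blast
qed

text \<open>The graphs of \<open>s\<close> and \<open>t\<close> are plots of the pullback through
  the same point. D-openness of the sheet \<open>A\<close> keeps both in \<open>A\<close> near
  \<open>u\<close>, and the projection is injective on \<open>A\<close>.\<close>

lemma etale_lifts_unique:
  assumes X: "precomp_closed X" and f: "diffeological_etale X Y f"
  shows "lifts_unique X f"
  unfolding lifts_unique_def
proof (intro allI impI)
  fix n U s t u
  assume s: "(n, U, s) \<in> plots X" and t: "(n, U, t) \<in> plots X" and u: "u \<in> U" and st: "s u = t u"
    and eq: "\<forall>r\<in>U. f (s r) = f (t r)"
  have U: "n_domain n U" by (rule plots_n_domain[OF X s])
  define P where "P = (\<lambda>r\<in>U. f (s r))"
  have "dsmooth X Y f" using f by (simp add: diffeological_etale_def)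
  then have P: "(n, U, P) \<in> plots Y" unfolding P_def using s by (rule dsmooth_plots)
  let ?Z = "domain_dspace n U"
  let ?B = "pullback_dspace ?Z X P f"
  have "etale ?B ?Z fst" using f P unfolding diffeological_etale_def by blast
  moreover have "(u, s u) \<in> points ?B" using u plots_mem[OF X s u] by (simp add: points_pullback P_def)
  ultimately obtain A V where A: "(u, s u) \<in> A" "D_open ?B A"
    and diff: "diffeomorphism (subspace_of ?B A) (subspace_of ?Z V) fst"
    unfolding etale_def by blast
  have inj: "inj_on fst A" using diff by (simp add: diffeomorphism_def bij_betw_def)
  have "(n, U, \<lambda>r\<in>U. r) \<in> plots ?Z" by (intro plots_domainI smooth_domain_map_id U) simp
  then have "(n, U, \<lambda>r\<in>U. ((\<lambda>r\<in>U. r) r, h r)) \<in> plots ?B"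
    if "(n, U, h) \<in> plots X" "\<forall>r\<in>U. f (s r) = f (h r)" for h
    unfolding plots_pullback_iff[OF precomp_closed_domain X] using that
    by (intro exI[of _ "\<lambda>r\<in>U. r"] exI[of _ h]) (simp add: P_def)
  from this[OF s] this[OF t eq]
  have "n_domain n {r \<in> U. (\<lambda>r\<in>U. ((\<lambda>r\<in>U. r) r, s r)) r \<in> A}"
    "n_domain n {r \<in> U. (\<lambda>r\<in>U. ((\<lambda>r\<in>U. r) r, t r)) r \<in> A}"
    using A(2) unfolding D_open_def by blast+
  then have "n_domain n ({r \<in> U. (\<lambda>r\<in>U. ((\<lambda>r\<in>U. r) r, s r)) r \<in> A} \<inter> {r \<in> U. (\<lambda>r\<in>U. ((\<lambda>r\<in>U. r) r, t r)) r \<in> A})"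
    by (rule n_domain_Int)
  moreover have "{r \<in> U. (\<lambda>r\<in>U. ((\<lambda>r\<in>U. r) r, s r)) r \<in> A} \<inter> {r \<in> U. (\<lambda>r\<in>U. ((\<lambda>r\<in>U. r) r, t r)) r \<in> A}
      = {r \<in> U. (r, s r) \<in> A \<and> (r, t r) \<in> A}" by auto
  ultimately have "n_domain n {r \<in> U. (r, s r) \<in> A \<and> (r, t r) \<in> A}" by simp
  moreover have "s r = t r" if "(r, s r) \<in> A" "(r, t r) \<in> A" for r
    using inj_onD[OF inj _ that] by simp
  ultimately show "\<exists>V. n_domain n V \<and> u \<in> V \<and> V \<subseteq> U \<and> (\<forall>r\<in>V. s r = t r)"
    using A(1) u st by (intro exI[of _ "{r \<in> U. (r, s r) \<in> A \<and> (r, t r) \<in> A}"]) auto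
qed

text \<open>The graph \<open>A\<close> of a lift \<open>s\<close> is the sheet through the given
  point, with inverse \<open>v \<mapsto> (v, s v)\<close>. Uniqueness of lifts makes it D-open:
  where a plot \<open>(F, t)\<close> of the pullback meets \<open>A\<close>, the plots
  \<open>t\<close> and \<open>s \<circ> F\<close> lift the same plot and agree at that parameter,
  hence near it.\<close>

lemma lifts_imp_diffeological_etale:
  assumes X: "precomp_closed X" and Y: "precomp_closed Y" and f: "dsmooth X Y f"
    and ex: "lifts_exist X Y f" and un: "lifts_unique X f"
  shows "diffeological_etale X Y f"
proof -
  have "etale (pullback_dspace (domain_dspace n U) X P f) (domain_dspace n U) fst"
    if P: "(n, U, P) \<in> plots Y" for n U P
    unfolding etale_def
  proof (intro conjI ballI)
    let ?Z = "domain_dspace n U"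
    let ?B = "pullback_dspace ?Z X P f"
    have U: "n_domain n U" by (rule plots_n_domain[OF Y P])
    show "fst \<in> points ?B \<rightarrow> points ?Z" by (auto simp: points_pullback)
    fix b assume b: "b \<in> points ?B"
    then obtain u x where bux: "b = (u, x)" "u \<in> U" "x \<in> points X" "f x = P u"
      by (auto simp: points_pullback)
    obtain V s where s: "(n, V, s) \<in> plots X" "u \<in> V" "V \<subseteq> U" "s u = x" "\<forall>r\<in>V. f (s r) = P r"
      using ex P bux(2-4) unfolding lifts_exist_def by blast
    have V: "n_domain n V" by (rule plots_n_domain[OF X s(1)])
    define A where "A = (\<lambda>v. (v, s v)) ` V"
    have bij: "bij_betw fst A V" by (auto simp: A_def bij_betw_def inj_on_def image_image)
    have inv: "inv_into A fst v = (v, s v)" if "v \<in> V" for v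
      by (rule inv_into_f_eq) (use bij that in \<open>auto simp: A_def bij_betw_def\<close>)
    have AB: "A \<subseteq> points ?B" using s(3,5) plots_mem[OF X s(1)] by (auto simp: A_def points_pullback)
    have "D_open ?B A"
      unfolding D_open_def
    proof (intro conjI ballI AB)
      fix p assume p: "p \<in> plots ?B"
      obtain m W R where pe: "p = (m, W, R)" by (cases p)
      then obtain F t where R: "(m, W, F) \<in> plots ?Z" "(m, W, t) \<in> plots X" "R = (\<lambda>r\<in>W. (F r, t r))"
         "\<forall>r\<in>W. P (F r) = f (t r)"
        using p plots_pullback_iff[OF precomp_closed_domain X] by blast
      have F: "smooth_domain_map m W n U F" using R(1) by (simp add: plots_domain_iff)
      have "n_domain m {r \<in> W. R r \<in> A}"
      proof (rule n_domain_locallyI)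
        fix r0 assume "r0 \<in> {r \<in> W. R r \<in> A}"
        then have r0: "r0 \<in> W" "F r0 \<in> V" "t r0 = s (F r0)" by (auto simp: R(3) A_def)
        define W' where "W' = {r \<in> W. F r \<in> V}"
        have W': "n_domain m W'" unfolding W'_def by (rule smooth_preimage[OF F V])
        have F': "smooth_domain_map m W' n V F"
          by (rule smooth_domain_map_restrict[OF F W' _ V]) (auto simp: W'_def)
        have "(m, W', \<lambda>r\<in>W'. s (F r)) \<in> plots X" by (rule plots_precomp[OF X s(1) F'])
        moreover have "(m, W', restrict t W') \<in> plots X"
          by (rule plots_restrict[OF X R(2) W']) (auto simp: W'_def)
        moreover have "r0 \<in> W'" using r0 by (simp add: W'_def)
        moreover have "(\<lambda>r\<in>W'. s (F r)) r0 = restrict t W' r0" using r0 by (simp add: W'_def)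
        moreover have "\<forall>r\<in>W'. f ((\<lambda>r\<in>W'. s (F r)) r) = f (restrict t W' r)"
          using R(4) s(5) by (simp add: W'_def)
        ultimately obtain V' where V': "n_domain m V'" "r0 \<in> V'" "V' \<subseteq> W'"
          "\<forall>r\<in>V'. (\<lambda>r\<in>W'. s (F r)) r = restrict t W' r"
          using un unfolding lifts_unique_def by blast
        have "R r \<in> A \<and> r \<in> W" if "r \<in> V'" for r
        proof -
          have r: "r \<in> W'" using V'(3) that by blast
          then have "s (F r) = t r" using V'(4) that by auto
          with r show ?thesis by (auto simp: R(3) A_def W'_def)
        qed
        with V' show "\<exists>V. n_domain m V \<and> r0 \<in> V \<and> V \<subseteq> {r \<in> W. R r \<in> A}" by blast
      qed
      then show "case p of (n, U, P) \<Rightarrow> n_domain n {r \<in> U. P r \<in> A}" by (simp add: pe)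
    qed
    moreover have "D_open ?Z V"
      unfolding D_open_def
    proof (intro conjI ballI)
      show "V \<subseteq> points ?Z" using s(3) by simp
      fix p assume p: "p \<in> plots ?Z"
      obtain m W F where pe: "p = (m, W, F)" by (cases p)
      then have "smooth_domain_map m W n U F" using p by (simp add: plots_domain_iff)
      then have "n_domain m {r \<in> W. F r \<in> V}" using V by (rule smooth_preimage)
      then show "case p of (n, U, P) \<Rightarrow> n_domain n {r \<in> U. P r \<in> V}" by (simp add: pe)
    qed
    moreover have "diffeomorphism (subspace_of ?B A) (subspace_of ?Z V) fst"
      unfolding diffeomorphism_def dsmooth_def
    proof (intro conjI ballI)
      show "bij_betw fst (points (subspace_of ?B A)) (points (subspace_of ?Z V))" using bij by simp
      show "fst \<in> points (subspace_of ?B A) \<rightarrow> points (subspace_of ?Z V)" by (auto simp: A_def)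
      show "inv_into (points (subspace_of ?B A)) fst \<in> points (subspace_of ?Z V) \<rightarrow> points (subspace_of ?B A)"
        by (auto simp: inv) (auto simp: A_def)
    next
      fix p assume p: "p \<in> plots (subspace_of ?B A)"
      obtain m W R where pe: "p = (m, W, R)" by (cases p)
      then have R: "(m, W, R) \<in> plots ?B" "R ` W \<subseteq> A" using p by (simp_all add: plots_subspace_iff)
      obtain F t where Ft: "(m, W, F) \<in> plots ?Z" "R = (\<lambda>r\<in>W. (F r, t r))"
        using R(1) unfolding plots_pullback_iff[OF precomp_closed_domain X] by (elim exE conjE) (rule that)
      have "compose W fst R = restrict F W"
        unfolding compose_def Ft(2) by (rule restrict_ext) simp
      then have *: "compose W fst R = F" using plots_restrict_eq[OF precomp_closed_domain Ft(1)] by simp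
      have "F ` W \<subseteq> V" using R(2) by (auto simp: Ft(2) A_def)
      then show "case p of (n, U, P) \<Rightarrow> (n, U, compose U fst P) \<in> plots (subspace_of ?Z V)"
        using Ft(1) by (simp add: pe * plots_subspace_iff)
    next
      fix p assume p: "p \<in> plots (subspace_of ?Z V)"
      obtain m W F where pe: "p = (m, W, F)" by (cases p)
      then have F: "(m, W, F) \<in> plots ?Z" "F ` W \<subseteq> V" using p by (simp_all add: plots_subspace_iff)
      have Fs: "smooth_domain_map m W n U F" using F(1) by (simp add: plots_domain_iff)
      have F': "smooth_domain_map m W n V F"
        by (rule smooth_domain_map_restrict[OF Fs smooth_domain_mapD(1)[OF Fs] order_refl V]) (use F(2) in blast)
      have sF: "(m, W, \<lambda>r\<in>W. s (F r)) \<in> plots X" by (rule plots_precomp[OF X s(1) F'])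
      have FV: "F r \<in> V" if "r \<in> W" for r using F(2) that by blast
      have *: "compose W (inv_into A fst) F = (\<lambda>r\<in>W. (F r, (\<lambda>r\<in>W. s (F r)) r))"
        unfolding compose_def by (rule restrict_ext) (simp add: inv FV)
      have "(m, W, compose W (inv_into A fst) F) \<in> plots ?B"
        unfolding plots_pullback_iff[OF precomp_closed_domain X] *
        using F(1) sF s(5) FV by (intro exI[of _ F] exI[of _ "\<lambda>r\<in>W. s (F r)"]) auto
      moreover have "compose W (inv_into A fst) F ` W \<subseteq> A" unfolding * using FV by (auto simp: A_def)
      ultimately show "case p of (n, U, P) \<Rightarrow> (n, U, compose U (inv_into (points (subspace_of ?B A)) fst) P)
          \<in> plots (subspace_of ?B A)"
        by (simp add: pe plots_subspace_iff)
    qed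
    moreover have "b \<in> A" "fst b \<in> V" using s(2,4) by (auto simp: bux(1) A_def)
    ultimately show "\<exists>A B. D_open ?B A \<and> b \<in> A \<and> D_open ?Z B \<and> fst b \<in> B \<and>
        diffeomorphism (subspace_of ?B A) (subspace_of ?Z B) fst" by blast
  qed
  then show ?thesis using f by (auto simp: diffeological_etale_def)
qed

section \<open>Centered charts\<close>

text \<open>Of an etale chart only the lifting of plots through the base point is kept; it is stated with
  smooth maps into \<open>U\<close> in place of plots of the domain.\<close>

definition chart :: "nat \<Rightarrow> 'a dspace \<Rightarrow> 'a \<Rightarrow> (nat \<Rightarrow> real) set \<Rightarrow> ((nat \<Rightarrow> real) \<Rightarrow> 'a) \<Rightarrow> bool"
  where "chart n X x U \<phi> \<longleftrightarrow> (n, U, \<phi>) \<in> centered_plots X x \<and>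
    (\<forall>m V P u. (m, V, P) \<in> plots X \<longrightarrow> u \<in> V \<longrightarrow> P u = x \<longrightarrow>
      (\<exists>W G. smooth_domain_map m W n U G \<and> u \<in> W \<and> W \<subseteq> V \<and> G u = origin \<and> (\<forall>r\<in>W. P r = \<phi> (G r)))) \<and>
    (\<forall>m W G H u. smooth_domain_map m W n U G \<longrightarrow> smooth_domain_map m W n U H \<longrightarrow> u \<in> W \<longrightarrow>
      G u = origin \<longrightarrow> H u = origin \<longrightarrow> (\<forall>r\<in>W. \<phi> (G r) = \<phi> (H r)) \<longrightarrow>
      (\<exists>W'. n_domain m W' \<and> u \<in> W' \<and> W' \<subseteq> W \<and> (\<forall>r\<in>W'. G r = H r)))"

lemma chart_centered: "chart n X x U \<phi> \<Longrightarrow> (n, U, \<phi>) \<in> centered_plots X x"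
  by (simp add: chart_def)

lemma chart_plot:
  assumes "chart n X x U \<phi>"
  shows "(n, U, \<phi>) \<in> plots X" "origin \<in> U" "\<phi> origin = x"
  using chart_centered[OF assms] by (simp_all add: centered_plots_def)

lemma chart_lift:
  assumes "chart n X x U \<phi>" "(m, V, P) \<in> plots X" "u \<in> V" "P u = x"
  obtains W G where "smooth_domain_map m W n U G" "u \<in> W" "W \<subseteq> V" "G u = origin" "\<And>r. r \<in> W \<Longrightarrow> P r = \<phi> (G r)"
proof -
  have "\<exists>W G. smooth_domain_map m W n U G \<and> u \<in> W \<and> W \<subseteq> V \<and> G u = origin \<and> (\<forall>r\<in>W. P r = \<phi> (G r))"
    by (rule assms(1)[unfolded chart_def, THEN conjunct2, THEN conjunct1, rule_format, OF assms(2-4)])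
  then show thesis by (elim exE conjE) (rule that, assumption+, simp)
qed

lemma chart_lift_unique:
  assumes "chart n X x U \<phi>" "smooth_domain_map m W n U G" "smooth_domain_map m W n U H" "u \<in> W"
    "G u = origin" "H u = origin" "\<And>r. r \<in> W \<Longrightarrow> \<phi> (G r) = \<phi> (H r)"
  obtains W' where "n_domain m W'" "u \<in> W'" "W' \<subseteq> W" "\<And>r. r \<in> W' \<Longrightarrow> G r = H r"
proof -
  have "\<exists>W'. n_domain m W' \<and> u \<in> W' \<and> W' \<subseteq> W \<and> (\<forall>r\<in>W'. G r = H r)"
    by (rule assms(1)[unfolded chart_def, THEN conjunct2, THEN conjunct2, rule_format, OF assms(2-7)])
  then show thesis by (elim exE conjE) (rule that, assumption+, simp)
qed

lemma smooth_domain_map_translate: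
  assumes G: "smooth_domain_map m W n U G" and U': "n_domain n U'" "\<And>r. r \<in> W \<Longrightarrow> (\<lambda>i. G r i + c i) \<in> U'"
  shows "smooth_domain_map m W n U' (\<lambda>r i. G r i + c i)"
  by (intro smooth_domain_mapI smooth_domain_mapD(1)[OF G] U' Pi_I Ck_add smooth_domain_map_Ck[OF G] Ck_const)

lemma etale_manifold_diffeological: "etale_manifold X \<Longrightarrow> diffeological_space X"
  by (auto simp: etale_manifold_def etale_n_manifold_def)

text \<open>An etale chart reaches \<open>x\<close> at some point \<open>u1\<close>, not necessarily
  the origin. It is precomposed with the translation by \<open>u1\<close>, and lifts through it are
  shifted back by \<open>- u1\<close>.\<close>

lemma chart_exists:
  assumes X: "etale_manifold X" and x: "x \<in> points X"
  obtains n U \<phi> where "chart n X x U \<phi>"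
proof -
  note pc = diffeological_space_precomp_closed[OF etale_manifold_diffeological[OF X]]
  obtain n \<A> where \<A>: "\<forall>(U, \<phi>)\<in>\<A>. n_domain n U \<and> diffeological_etale (domain_dspace n U) X \<phi>"
      "(\<Union>(U, \<phi>)\<in>\<A>. \<phi> ` U) = points X"
    using X unfolding etale_manifold_def etale_n_manifold_def by (elim exE conjE) (rule that)
  have "x \<in> (\<Union>(U, \<phi>)\<in>\<A>. \<phi> ` U)" using x \<A>(2) by simp
  then obtain U1 \<phi>1 u1 where "(U1, \<phi>1) \<in> \<A>" and u1: "u1 \<in> U1" "\<phi>1 u1 = x" by auto
  then have U1: "n_domain n U1" and et: "diffeological_etale (domain_dspace n U1) X \<phi>1" using \<A>(1) by blast+
  have sm: "dsmooth (domain_dspace n U1) X \<phi>1" using et by (simp add: diffeological_etale_def)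
  have u1R: "u1 \<in> Rn n" by (rule n_domain_RnD[OF U1 u1(1)])
  define tr where "tr = (\<lambda>(u :: nat \<Rightarrow> real) i. u i + u1 i)"
  have trR: "smooth_domain_map n (Rn n) n (Rn n) tr"
    unfolding tr_def using u1R by (intro smooth_domain_map_translate[OF smooth_domain_map_id]) (auto simp: Rn_iff)
  define U where "U = {u \<in> Rn n. tr u \<in> U1}"
  have U: "n_domain n U" unfolding U_def by (rule smooth_preimage[OF trR U1])
  have trU: "smooth_domain_map n U n U1 tr"
    by (rule smooth_domain_map_restrict[OF trR U _ U1]) (auto simp: U_def)
  define \<phi> where "\<phi> = (\<lambda>u\<in>U. \<phi>1 (tr u))"
  have "(n, U, \<lambda>r\<in>U. \<phi>1 (restrict tr U r)) \<in> plots X"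
    by (rule dsmooth_plots[OF sm plots_domainI[OF trU]])
  moreover have "(\<lambda>r\<in>U. \<phi>1 (restrict tr U r)) = \<phi>" by (auto simp: \<phi>_def)
  moreover have tr0: "tr origin = u1" by (simp add: tr_def origin_def)
  ultimately have cent: "(n, U, \<phi>) \<in> centered_plots X x"
    using u1 by (auto simp: centered_plots_def U_def \<phi>_def)
  have "chart n X x U \<phi>"
    unfolding chart_def
  proof (intro conjI allI impI cent)
    fix m V P u assume P: "(m, V, P) \<in> plots X" "u \<in> V" "P u = x"
    obtain W s where s: "(m, W, s) \<in> plots (domain_dspace n U1)" "u \<in> W" "W \<subseteq> V" "s u = u1"
      "\<forall>r\<in>W. \<phi>1 (s r) = P r"
      using etale_lifts_exist[OF precomp_closed_domain pc et] P u1 unfolding lifts_exist_def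
      by (metis points_domain)
    have sm_s: "smooth_domain_map m W n U1 s" using s(1) by (simp add: plots_domain_iff)
    define G where "G = (\<lambda>r i. s r i + (- u1 i))"
    have trG: "tr (G r) = s r" for r by (simp add: tr_def G_def)
    have GU: "G r \<in> U" if "r \<in> W" for r
      using smooth_domain_map_mem_Rn[OF sm_s that] u1R smooth_domain_map_mem[OF sm_s that]
      by (auto simp: U_def trG) (auto simp: G_def Rn_iff)
    have "smooth_domain_map m W n U G"
      unfolding G_def by (rule smooth_domain_map_translate[OF sm_s U]) (use GU in \<open>simp add: G_def\<close>)
    moreover have "G u = origin" using s(4) by (simp add: G_def origin_def)
    moreover have "\<forall>r\<in>W. P r = \<phi> (G r)" using s(5) GU by (simp add: \<phi>_def trG)
    ultimately show "\<exists>W G. smooth_domain_map m W n U G \<and> u \<in> W \<and> W \<subseteq> V \<and> G u = origin \<and> (\<forall>r\<in>W. P r = \<phi> (G r))"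
      using s(2,3) by blast
  next
    fix m W G H u
    assume G: "smooth_domain_map m W n U G" and H: "smooth_domain_map m W n U H" and u: "u \<in> W"
      and 0: "G u = origin" "H u = origin" and eq: "\<forall>r\<in>W. \<phi> (G r) = \<phi> (H r)"
    have "(m, W, \<lambda>r\<in>W. tr (G r)) \<in> plots (domain_dspace n U1)" "(m, W, \<lambda>r\<in>W. tr (H r)) \<in> plots (domain_dspace n U1)"
      by (intro plots_domainI smooth_domain_map_comp[OF G trU] smooth_domain_map_comp[OF H trU])+
    moreover have "(\<lambda>r\<in>W. tr (G r)) u = (\<lambda>r\<in>W. tr (H r)) u" using 0 u by simp
    moreover have "\<forall>r\<in>W. \<phi>1 ((\<lambda>r\<in>W. tr (G r)) r) = \<phi>1 ((\<lambda>r\<in>W. tr (H r)) r)"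
      using eq smooth_domain_map_mem[OF G] smooth_domain_map_mem[OF H] by (auto simp: \<phi>_def)
    ultimately obtain V where V: "n_domain m V" "u \<in> V" "V \<subseteq> W"
        "\<forall>r\<in>V. (\<lambda>r\<in>W. tr (G r)) r = (\<lambda>r\<in>W. tr (H r)) r"
      using etale_lifts_unique[OF precomp_closed_domain et] u unfolding lifts_unique_def by blast
    have "G r = H r" if "r \<in> V" for r
    proof -
      have "r \<in> W" using V(3) that by blast
      then have "tr (G r) = tr (H r)" using bspec[OF V(4) that] by simp
      then show ?thesis by (auto simp: tr_def fun_eq_iff)
    qed
    with V show "\<exists>W'. n_domain m W' \<and> u \<in> W' \<and> W' \<subseteq> W \<and> (\<forall>r\<in>W'. G r = H r)" by blast
  qed
  then show thesis by (rule that)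
qed

section \<open>Tangent spaces in charts\<close>

lemma subspace_tangent_relations: "subspace (tangent_relations X x)"
  by (simp add: tangent_relations_def)

lemma tangent_classI: "\<rho> \<in> tangent_relations X x \<Longrightarrow> \<xi> + \<rho> \<in> tangent_class X x \<xi>"
  by (auto simp: tangent_class_def)

lemma tangent_class_self: "\<xi> \<in> tangent_class X x \<xi>"
  using tangent_classI[OF subspace_0[OF subspace_tangent_relations], of \<xi>] by simp

lemma tangent_addI: "\<xi> \<in> A \<Longrightarrow> \<eta> \<in> B \<Longrightarrow> \<xi> + \<eta> \<in> tangent_add A B"
  by (auto simp: tangent_add_def)

lemma tangent_scaleI: "\<xi> \<in> A \<Longrightarrow> \<rho> \<in> tangent_relations X x \<Longrightarrow> c *\<^sub>R \<xi> + \<rho> \<in> tangent_scale X x c A"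
  by (auto simp: tangent_scale_def)

lemma tangent_class_eq_iff:
  "tangent_class X x \<xi> = tangent_class X x \<eta> \<longleftrightarrow> \<xi> - \<eta> \<in> tangent_relations X x"
proof
  assume eq: "tangent_class X x \<xi> = tangent_class X x \<eta>"
  have "\<xi> \<in> tangent_class X x \<xi>" by (rule tangent_class_self)
  then obtain \<rho> where "\<xi> = \<eta> + \<rho>" "\<rho> \<in> tangent_relations X x" unfolding eq by (auto simp: tangent_class_def)
  then show "\<xi> - \<eta> \<in> tangent_relations X x" by simp
next
  assume d: "\<xi> - \<eta> \<in> tangent_relations X x"
  have sub: "tangent_class X x \<alpha> \<subseteq> tangent_class X x \<beta>" if "\<alpha> - \<beta> \<in> tangent_relations X x" for \<alpha> \<beta>
  proof
    fix \<zeta> assume "\<zeta> \<in> tangent_class X x \<alpha>"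
    then obtain \<rho> where \<rho>: "\<zeta> = \<alpha> + \<rho>" "\<rho> \<in> tangent_relations X x" by (auto simp: tangent_class_def)
    have "\<zeta> = \<beta> + ((\<alpha> - \<beta>) + \<rho>)" using \<rho> by simp
    moreover have "(\<alpha> - \<beta>) + \<rho> \<in> tangent_relations X x"
      by (rule subspace_add[OF subspace_tangent_relations that \<rho>(2)])
    ultimately show "\<zeta> \<in> tangent_class X x \<beta>" using tangent_classI by metis
  qed
  have "\<eta> - \<xi> \<in> tangent_relations X x" using subspace_neg[OF subspace_tangent_relations d] by simp
  with d show "tangent_class X x \<xi> = tangent_class X x \<eta>" by (intro equalityI sub)
qed

lemma tangent_add_class:
  "tangent_add (tangent_class X x \<xi>) (tangent_class X x \<eta>) = tangent_class X x (\<xi> + \<eta>)"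
proof (intro equalityI subsetI)
  fix \<zeta> assume "\<zeta> \<in> tangent_add (tangent_class X x \<xi>) (tangent_class X x \<eta>)"
  then obtain \<rho> \<sigma> where *: "\<zeta> = (\<xi> + \<rho>) + (\<eta> + \<sigma>)" "\<rho> \<in> tangent_relations X x" "\<sigma> \<in> tangent_relations X x"
    by (auto simp: tangent_add_def tangent_class_def)
  then have "\<zeta> = (\<xi> + \<eta>) + (\<rho> + \<sigma>)" "\<rho> + \<sigma> \<in> tangent_relations X x"
    using subspace_add[OF subspace_tangent_relations] by (auto simp: algebra_simps)
  then show "\<zeta> \<in> tangent_class X x (\<xi> + \<eta>)" using tangent_classI by metis
next
  fix \<zeta> assume "\<zeta> \<in> tangent_class X x (\<xi> + \<eta>)"
  then obtain \<rho> where *: "\<zeta> = (\<xi> + \<eta>) + \<rho>" "\<rho> \<in> tangent_relations X x" by (auto simp: tangent_class_def)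
  have "\<zeta> = (\<xi> + \<rho>) + \<eta>" using * by (simp add: algebra_simps)
  then show "\<zeta> \<in> tangent_add (tangent_class X x \<xi>) (tangent_class X x \<eta>)"
    using tangent_addI[OF tangent_classI[OF *(2)] tangent_class_self] by simp
qed

lemma tangent_scale_class:
  "tangent_scale X x c (tangent_class X x \<xi>) = tangent_class X x (c *\<^sub>R \<xi>)"
proof (intro equalityI subsetI)
  fix \<zeta> assume "\<zeta> \<in> tangent_scale X x c (tangent_class X x \<xi>)"
  then obtain \<rho> \<sigma> where *: "\<zeta> = c *\<^sub>R (\<xi> + \<rho>) + \<sigma>" "\<rho> \<in> tangent_relations X x" "\<sigma> \<in> tangent_relations X x"
    by (auto simp: tangent_scale_def tangent_class_def)
  have "\<zeta> = c *\<^sub>R \<xi> + (c *\<^sub>R \<rho> + \<sigma>)" using * by (simp add: scaleR_add_right add.assoc)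
  moreover have "c *\<^sub>R \<rho> + \<sigma> \<in> tangent_relations X x"
    using * by (intro subspace_add subspace_scale subspace_tangent_relations)
  ultimately show "\<zeta> \<in> tangent_class X x (c *\<^sub>R \<xi>)" using tangent_classI by metis
next
  fix \<zeta> assume "\<zeta> \<in> tangent_class X x (c *\<^sub>R \<xi>)"
  then obtain \<rho> where *: "\<zeta> = c *\<^sub>R \<xi> + \<rho>" "\<rho> \<in> tangent_relations X x" by (auto simp: tangent_class_def)
  show "\<zeta> \<in> tangent_scale X x c (tangent_class X x \<xi>)"
    unfolding *(1) by (rule tangent_scaleI[OF tangent_class_self *(2)])
qed

section \<open>Linear functionals on the direct sum\<close>

lemma lookup_scaleR [simp]: "Poly_Mapping.lookup (c *\<^sub>R \<xi>) k = c *\<^sub>R Poly_Mapping.lookup \<xi> k"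
proof -
  have "finite {i. c *\<^sub>R Poly_Mapping.lookup \<xi> i \<noteq> 0}"
    by (rule finite_subset[OF _ finite_keys[of \<xi>]]) (auto simp: in_keys_iff)
  then show ?thesis by (simp add: scaleR_poly_mapping_def)
qed

lemma scaleR_single: "c *\<^sub>R Poly_Mapping.single k a = Poly_Mapping.single k (c * a :: real)"
  by (rule poly_mapping_eqI) (simp add: lookup_single when_def)

lemma summand_add: "summand p (\<lambda>i. v i + w i) = summand p v + summand p w"
  by (simp add: summand_def single_add sum.distrib)

lemma summand_scale: "summand p (\<lambda>i. c * v i) = c *\<^sub>R summand p v"
  by (simp add: summand_def scaleR_sum_right scaleR_single)

lemma summand_sum: "finite K \<Longrightarrow> summand p (\<lambda>i. \<Sum>k\<in>K. v k i) = (\<Sum>k\<in>K. summand p (v k))"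
  by (induction K rule: finite_induct) (simp_all add: summand_add, simp add: summand_def)

lemma summand_unit:
  assumes "i < fst p"
  shows "summand p (\<lambda>j. if j = i then a else 0) = Poly_Mapping.single (p, i) a"
proof -
  have "summand p (\<lambda>j. if j = i then a else 0) = (\<Sum>j<fst p. if j = i then Poly_Mapping.single (p, i) a else 0)"
    unfolding summand_def by (intro sum.cong) auto
  then show ?thesis using assms by simp
qed

text \<open>The vectors \<open>single k 1\<close> form a basis of the finitely supported functions;
  this is the linear functional with the prescribed value \<open>c k\<close> on each of
  them.\<close>

definition extend_linear :: "('k \<Rightarrow> real) \<Rightarrow> ('k \<Rightarrow>\<^sub>0 real) \<Rightarrow> real"
  where "extend_linear c \<xi> = (\<Sum>k\<in>Poly_Mapping.keys \<xi>. Poly_Mapping.lookup \<xi> k * c k)"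

lemma extend_linear_superset:
  "finite K \<Longrightarrow> Poly_Mapping.keys \<xi> \<subseteq> K \<Longrightarrow> extend_linear c \<xi> = (\<Sum>k\<in>K. Poly_Mapping.lookup \<xi> k * c k)"
  unfolding extend_linear_def by (rule sum.mono_neutral_left) (auto simp: in_keys_iff)

lemma linear_extend_linear: "linear (extend_linear c)"
proof (rule linearI)
  fix \<xi> \<eta> :: "'a \<Rightarrow>\<^sub>0 real"
  let ?K = "Poly_Mapping.keys \<xi> \<union> Poly_Mapping.keys \<eta>"
  have "Poly_Mapping.keys (\<xi> + \<eta>) \<subseteq> ?K" by (rule keys_add)
  then show "extend_linear c (\<xi> + \<eta>) = extend_linear c \<xi> + extend_linear c \<eta>"
    by (simp add: extend_linear_superset[of ?K] lookup_add distrib_right sum.distrib)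
next
  fix r and \<xi> :: "'a \<Rightarrow>\<^sub>0 real"
  have "Poly_Mapping.keys (r *\<^sub>R \<xi>) \<subseteq> Poly_Mapping.keys \<xi>" by (auto simp: in_keys_iff)
  then show "extend_linear c (r *\<^sub>R \<xi>) = r *\<^sub>R extend_linear c \<xi>"
    by (simp add: extend_linear_superset[of "Poly_Mapping.keys \<xi>"] sum_distrib_left mult.assoc)
qed

lemma extend_linear_single [simp]: "extend_linear c (Poly_Mapping.single k a) = a * c k"
  by (simp add: extend_linear_def)

lemma extend_linear_summand: "extend_linear c (summand p v) = (\<Sum>i<fst p. v i * c (p, i))"
  by (simp add: summand_def linear_sum[OF linear_extend_linear])

lemma poly_mapping_sum_single: "\<xi> = (\<Sum>k\<in>Poly_Mapping.keys \<xi>. Poly_Mapping.single k (Poly_Mapping.lookup \<xi> k))"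
  by (rule poly_mapping_eqI) (simp add: lookup_sum lookup_single when_def in_keys_iff)

section \<open>A chart as terminal object among the centered plots\<close>

lemma plot_morphism_comp:
  assumes "plot_morphism (m, V, Q) (n, U, P) W F" "plot_morphism (n, U, P) (l, U', P') W' G"
  shows "plot_morphism (m, V, Q) (l, U', P') {r \<in> W. F r \<in> W'} (\<lambda>r. G (F r))"
    and "differential m (\<lambda>r. G (F r)) origin v = differential n G origin (differential m F origin v)"
proof -
  have F: "smooth_domain_map m W n U F" "W \<subseteq> V" "origin \<in> W" "F origin = origin" "\<forall>r\<in>W. Q r = P (F r)"
    and G: "smooth_domain_map n W' l U' G" "W' \<subseteq> U" "origin \<in> W'" "G origin = origin" "\<forall>r\<in>W'. P r = P' (G r)"
    using assms by simp_all
  let ?W = "{r \<in> W. F r \<in> W'}"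
  have W: "n_domain m ?W" by (rule smooth_preimage[OF F(1) smooth_domain_mapD(1)[OF G(1)]])
  have F': "smooth_domain_map m ?W n W' F"
    by (rule smooth_domain_map_restrict[OF F(1) W _ smooth_domain_mapD(1)[OF G(1)]]) auto
  show "plot_morphism (m, V, Q) (l, U', P') ?W (\<lambda>r. G (F r))"
    using smooth_domain_map_comp[OF F' G(1)] F G by auto
  show "differential m (\<lambda>r. G (F r)) origin v = differential n G origin (differential m F origin v)"
    using differential_comp[OF F' G(1), of origin v] F(3,4) G(3) by simp
qed

text \<open>Together with the uniqueness of the germ, this makes the chart terminal in the category
  of plots centered at \<open>x\<close>. A colimit over a category with a terminal object is the
  value at that object, which is why the tangent space turns out to be
  \<open>\<real>\<^sup>n\<close>.\<close>

lemma chart_morphism_ex: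
  assumes "chart n X x U \<phi>" "(m, V, P) \<in> centered_plots X x"
  shows "\<exists>W G. plot_morphism (m, V, P) (n, U, \<phi>) W G"
proof -
  have P: "(m, V, P) \<in> plots X" "origin \<in> V" "P origin = x" using assms(2) by (auto simp: centered_plots_def)
  show ?thesis
    by (rule chart_lift[OF assms(1) P]) (auto intro!: exI)
qed

text \<open>Two lifts of one plot through the chart that both vanish at the origin agree near it,
  and a differential depends only on the germ.\<close>

lemma chart_morphism_differential:
  assumes c: "chart n X x U \<phi>" and F: "plot_morphism (m, V, P) (n, U, \<phi>) W F"
    and G: "plot_morphism (m, V, P) (n, U, \<phi>) W' G"
  shows "differential m F origin = differential m G origin"
proof -
  have W: "n_domain m W" "n_domain m W'" using F G smooth_domain_mapD(1) by auto
  have U: "n_domain n U" using F smooth_domain_mapD(2) by auto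
  have F': "smooth_domain_map m (W \<inter> W') n U F"
    using F by (intro smooth_domain_map_restrict[of m W n U F "W \<inter> W'"] n_domain_Int W U)
      (auto dest: smooth_domain_map_mem)
  have G': "smooth_domain_map m (W \<inter> W') n U G"
    using G by (intro smooth_domain_map_restrict[of m W' n U G "W \<inter> W'"] n_domain_Int W U)
      (auto dest: smooth_domain_map_mem)
  have *: "origin \<in> W \<inter> W'" "F origin = origin" "G origin = origin" "\<And>r. r \<in> W \<inter> W' \<Longrightarrow> \<phi> (F r) = \<phi> (G r)"
    using F G by auto
  show ?thesis
    by (rule chart_lift_unique[OF c F' G' *], assumption, rule differential_cong)
qed

lemma differential_add:
  "differential m F x (\<lambda>i. v i + w i) = (\<lambda>j. differential m F x v j + differential m F x w j)"
  by (simp add: differential_def distrib_left sum.distrib)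

lemma differential_scale: "differential m F x (\<lambda>i. c * v i) = (\<lambda>j. c * differential m F x v j)"
  by (simp add: differential_def sum_distrib_left mult.left_commute)

lemma morphism_relation:
  assumes "p \<in> centered_plots X x" "q \<in> centered_plots X x" "plot_morphism q p W F" "v \<in> Rn (fst q)"
  shows "summand q v - summand p (differential (fst q) F origin v) \<in> tangent_relations X x"
  unfolding tangent_relations_def by (rule span_base) (use assms in blast)

text \<open>The \<open>\<kappa> j\<close> are the coordinates of the inverse of the structure map of
  the chart. They are built on the direct sum by sending a vector in the summand of \<open>p\<close>
  through the differential of a lift of \<open>p\<close>, and have to be seen to vanish on the
  relations.\<close>

lemma chart_tangent_coordinates:
  assumes X: "precomp_closed X" and c: "chart n X x U \<phi>"
  obtains \<kappa> :: "nat \<Rightarrow> 'a tangent_rep \<Rightarrow> real"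
  where "\<And>j \<xi>. \<xi> \<in> tangent_relations X x \<Longrightarrow> \<kappa> j \<xi> = 0" "\<And>j. linear (\<kappa> j)"
    "\<And>v j. v \<in> Rn n \<Longrightarrow> \<kappa> j (summand (n, U, \<phi>) v) = v j"
    "\<And>\<xi>. \<xi> \<in> tangent_sum X x \<Longrightarrow> (\<lambda>j. \<kappa> j \<xi>) \<in> Rn n \<and> \<xi> - summand (n, U, \<phi>) (\<lambda>j. \<kappa> j \<xi>) \<in> tangent_relations X x"
proof -
  define p0 where "p0 = (n, U, \<phi>)"
  have p0: "p0 \<in> centered_plots X x" using chart_centered[OF c] by (simp add: p0_def)
  \<comment> \<open>A chosen morphism from \<open>p\<close> to the chart. Only its differential at
    the origin is used, and that is independent of the choice.\<close>
  define lft where "lft p = (SOME G. \<exists>W. plot_morphism p p0 W G)" for p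
  have lft: "\<exists>W. plot_morphism p p0 W (lft p)" if p: "p \<in> centered_plots X x" for p
  proof -
    obtain m V P where pe: "p = (m, V, P)" by (cases p)
    have "\<exists>G W. plot_morphism p p0 W G" using chart_morphism_ex[OF c] p unfolding pe p0_def by blast
    then show ?thesis unfolding lft_def by (rule someI_ex)
  qed
  have lft_diff: "differential (fst p) (lft p) origin = differential (fst p) G origin"
    if p: "p \<in> centered_plots X x" and G: "plot_morphism p p0 W G" for p W G
  proof -
    obtain m V P where pe: "p = (m, V, P)" by (cases p)
    obtain W' where "plot_morphism p p0 W' (lft p)" using lft[OF p] by blast
    then show ?thesis
      using chart_morphism_differential[OF c _ G[unfolded pe p0_def], of W' "lft p"] by (simp add: pe p0_def)
  qed
  define \<kappa> where "\<kappa> j = extend_linear (\<lambda>(p, i). partial i (\<lambda>y. lft p y j) origin)" for j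
  have \<kappa>_summand: "\<kappa> j (summand p v) = differential (fst p) (lft p) origin v j" for j p v
    by (simp add: \<kappa>_def extend_linear_summand differential_def mult.commute)
  have lin: "linear (\<kappa> j)" for j unfolding \<kappa>_def by (rule linear_extend_linear)
  have rel: "\<kappa> j \<xi> = 0" if "\<xi> \<in> tangent_relations X x" for j \<xi>
    using that unfolding tangent_relations_def
  proof (rule linear_eq_0_on_span[OF lin, rotated])
    fix \<zeta> assume "\<zeta> \<in> {summand q v - summand p (differential (fst q) F origin v) | p q W F v.
       p \<in> centered_plots X x \<and> q \<in> centered_plots X x \<and> plot_morphism q p W F \<and> v \<in> Rn (fst q)}"
    then obtain p q W F v where \<zeta>: "\<zeta> = summand q v - summand p (differential (fst q) F origin v)"
      and p: "p \<in> centered_plots X x" and q: "q \<in> centered_plots X x" and F: "plot_morphism q p W F" by blast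
    obtain W' where G: "plot_morphism p p0 W' (lft p)" using lft[OF p] by blast
    obtain m V Q where qe: "q = (m, V, Q)" by (cases q)
    obtain k V' P where pe: "p = (k, V', P)" by (cases p)
    \<comment> \<open>\<open>lft q\<close> and \<open>lft p \<circ> F\<close> are both morphisms
      from \<open>q\<close> to the chart, so their differentials coincide; by the chain rule the two
      terms of the relation get equal coordinates.\<close>
    have "differential (fst q) (lft q) origin = differential (fst q) (\<lambda>r. lft p (F r)) origin"
      using plot_morphism_comp(1)[OF F[unfolded qe pe] G[unfolded pe p0_def]]
      by (intro lft_diff[OF q]) (simp only: qe pe p0_def)
    then have "differential (fst q) (lft q) origin v = differential (fst q) (\<lambda>r. lft p (F r)) origin v" by simp
    also have "\<dots> = differential (fst p) (lft p) origin (differential (fst q) F origin v)"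
      using plot_morphism_comp(2)[OF F[unfolded qe pe] G[unfolded pe p0_def]] by (simp add: qe pe)
    finally show "\<kappa> j \<zeta> = 0"
      by (simp add: \<zeta> linear_diff[OF lin] \<kappa>_summand)
  qed
  have lft0: "differential n (lft p0) origin v = v" if v: "v \<in> Rn n" for v
  proof -
    have "plot_morphism p0 p0 U (\<lambda>y. y)"
      using chart_plot[OF c] plots_n_domain[OF X chart_plot(1)[OF c]] unfolding p0_def
      by (simp add: smooth_domain_map_id)
    from lft_diff[OF p0 this] show ?thesis using differential_id[OF v] by (simp add: p0_def)
  qed
  have coord: "(\<lambda>j. \<kappa> j \<xi>) \<in> Rn n \<and> \<xi> - summand p0 (\<lambda>j. \<kappa> j \<xi>) \<in> tangent_relations X x"
    if \<xi>: "\<xi> \<in> tangent_sum X x" for \<xi>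
  proof -
    let ?K = "Poly_Mapping.keys \<xi>"
    \<comment> \<open>The element \<open>\<xi>\<close> is split into its basis components:
      \<open>e k\<close> is the component at \<open>k\<close> as a vector of its summand, and
      \<open>d k\<close> is its image in the chart. The morphism \<open>lft\<close> makes the two
      congruent modulo the relations.\<close>
    define e where "e k = (\<lambda>j. if j = snd k then Poly_Mapping.lookup \<xi> k else 0)" for k :: "'a param \<times> nat"
    define d where "d k = differential (fst (fst k)) (lft (fst k)) origin (e k)" for k
    have key: "fst k \<in> centered_plots X x" "snd k < fst (fst k)" "e k \<in> Rn (fst (fst k))"
      "summand (fst k) (e k) = Poly_Mapping.single k (Poly_Mapping.lookup \<xi> k)"
      if "k \<in> ?K" for k
    proof -
      show k: "fst k \<in> centered_plots X x" "snd k < fst (fst k)"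
        using \<xi> that unfolding tangent_sum_def by (cases k; auto)+
      show "e k \<in> Rn (fst (fst k))" using k(2) by (simp add: Rn_iff e_def)
      show "summand (fst k) (e k) = Poly_Mapping.single k (Poly_Mapping.lookup \<xi> k)"
        using summand_unit[OF k(2)] by (simp add: e_def)
    qed
    have dR: "d k \<in> Rn n" and drel: "Poly_Mapping.single k (Poly_Mapping.lookup \<xi> k) - summand p0 (d k) \<in> tangent_relations X x"
      if k: "k \<in> ?K" for k
    proof -
      obtain W where W: "plot_morphism (fst k) p0 W (lft (fst k))" using lft[OF key(1)[OF k]] by blast
      show "Poly_Mapping.single k (Poly_Mapping.lookup \<xi> k) - summand p0 (d k) \<in> tangent_relations X x"
        using morphism_relation[OF p0 key(1)[OF k] W key(3)[OF k]] key(4)[OF k] by (simp add: d_def)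
      obtain m V P where pe: "fst k = (m, V, P)" by (cases "fst k")
      have "smooth_domain_map m W n U (lft (fst k))" "origin \<in> W" using W unfolding pe p0_def by simp_all
      then show "d k \<in> Rn n" unfolding d_def pe fst_conv by (rule differential_Rn)
    qed
    have \<xi>_sum: "\<xi> = (\<Sum>k\<in>?K. Poly_Mapping.single k (Poly_Mapping.lookup \<xi> k))"
      by (rule poly_mapping_sum_single)
    have \<kappa>_sum: "\<kappa> j \<xi> = (\<Sum>k\<in>?K. d k j)" for j
    proof -
      have "\<kappa> j \<xi> = (\<Sum>k\<in>?K. \<kappa> j (Poly_Mapping.single k (Poly_Mapping.lookup \<xi> k)))"
        by (subst \<xi>_sum) (rule linear_sum[OF lin])
      also have "\<dots> = (\<Sum>k\<in>?K. d k j)"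
        by (intro sum.cong refl) (simp add: key(4)[symmetric] \<kappa>_summand d_def)
      finally show ?thesis .
    qed
    have "(\<Sum>k\<in>?K. Poly_Mapping.single k (Poly_Mapping.lookup \<xi> k) - summand p0 (d k)) \<in> tangent_relations X x"
      by (rule subspace_sum[OF subspace_tangent_relations drel])
    moreover have "(\<Sum>k\<in>?K. Poly_Mapping.single k (Poly_Mapping.lookup \<xi> k) - summand p0 (d k))
        = \<xi> - summand p0 (\<lambda>j. \<kappa> j \<xi>)"
      unfolding sum_subtractf \<xi>_sum[symmetric] \<kappa>_sum by (simp add: summand_sum)
    moreover have "(\<lambda>j. \<kappa> j \<xi>) \<in> Rn n"
      using dR by (simp add: \<kappa>_sum Rn_iff)
    ultimately show ?thesis by simp
  qed
  show thesis
  proof (rule that[of \<kappa>])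
    show "\<kappa> j (summand (n, U, \<phi>) v) = v j" if "v \<in> Rn n" for v j
      using \<kappa>_summand[of j p0 v] lft0[OF that] by (simp add: p0_def)
  qed (use rel lin coord in \<open>simp_all add: p0_def\<close>)
qed

section \<open>Structure maps and the tangent map in charts\<close>

lemma summand_in_tangent_sum: "p \<in> centered_plots X x \<Longrightarrow> summand p v \<in> tangent_sum X x"
  unfolding tangent_sum_def summand_def
  using keys_sum[of "\<lambda>i. Poly_Mapping.single (p, i) (v i)" "{..<fst p}"] by (fastforce split: if_splits)

lemma dplot_in_tangent_space: "p \<in> centered_plots X x \<Longrightarrow> dplot X x p v \<in> tangent_space X x"
  by (simp add: dplot_def tangent_space_def summand_in_tangent_sum)

lemma dplot_add: "dplot X x p (\<lambda>i. v i + w i) = tangent_add (dplot X x p v) (dplot X x p w)"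
  by (simp add: dplot_def summand_add tangent_add_class)

lemma dplot_scale: "dplot X x p (\<lambda>i. c * v i) = tangent_scale X x c (dplot X x p v)"
  by (simp add: dplot_def summand_scale tangent_scale_class)

lemma dplot_morphism:
  assumes "p \<in> centered_plots X x" "q \<in> centered_plots X x" "plot_morphism q p W F" "v \<in> Rn (fst q)"
  shows "dplot X x q v = dplot X x p (differential (fst q) F origin v)"
  unfolding dplot_def tangent_class_eq_iff using assms by (rule morphism_relation)

text \<open>The coordinates \<open>\<kappa>\<close> recover \<open>v\<close> from its class, which
  gives injectivity, and the coordinate vector of any representative of a tangent vector is a
  preimage of it.\<close>

lemma bij_dplot_chart:
  assumes X: "precomp_closed X" and c: "chart n X x U \<phi>"
  shows "bij_betw (dplot X x (n, U, \<phi>)) (Rn n) (tangent_space X x)"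
proof -
  obtain \<kappa> :: "nat \<Rightarrow> 'a tangent_rep \<Rightarrow> real"
    where rel: "\<And>j \<xi>. \<xi> \<in> tangent_relations X x \<Longrightarrow> \<kappa> j \<xi> = 0" and lin: "\<And>j. linear (\<kappa> j)"
    and unit: "\<And>v j. v \<in> Rn n \<Longrightarrow> \<kappa> j (summand (n, U, \<phi>) v) = v j"
    and coord: "\<And>\<xi>. \<xi> \<in> tangent_sum X x \<Longrightarrow> (\<lambda>j. \<kappa> j \<xi>) \<in> Rn n \<and> \<xi> - summand (n, U, \<phi>) (\<lambda>j. \<kappa> j \<xi>) \<in> tangent_relations X x"
    by (rule chart_tangent_coordinates[OF X c]) (rule that)
  show ?thesis
    unfolding bij_betw_def
  proof (intro conjI equalityI subsetI)
    show "inj_on (dplot X x (n, U, \<phi>)) (Rn n)"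
    proof (rule inj_onI)
      fix v w assume v: "v \<in> Rn n" and w: "w \<in> Rn n" and "dplot X x (n, U, \<phi>) v = dplot X x (n, U, \<phi>) w"
      then have "summand (n, U, \<phi>) v - summand (n, U, \<phi>) w \<in> tangent_relations X x"
        by (simp add: dplot_def tangent_class_eq_iff)
      from rel[OF this] have "v j = w j" for j by (simp add: linear_diff[OF lin] unit v w)
      then show "v = w" by (rule ext)
    qed
    show "A \<in> tangent_space X x" if "A \<in> dplot X x (n, U, \<phi>) ` Rn n" for A
      using that dplot_in_tangent_space[OF chart_centered[OF c]] by blast
    fix A assume "A \<in> tangent_space X x"
    then obtain \<xi> where \<xi>: "\<xi> \<in> tangent_sum X x" "A = tangent_class X x \<xi>" by (auto simp: tangent_space_def)
    have "A = dplot X x (n, U, \<phi>) (\<lambda>j. \<kappa> j \<xi>)"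
      unfolding \<xi>(2) dplot_def tangent_class_eq_iff using coord[OF \<xi>(1)] by blast
    then show "A \<in> dplot X x (n, U, \<phi>) ` Rn n" using coord[OF \<xi>(1)] by blast
  qed
qed

lemma Rn_add: "v \<in> Rn n \<Longrightarrow> w \<in> Rn n \<Longrightarrow> (\<lambda>i. v i + w i) \<in> Rn n"
  by (simp add: Rn_iff)

lemma Rn_scale: "v \<in> Rn n \<Longrightarrow> (\<lambda>i. c * v i) \<in> Rn n"
  by (simp add: Rn_iff)

text \<open>The composite \<open>T\<close> of \<open>D2\<close>, the differential of
  \<open>h\<close> and the inverse of \<open>D1\<close> satisfies the characterisation of the
  tangent map. As \<open>D1\<close> and \<open>D2\<close> are bijections, \<open>T\<close> is
  bijective exactly when the differential is.\<close>

lemma tangent_iso_chart_iff: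
  assumes N: "precomp_closed N" and L: "precomp_closed L" and g: "dsmooth N L g"
    and \<phi>: "chart n N y U \<phi>" and \<psi>: "chart l L (g y) V \<psi>"
    and h: "smooth_domain_map n U' l V h" "origin \<in> U'" "U' \<subseteq> U" "h origin = origin"
      "\<And>u. u \<in> U' \<Longrightarrow> g (\<phi> u) = \<psi> (h u)"
  shows "tangent_iso N y L (g y) (tangent_map N L g y) \<longleftrightarrow>
    bij_betw (differential n h origin) (Rn n) (Rn l)"
proof -
  define D1 where "D1 = dplot N y (n, U, \<phi>)"
  define D2 where "D2 = dplot L (g y) (l, V, \<psi>)"
  define dh where "dh = differential n h origin"
  have bij1: "bij_betw D1 (Rn n) (tangent_space N y)" unfolding D1_def by (rule bij_dplot_chart[OF N \<phi>])
  have bij2: "bij_betw D2 (Rn l) (tangent_space L (g y))" unfolding D2_def by (rule bij_dplot_chart[OF L \<psi>])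
  have dhR: "dh v \<in> Rn l" for v unfolding dh_def by (rule differential_Rn[OF h(1,2)])
  define T where "T = (\<lambda>A\<in>tangent_space N y. D2 (dh (inv_into (Rn n) D1 A)))"
  have D1T: "D1 v \<in> tangent_space N y" if "v \<in> Rn n" for v using bij_betwE[OF bij1] that by blast
  have D2T: "D2 v \<in> tangent_space L (g y)" if "v \<in> Rn l" for v using bij_betwE[OF bij2] that by blast
  have TD1: "T (D1 v) = D2 (dh v)" if "v \<in> Rn n" for v
    using D1T[OF that] bij_betw_inv_into_left[OF bij1 that] by (simp add: T_def)
  have D1_surj: "\<exists>v\<in>Rn n. A = D1 v" if "A \<in> tangent_space N y" for A
    using bij1 that unfolding bij_betw_def by blast
  have T_ext: "T \<in> extensional (tangent_space N y)" by (simp add: T_def)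
  have T_lin: "tangent_linear N y L (g y) T"
    unfolding tangent_linear_def
  proof (intro conjI ballI allI)
    show "T \<in> tangent_space N y \<rightarrow> tangent_space L (g y)" using D2T[OF dhR] by (simp add: T_def)
  next
    fix A B assume "A \<in> tangent_space N y" "B \<in> tangent_space N y"
    then obtain v w where v: "v \<in> Rn n" "A = D1 v" and w: "w \<in> Rn n" "B = D1 w" using D1_surj by blast
    have "T (tangent_add A B) = T (D1 (\<lambda>i. v i + w i))" unfolding v(2) w(2) D1_def dplot_add ..
    also have "\<dots> = D2 (\<lambda>j. dh v j + dh w j)"
      unfolding TD1[OF Rn_add[OF v(1) w(1)]] dh_def differential_add ..
    also have "\<dots> = tangent_add (T A) (T B)" unfolding v(2) w(2) TD1[OF v(1)] TD1[OF w(1)] D2_def dplot_add ..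
    finally show "T (tangent_add A B) = tangent_add (T A) (T B)" .
  next
    fix c A assume "A \<in> tangent_space N y"
    then obtain v where v: "v \<in> Rn n" "A = D1 v" using D1_surj by blast
    have "T (tangent_scale N y c A) = T (D1 (\<lambda>i. c * v i))" unfolding v(2) D1_def dplot_scale ..
    also have "\<dots> = D2 (\<lambda>j. c * dh v j)" unfolding TD1[OF Rn_scale[OF v(1)]] dh_def differential_scale ..
    also have "\<dots> = tangent_scale L (g y) c (T A)" unfolding v(2) TD1[OF v(1)] D2_def dplot_scale ..
    finally show "T (tangent_scale N y c A) = tangent_scale L (g y) c (T A)" .
  qed
  have centered: "(m, W, compose W g P) \<in> centered_plots L (g y)" if "(m, W, P) \<in> centered_plots N y" for m W P
    using that dsmooth_plots[OF g, of m W P] by (auto simp: centered_plots_def compose_def)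
  \<comment> \<open>A plot \<open>P\<close> factors through \<open>\<phi>\<close> by some
    \<open>G\<close>, so \<open>g \<circ> P\<close> factors through \<open>\<psi>\<close> by
    \<open>h \<circ> G\<close>, and the chain rule compares the two structure maps.\<close>
  have T_plot: "T (dplot N y (m, W, P) v) = dplot L (g y) (m, W, compose W g P) v"
    if P: "(m, W, P) \<in> centered_plots N y" and v: "v \<in> Rn m" for m W P v
  proof -
    obtain W1 G where G: "plot_morphism (m, W, P) (n, U, \<phi>) W1 G"
      using chart_morphism_ex[OF \<phi> P] by blast
    have h_mor: "plot_morphism (n, U', \<lambda>u\<in>U'. g (\<phi> u)) (l, V, \<psi>) U' h"
      using h by simp
    have U': "n_domain n U'" using h(1) by (rule smooth_domain_mapD)
    let ?W = "{r \<in> W1. G r \<in> U'}"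
    have Gs: "smooth_domain_map m W1 n U G" "W1 \<subseteq> W" "origin \<in> W1" "G origin = origin" "\<forall>r\<in>W1. P r = \<phi> (G r)"
      using G by simp_all
    have W': "n_domain m ?W" by (rule smooth_preimage[OF Gs(1) U'])
    have G': "smooth_domain_map m ?W n U' G"
      by (rule smooth_domain_map_restrict[OF Gs(1) W' _ U']) auto
    have mor: "plot_morphism (m, W, compose W g P) (l, V, \<psi>) ?W (\<lambda>r. h (G r))"
      using smooth_domain_map_comp[OF G' h(1)] Gs h by (auto simp: compose_def)
    have diff: "differential m (\<lambda>r. h (G r)) origin v = dh (differential m G origin v)"
      using differential_comp[OF G' h(1), of origin v] Gs(3,4) h(2) by (simp add: dh_def)
    have "T (dplot N y (m, W, P) v) = T (D1 (differential m G origin v))"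
      using dplot_morphism[OF chart_centered[OF \<phi>] P G] v by (simp add: D1_def)
    also have "\<dots> = D2 (dh (differential m G origin v))"
      by (rule TD1[OF differential_Rn[OF Gs(1,3)]])
    also have "\<dots> = dplot L (g y) (m, W, compose W g P) v"
      using dplot_morphism[OF chart_centered[OF \<psi>] centered[OF P] mor] v diff by (simp add: D2_def)
    finally show ?thesis .
  qed
  have "tangent_map N L g y = T"
    unfolding tangent_map_def
  proof (rule the_equality)
    show "T \<in> extensional (tangent_space N y) \<and> tangent_linear N y L (g y) T \<and>
      (\<forall>(n, U, P)\<in>centered_plots N y. \<forall>v\<in>Rn n. T (dplot N y (n, U, P) v) = dplot L (g y) (n, U, compose U g P) v)"
      using T_ext T_lin T_plot by auto
    fix S assume S: "S \<in> extensional (tangent_space N y) \<and> tangent_linear N y L (g y) S \<and>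
      (\<forall>(n, U, P)\<in>centered_plots N y. \<forall>v\<in>Rn n. S (dplot N y (n, U, P) v) = dplot L (g y) (n, U, compose U g P) v)"
    \<comment> \<open>Every tangent vector at \<open>y\<close> comes from the chart, so the
      condition on the single plot \<open>\<phi>\<close> already determines
      \<open>S\<close>.\<close>
    show "S = T"
    proof (rule extensionalityI[of _ "tangent_space N y"])
      fix A assume "A \<in> tangent_space N y"
      then obtain v where v: "v \<in> Rn n" "A = D1 v" using D1_surj by blast
      then show "S A = T A" using S T_plot[OF chart_centered[OF \<phi>] v(1)] chart_centered[OF \<phi>]
        by (auto simp: D1_def)
    qed (use S T_ext in auto)
  qed
  then have "tangent_iso N y L (g y) (tangent_map N L g y) \<longleftrightarrow> bij_betw T (tangent_space N y) (tangent_space L (g y))"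
    using T_lin by (simp add: tangent_iso_def)
  also have "\<dots> \<longleftrightarrow> bij_betw (T \<circ> D1) (Rn n) (tangent_space L (g y))"
    by (rule bij_betw_comp_iff[OF bij1])
  also have "\<dots> \<longleftrightarrow> bij_betw (D2 \<circ> dh) (Rn n) (tangent_space L (g y))"
    by (rule bij_betw_cong) (simp add: TD1)
  also have "\<dots> \<longleftrightarrow> bij_betw dh (Rn n) (Rn l)"
    by (rule bij_betw_comp_iff2[OF bij2, symmetric]) (use dhR in blast)
  finally show ?thesis by (simp add: dh_def)
qed

section \<open>The track map\<close>

definition rear :: "nat \<Rightarrow> (nat \<Rightarrow> real) \<Rightarrow> nat \<Rightarrow> real"
  where "rear p x = (\<lambda>i. x (p + i))"

text \<open>The identification of \<open>\<real>\<^sup>p \<times> \<real>\<^sup>n\<close> with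
  \<open>\<real>\<^sup>p\<^sup>+\<^sup>n\<close>, with \<open>front p\<close> and
  \<open>rear p\<close> as the two projections: \<open>w\<close> holds the parameters and
  \<open>u\<close> the unknowns.\<close>

definition join :: "nat \<Rightarrow> (nat \<Rightarrow> real) \<Rightarrow> (nat \<Rightarrow> real) \<Rightarrow> nat \<Rightarrow> real"
  where "join p w u = (\<lambda>i. if i < p then w i else u (i - p))"

lemma join_Rn: "u \<in> Rn n \<Longrightarrow> join p w u \<in> Rn (p + n)"
  by (auto simp: join_def Rn_iff)

lemma front_join: "w \<in> Rn p \<Longrightarrow> front p (join p w u) = w"
  by (auto simp: front_def join_def Rn_iff)

lemma rear_join [simp]: "rear p (join p w u) = u"
  by (auto simp: rear_def join_def)

lemma rear_Rn: "x \<in> Rn (p + n) \<Longrightarrow> rear p x \<in> Rn n"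
  by (simp add: rear_def Rn_iff)

lemma smooth_domain_map_rear: "n_domain (p + n) V \<Longrightarrow> smooth_domain_map (p + n) V n (Rn n) (rear p)"
  by (rule smooth_domain_mapI) (auto intro: Ck_coordinate rear_Rn n_domain_RnD simp: rear_def)

lemma smooth_domain_map_join:
  assumes F: "smooth_domain_map m W p U F" and G: "smooth_domain_map m W n U' G"
  shows "smooth_domain_map m W (p + n) (Rn (p + n)) (\<lambda>r. join p (F r) (G r))"
proof (rule smooth_domain_mapI)
  show "n_domain m W" by (rule smooth_domain_mapD(1)[OF F])
  show "(\<lambda>r. join p (F r) (G r)) \<in> W \<rightarrow> Rn (p + n)" using smooth_domain_map_mem_Rn[OF G] join_Rn by blast
  show "Ck k m W (\<lambda>x. join p (F x) (G x) j)" for j k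
    by (cases "j < p") (simp_all add: join_def smooth_domain_map_Ck[OF F] smooth_domain_map_Ck[OF G])
qed simp

lemma n_domain_product:
  assumes "n_domain p W" "n_domain n U"
  shows "n_domain (p + n) {x \<in> Rn (p + n). front p x \<in> W \<and> rear p x \<in> U}"
proof -
  have "n_domain (p + n) ({x \<in> Rn (p + n). front p x \<in> W} \<inter> {x \<in> Rn (p + n). rear p x \<in> U})"
    by (intro n_domain_Int smooth_preimage[OF smooth_domain_map_front] smooth_preimage[OF smooth_domain_map_rear] assms) simp_all
  moreover have "{x \<in> Rn (p + n). front p x \<in> W} \<inter> {x \<in> Rn (p + n). rear p x \<in> U}
      = {x \<in> Rn (p + n). front p x \<in> W \<and> rear p x \<in> U}" by blast
  ultimately show ?thesis by simp
qed

section \<open>Jacobian matrices and equations with parameters\<close>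

lemma differential_sum:
  "finite K \<Longrightarrow> differential m F x (\<lambda>i. \<Sum>k\<in>K. c k * v k i) = (\<lambda>j. \<Sum>k\<in>K. c k * differential m F x (v k) j)"
proof (induction K rule: finite_induct)
  case empty then show ?case by (simp add: differential_def)
next
  case (insert k K) then show ?case by (simp add: differential_add differential_scale)
qed

lemma differential_unit:
  assumes "i < m"
  shows "differential m F x (\<lambda>k. if k = i then 1 else 0) j = partial i (\<lambda>y. F y j) x"
proof -
  have "differential m F x (\<lambda>k. if k = i then 1 else 0) j = (\<Sum>k<m. if k = i then partial i (\<lambda>y. F y j) x else 0)"
    unfolding differential_def by (intro sum.cong) auto
  then show ?thesis using assms by simp
qed

text \<open>The columns of \<open>b\<close> are the preimages \<open>B (e c)\<close> of the unit
  vectors. Linearity of \<open>B\<close> is read off by applying \<open>dh\<close> to the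
  corresponding combination of columns; injectivity on \<open>\<real>\<^sup>l\<close> then follows
  because \<open>dh\<close> undoes \<open>B\<close>.\<close>

lemma left_inverse_matrix:
  assumes bij: "bij_betw (differential n h x) (Rn n) (Rn l)"
  obtains b where "inverse_matrix n l b (\<lambda>c i. partial i (\<lambda>u. h u c) x)"
proof -
  define dh where "dh = differential n h x"
  define B where "B = inv_into (Rn n) dh"
  define e where "e c = (\<lambda>k. if k = c then 1 else (0::real))" for c :: nat
  define b where "b a c = B (e c) a" for a c
  have bij: "bij_betw dh (Rn n) (Rn l)" using assms by (simp add: dh_def)
  have BR: "B v \<in> Rn n" and dhB: "dh (B v) = v" if "v \<in> Rn l" for v
    using bij_betwE[OF bij_betw_inv_into[OF bij]] bij_betw_inv_into_right[OF bij that] that by (auto simp: B_def)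
  have eR: "e c \<in> Rn k" if "c < k" for c k using that by (auto simp: e_def Rn_iff)
  have B_sum: "(\<Sum>c<l. b a c * v c) = B v a" if v: "v \<in> Rn l" for v a
  proof -
    let ?w = "\<lambda>i. \<Sum>c<l. v c * B (e c) i"
    have "dh ?w = (\<lambda>j. \<Sum>c<l. v c * dh (B (e c)) j)"
      unfolding dh_def by (rule differential_sum) simp
    also have "\<dots> = (\<lambda>j. \<Sum>c<l. if j = c then v c else 0)"
    proof (intro ext sum.cong refl)
      fix j c assume "c \<in> {..<l}"
      then have "dh (B (e c)) j = e c j" by (simp add: dhB eR)
      then show "v c * dh (B (e c)) j = (if j = c then v c else 0)" by (simp add: e_def)
    qed
    also have "\<dots> = v" using v by (auto simp: Rn_iff)
    finally have "dh ?w = v" .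
    moreover have "?w \<in> Rn n"
      using BR[OF eR] unfolding Rn_iff by (intro allI impI sum.neutral) simp
    ultimately have "B v = ?w" using bij_betw_inv_into_left[OF bij, of ?w] by (simp add: B_def)
    then show ?thesis by (simp add: b_def mult.commute)
  qed
  have "inverse_matrix n l b (\<lambda>c i. partial i (\<lambda>u. h u c) x)"
    unfolding inverse_matrix_def
  proof (intro conjI allI impI)
    fix a i assume a: "a < n" and i: "i < n"
    have dR: "dh (e i) \<in> Rn l" using bij_betwE[OF bij] eR[OF i] by blast
    have "(\<Sum>c<l. b a c * partial i (\<lambda>u. h u c) x) = (\<Sum>c<l. b a c * dh (e i) c)"
      using differential_unit[OF i, of h x] by (simp add: dh_def e_def)
    also have "\<dots> = B (dh (e i)) a" by (rule B_sum[OF dR])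
    also have "B (dh (e i)) = e i" unfolding B_def by (rule bij_betw_inv_into_left[OF bij eR[OF i]])
    finally show "(\<Sum>c<l. b a c * partial i (\<lambda>u. h u c) x) = (if a = i then 1 else 0)" by (simp add: e_def)
  next
    fix v c assume v: "\<forall>a<n. (\<Sum>c<l. b a c * v c) = 0" and c: "c < l"
    have "B (front l v) a = 0" for a
    proof (cases "a < n")
      case True
      have "B (front l v) a = (\<Sum>c<l. b a c * v c)" by (simp add: B_sum[symmetric] front_apply)
      then show ?thesis using v True by simp
    next
      case False then show ?thesis using BR[OF front_Rn] by (simp add: Rn_iff)
    qed
    then have "B (front l v) = (\<lambda>i. 0)" by (intro ext)
    then have "front l v = dh (\<lambda>i. 0)" using dhB[OF front_Rn] by metis
    also have "\<dots> = (\<lambda>j. 0)" by (simp add: dh_def differential_def)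
    finally have "front l v = (\<lambda>j. 0)" .
    then show "v c = 0" using front_apply[OF c, of v] by simp
  qed
  then show thesis by (rule that)
qed

text \<open>Moving a coordinate of index \<open>p\<close> or more leaves \<open>front p x\<close>
  fixed, so the subtracted term is constant along the line, whatever \<open>g\<close> is.\<close>

lemma partial_diff_front:
  assumes D: "n_domain (p + n) D" and F: "Ck (Suc 0) (p + n) D F" and x: "x \<in> D" and i: "i < n"
  shows "partial (p + i) (\<lambda>x. F x - g (front p x)) x = partial (p + i) F x"
proof -
  have "front p (x(p + i := t)) = front p x" for t by (auto simp: front_def)
  moreover have "((\<lambda>t. F (x(p + i := t)) - g (front p x)) has_field_derivative partial (p + i) F x - 0) (at (x (p + i)))"
    using i by (intro DERIV_diff DERIV_const Ck_SucD_deriv[OF D F _ x]) simp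
  ultimately show ?thesis
    unfolding partial_def[of "p + i" "\<lambda>x. F x - g (front p x)"] by (intro DERIV_imp_deriv) simp
qed

text \<open>The implicit function theorem is applied to \<open>F x - q (front p x)\<close>. The
  second term depends on the parameters alone, so the Jacobian in the unknowns is that of
  \<open>F\<close>.\<close>

lemma parametrised_solution:
  assumes F: "smooth_domain_map (p + n) D l V F" and x0: "x0 \<in> D"
    and inv: "inverse_matrix n l b (\<lambda>c i. partial (p + i) (\<lambda>x. F x c) x0)"
    and q: "smooth_domain_map p W l V q" and w0: "front p x0 \<in> W" and F0: "F x0 = q (front p x0)"
  obtains A E G where "smooth_domain_map p A (p + n) E G" "front p x0 \<in> A" "x0 \<in> E" "E \<subseteq> D" "A \<subseteq> W"
    "\<And>w. w \<in> A \<Longrightarrow> front p (G w) = w"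
    "\<And>x. x \<in> E \<Longrightarrow> front p x \<in> A \<and> (F x = q (front p x) \<longleftrightarrow> x = G (front p x))"
proof -
  have D: "n_domain (p + n) D" by (rule smooth_domain_mapD(1)[OF F])
  have W: "n_domain p W" by (rule smooth_domain_mapD(1)[OF q])
  \<comment> \<open>The part of \<open>D\<close> over which the right-hand side
    \<open>q (front p x)\<close> is defined.\<close>
  define D1 where "D1 = {x \<in> D. front p x \<in> W}"
  have D1: "n_domain (p + n) D1" unfolding D1_def by (rule smooth_preimage[OF smooth_domain_map_front[OF _ D] W]) simp
  have F1: "Ck k (p + n) D1 (\<lambda>x. F x c)" for k c
    by (rule Ck_subset[OF D1 D _ smooth_domain_map_Ck[OF F]]) (auto simp: D1_def)
  have frontW: "smooth_domain_map (p + n) D1 p W (front p)"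
    by (rule smooth_domain_map_restrict[OF smooth_domain_map_front[OF _ D1] D1 order_refl W]) (auto simp: D1_def)
  have q1: "Ck k (p + n) D1 (\<lambda>x. q (front p x) c)" for k c
    by (rule smooth_domain_map_Ck[OF smooth_domain_map_comp[OF frontW q]])
  have x1: "x0 \<in> D1" using x0 w0 by (simp add: D1_def)
  have part: "partial (p + i) (\<lambda>x. F x c - q (front p x) c) x0 = partial (p + i) (\<lambda>x. F x c) x0" if "i < n" for i c
    by (rule partial_diff_front[OF D1 F1 x1 that])
  have inv': "inverse_matrix n l b (\<lambda>c i. partial (p + i) (\<lambda>x. F x c - q (front p x) c) x0)"
    using inv part unfolding inverse_matrix_def by simp
  have C: "Ck k (p + n) D1 (\<lambda>x. F x c - q (front p x) c)" for k c by (intro Ck_diff D1 F1 q1)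
  have Z: "F x0 c - q (front p x0) c = 0" for c using F0 by simp
  obtain A E G where G: "smooth_domain_map p A (p + n) E G" "front p x0 \<in> A" "x0 \<in> E" "E \<subseteq> D1"
    "\<And>x. x \<in> A \<Longrightarrow> front p (G x) = x" "\<And>x. x \<in> E \<Longrightarrow> front p x \<in> A"
    "\<And>x. x \<in> E \<Longrightarrow> (\<forall>c<l. F x c - q (front p x) c = 0) \<longleftrightarrow> x = G (front p x)"
    by (rule implicit_function[where F = "\<lambda>c x. F x c - q (front p x) c", OF D1 C x1 Z inv']) (rule that)
  have eq: "(\<forall>c<l. F x c - q (front p x) c = 0) \<longleftrightarrow> F x = q (front p x)" if "x \<in> E" for x
  proof -
    have x: "x \<in> D" "front p x \<in> W" using G(4) that by (auto simp: D1_def)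
    show ?thesis
      using Rn_eqI[OF smooth_domain_map_mem_Rn[OF F x(1)] smooth_domain_map_mem_Rn[OF q x(2)]] by auto
  qed
  show thesis
  proof (rule that[OF G(1-3)])
    show "E \<subseteq> D" using G(4) by (auto simp: D1_def)
    show "A \<subseteq> W"
    proof
      fix w assume w: "w \<in> A"
      have "G w \<in> D1" using smooth_domain_map_mem[OF G(1) w] G(4) by blast
      then show "w \<in> W" using G(5)[OF w] by (simp add: D1_def)
    qed
    show "front p x \<in> A \<and> (F x = q (front p x) \<longleftrightarrow> x = G (front p x))" if "x \<in> E" for x
      using G(6,7)[OF that] eq[OF that] by simp
  qed (rule G(5))
qed

section \<open>The track map on plots\<close>

lemma dsmooth_section:
  assumes M: "diffeological_space M" and f: "dsmooth (prod_dspace M N) L f" and x: "x \<in> points M"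
    and N: "precomp_closed N"
  shows "dsmooth N L (\<lambda>y. f (x, y))"
  unfolding dsmooth_def
proof (intro conjI ballI)
  show "(\<lambda>y. f (x, y)) \<in> points N \<rightarrow> points L" using dsmooth_mem[OF f] x by auto
  fix p assume p: "p \<in> plots N"
  obtain n U P where pe: "p = (n, U, P)" by (cases p)
  then have P: "(n, U, P) \<in> plots N" using p by simp
  have "(n, U, \<lambda>r\<in>U. ((\<lambda>r\<in>U. x) r, P r)) \<in> plots (prod_dspace M N)"
    unfolding plots_prod_iff using const_plots[OF M x plots_n_domain[OF N P]] P by blast
  then have "(n, U, \<lambda>r\<in>U. f ((\<lambda>r\<in>U. ((\<lambda>r\<in>U. x) r, P r)) r)) \<in> plots L" by (rule dsmooth_plots[OF f])
  moreover have "(\<lambda>r\<in>U. f ((\<lambda>r\<in>U. ((\<lambda>r\<in>U. x) r, P r)) r)) = compose U (\<lambda>y. f (x, y)) P"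
    unfolding compose_def by (rule restrict_ext) simp
  ultimately show "case p of (n, U, P) \<Rightarrow> (n, U, compose U (\<lambda>y. f (x, y)) P) \<in> plots L" by (simp add: pe)
qed

lemma dsmooth_track:
  assumes M: "precomp_closed M" and N: "precomp_closed N" and f: "dsmooth (prod_dspace M N) L f"
  shows "dsmooth (prod_dspace M N) (prod_dspace M L) (\<lambda>(x, y). (x, f (x, y)))"
  unfolding dsmooth_def
proof (intro conjI ballI)
  show "(\<lambda>(x, y). (x, f (x, y))) \<in> points (prod_dspace M N) \<rightarrow> points (prod_dspace M L)"
    using dsmooth_mem[OF f] by auto
  fix p assume p: "p \<in> plots (prod_dspace M N)"
  obtain n U R where pe: "p = (n, U, R)" by (cases p)
  then have R: "(n, U, R) \<in> plots (prod_dspace M N)" using p by simp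
  then obtain P Q where PQ: "(n, U, P) \<in> plots M" "R = (\<lambda>r\<in>U. (P r, Q r))"
    unfolding plots_prod_iff by (elim exE conjE) (rule that)
  have "compose U (\<lambda>(x, y). (x, f (x, y))) R = (\<lambda>r\<in>U. (P r, (\<lambda>r\<in>U. f (R r)) r))"
    unfolding compose_def by (rule restrict_ext) (simp add: PQ(2))
  then have "(n, U, compose U (\<lambda>(x, y). (x, f (x, y))) R) \<in> plots (prod_dspace M L)"
    unfolding plots_prod_iff using PQ(1) dsmooth_plots[OF f R] by blast
  then show "case p of (n, U, P) \<Rightarrow> (n, U, compose U (\<lambda>(x, y). (x, f (x, y))) P) \<in> plots (prod_dspace M L)"
    by (simp add: pe)
qed

text \<open>The map \<open>F\<close> represents \<open>(w, u) \<mapsto> f (P w, \<phi> u)\<close> in the charts, and \<open>b\<close> is a left inverse of its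
  Jacobian in \<open>u\<close>.\<close>

lemma track_in_charts:
  assumes M: "diffeological_space M" and N: "etale_manifold N" and L: "etale_manifold L"
    and f: "dsmooth (prod_dspace M N) L f"
    and y0: "y0 \<in> points N" and P: "(p, W, P) \<in> plots M" and w0: "w0 \<in> W"
    and iso: "tangent_iso N y0 L (f (P w0, y0)) (tangent_map N L (\<lambda>y. f (P w0, y)) y0)"
  obtains n U \<phi> l V \<psi> D F b where "chart n N y0 U \<phi>" "chart l L (f (P w0, y0)) V \<psi>"
    "smooth_domain_map (p + n) D l V F" "join p w0 origin \<in> D" "F (join p w0 origin) = origin"
    "\<And>x. x \<in> D \<Longrightarrow> front p x \<in> W \<and> rear p x \<in> U \<and> f (P (front p x), \<phi> (rear p x)) = \<psi> (F x)"
    "inverse_matrix n l b (\<lambda>c i. partial (p + i) (\<lambda>x. F x c) (join p w0 origin))"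
proof -
  note pM = diffeological_space_precomp_closed[OF M]
  note pN = diffeological_space_precomp_closed[OF etale_manifold_diffeological[OF N]]
  note pL = diffeological_space_precomp_closed[OF etale_manifold_diffeological[OF L]]
  have W: "n_domain p W" by (rule plots_n_domain[OF pM P])
  have w0R: "w0 \<in> Rn p" by (rule n_domain_RnD[OF W w0])
  have x0: "P w0 \<in> points M" by (rule plots_mem[OF pM P w0])
  have z0: "f (P w0, y0) \<in> points L" using dsmooth_mem[OF f] x0 y0 by simp
  obtain n U \<phi> where \<phi>: "chart n N y0 U \<phi>" by (rule chart_exists[OF N y0])
  obtain l V \<psi> where \<psi>: "chart l L (f (P w0, y0)) V \<psi>" by (rule chart_exists[OF L z0])
  have U: "n_domain n U" by (rule plots_n_domain[OF pN chart_plot(1)[OF \<phi>]])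
  let ?x0 = "join p w0 origin"
  define D0 where "D0 = {x \<in> Rn (p + n). front p x \<in> W \<and> rear p x \<in> U}"
  have D0: "n_domain (p + n) D0" unfolding D0_def by (rule n_domain_product[OF W U])
  have x0D0: "?x0 \<in> D0" using w0 chart_plot(2)[OF \<phi>] by (simp add: D0_def join_Rn front_join[OF w0R])
  have frontD0: "smooth_domain_map (p + n) D0 p W (front p)"
    by (rule smooth_domain_map_restrict[OF smooth_domain_map_front[OF _ D0] D0 order_refl W]) (auto simp: D0_def)
  have rearD0: "smooth_domain_map (p + n) D0 n U (rear p)"
    by (rule smooth_domain_map_restrict[OF smooth_domain_map_rear[OF D0] D0 order_refl U]) (auto simp: D0_def)
  define R where "R = (\<lambda>x\<in>D0. ((\<lambda>x\<in>D0. P (front p x)) x, (\<lambda>x\<in>D0. \<phi> (rear p x)) x))"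
  have "(p + n, D0, R) \<in> plots (prod_dspace M N)"
    unfolding plots_prod_iff R_def
    using plots_precomp[OF pM P frontD0] plots_precomp[OF pN chart_plot(1)[OF \<phi>] rearD0] by blast
  then have fR: "(p + n, D0, \<lambda>x\<in>D0. f (R x)) \<in> plots L" by (rule dsmooth_plots[OF f])
  have fR_eq: "(\<lambda>x\<in>D0. f (R x)) x = f (P (front p x), \<phi> (rear p x))" if "x \<in> D0" for x
    using that by (simp add: R_def)
  have e0: "(\<lambda>x\<in>D0. f (R x)) ?x0 = f (P w0, y0)"
    using fR_eq[OF x0D0] chart_plot(3)[OF \<phi>] front_join[OF w0R] by simp
  obtain D F where F: "smooth_domain_map (p + n) D l V F" "?x0 \<in> D" "D \<subseteq> D0" "F ?x0 = origin"
    "\<And>x. x \<in> D \<Longrightarrow> (\<lambda>x\<in>D0. f (R x)) x = \<psi> (F x)"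
    by (rule chart_lift[OF \<psi> fR x0D0 e0]) (rule that)
  have FD: "front p x \<in> W \<and> rear p x \<in> U \<and> f (P (front p x), \<phi> (rear p x)) = \<psi> (F x)" if "x \<in> D" for x
  proof -
    have x: "x \<in> D0" using F(3) that by blast
    then show ?thesis using F(5)[OF that] fR_eq[OF x] by (simp add: D0_def)
  qed
  have Dd: "n_domain (p + n) D" by (rule smooth_domain_mapD(1)[OF F(1)])
  \<comment> \<open>Freezing the parameter at \<open>w0\<close> turns \<open>F\<close> into a
    representative of \<open>y \<mapsto> f (P w0, y)\<close>, the map whose tangent map is assumed
    to be an isomorphism.\<close>
  define h where "h u = F (join p w0 u)" for u
  have joinU: "smooth_domain_map n U (p + n) (Rn (p + n)) (join p w0)"
    by (rule smooth_domain_map_join[OF smooth_domain_map_const[OF U W w0] smooth_domain_map_id[OF U U order_refl]])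
  define U' where "U' = {u \<in> U. join p w0 u \<in> D}"
  have U': "n_domain n U'" unfolding U'_def by (rule smooth_preimage[OF joinU Dd])
  have joinU': "smooth_domain_map n U' (p + n) D (join p w0)"
    by (rule smooth_domain_map_restrict[OF joinU U' _ Dd]) (auto simp: U'_def)
  have h: "smooth_domain_map n U' l V h" unfolding h_def by (rule smooth_domain_map_comp[OF joinU' F(1)])
  have "bij_betw (differential n h origin) (Rn n) (Rn l)"
  proof (subst tangent_iso_chart_iff[symmetric])
    show "precomp_closed N" "precomp_closed L" by (rule pN, rule pL)
    show "dsmooth N L (\<lambda>y. f (P w0, y))" by (rule dsmooth_section[OF M f x0 pN])
    show "chart n N y0 U \<phi>" by (rule \<phi>)
    show "chart l L (f (P w0, y0)) V \<psi>" by (rule \<psi>)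
    show "smooth_domain_map n U' l V h" by (rule h)
    show "origin \<in> U'" using F(2) chart_plot(2)[OF \<phi>] by (simp add: U'_def)
    show "U' \<subseteq> U" by (auto simp: U'_def)
    show "h origin = origin" using F(4) by (simp add: h_def)
    show "f (P w0, \<phi> u) = \<psi> (h u)" if "u \<in> U'" for u
      using FD[of "join p w0 u"] that by (simp add: U'_def h_def front_join[OF w0R])
  qed (rule iso)
  then obtain b where b: "inverse_matrix n l b (\<lambda>c i. partial i (\<lambda>u. h u c) origin)"
    by (rule left_inverse_matrix)
  \<comment> \<open>Moving coordinate \<open>p + i\<close> of the joined point moves coordinate
    \<open>i\<close> of \<open>u\<close>, so the Jacobian of \<open>h\<close> is the block of the
    Jacobian of \<open>F\<close> belonging to the unknowns.\<close>
  have "?x0(p + i := t) = join p w0 (origin(i := t))" for i t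
    by (auto simp: join_def fun_eq_iff)
  then have part: "partial (p + i) (\<lambda>x. F x c) ?x0 = partial i (\<lambda>u. h u c) origin" for i c
    by (simp add: partial_def h_def join_def origin_def)
  with b have b': "inverse_matrix n l b (\<lambda>c i. partial (p + i) (\<lambda>x. F x c) ?x0)" by simp
  show thesis by (rule that[OF \<phi> \<psi> F(1,2,4) _ b']) (rule FD)
qed

text \<open>The track map preserves the first component, so the lift keeps \<open>P\<close> and only
  its component in \<open>N\<close> has to be found, as \<open>\<phi>\<close> applied to the
  solution \<open>u\<close>.\<close>

lemma track_lifts_exist:
  assumes M: "diffeological_space M" and N: "etale_manifold N" and L: "etale_manifold L"
    and f: "dsmooth (prod_dspace M N) L f"
    and iso: "\<And>x y. x \<in> points M \<Longrightarrow> y \<in> points N \<Longrightarrow> tangent_iso N y L (f (x, y)) (tangent_map N L (\<lambda>y'. f (x, y')) y)"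
  shows "lifts_exist (prod_dspace M N) (prod_dspace M L) (\<lambda>(x, y). (x, f (x, y)))"
  unfolding lifts_exist_def
proof (intro allI impI)
  note pM = diffeological_space_precomp_closed[OF M]
  note pN = diffeological_space_precomp_closed[OF etale_manifold_diffeological[OF N]]
  fix p W R w0 xy
  assume R: "(p, W, R) \<in> plots (prod_dspace M L)" and w0: "w0 \<in> W" and xy: "xy \<in> points (prod_dspace M N)"
    and eq: "(\<lambda>(x, y). (x, f (x, y))) xy = R w0"
  obtain P Q where P: "(p, W, P) \<in> plots M" and Q: "(p, W, Q) \<in> plots L" and Re: "R = (\<lambda>r\<in>W. (P r, Q r))"
    using R unfolding plots_prod_iff by (elim exE conjE) (rule that)
  obtain y0 where xy': "xy = (P w0, y0)" "y0 \<in> points N" "f (P w0, y0) = Q w0" "P w0 \<in> points M"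
    using xy eq w0 by (cases xy) (auto simp: Re)
  have w0R: "w0 \<in> Rn p" by (rule n_domain_RnD[OF plots_n_domain[OF pM P] w0])
  obtain n U \<phi> l V \<psi> D F b where \<phi>: "chart n N y0 U \<phi>" and \<psi>: "chart l L (f (P w0, y0)) V \<psi>"
    and F: "smooth_domain_map (p + n) D l V F" "join p w0 origin \<in> D" "F (join p w0 origin) = origin"
    and FD: "\<And>x. x \<in> D \<Longrightarrow> front p x \<in> W \<and> rear p x \<in> U \<and> f (P (front p x), \<phi> (rear p x)) = \<psi> (F x)"
    and b: "inverse_matrix n l b (\<lambda>c i. partial (p + i) (\<lambda>x. F x c) (join p w0 origin))"
    by (rule track_in_charts[OF M N L f xy'(2) P w0 iso[OF xy'(4,2)]]) (rule that)
  obtain W1 q where q: "smooth_domain_map p W1 l V q" "w0 \<in> W1" "W1 \<subseteq> W" "q w0 = origin"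
    "\<And>r. r \<in> W1 \<Longrightarrow> Q r = \<psi> (q r)"
    by (rule chart_lift[OF \<psi> Q w0 xy'(3)[symmetric]]) (rule that)
  have c0: "front p (join p w0 origin) = w0" by (rule front_join[OF w0R])
  have qW: "front p (join p w0 origin) \<in> W1" using q(2) by (simp add: c0)
  have qF: "F (join p w0 origin) = q (front p (join p w0 origin))" using q(4) F(3) by (simp add: c0)
  obtain A E G where G: "smooth_domain_map p A (p + n) E G" "w0 \<in> A" "join p w0 origin \<in> E" "E \<subseteq> D" "A \<subseteq> W1"
    "\<And>w. w \<in> A \<Longrightarrow> front p (G w) = w"
    "\<And>x. x \<in> E \<Longrightarrow> front p x \<in> A \<and> (F x = q (front p x) \<longleftrightarrow> x = G (front p x))"
    by (rule parametrised_solution[OF F(1,2) b q(1) qW qF, unfolded c0]) (rule that)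
  have GD: "G w \<in> D" if "w \<in> A" for w using smooth_domain_map_mem[OF G(1) that] G(4) by blast
  have FG: "F (G w) = q w" if "w \<in> A" for w
    using G(7)[OF smooth_domain_map_mem[OF G(1) that]] G(6)[OF that] by simp
  have U: "n_domain n U" by (rule plots_n_domain[OF pN chart_plot(1)[OF \<phi>]])
  have A: "n_domain p A" by (rule smooth_domain_mapD(1)[OF G(1)])
  have "smooth_domain_map p A n (Rn n) (\<lambda>w. rear p (G w))"
    by (rule smooth_domain_map_comp[OF G(1) smooth_domain_map_rear[OF smooth_domain_mapD(2)[OF G(1)]]])
  then have sG: "smooth_domain_map p A n U (\<lambda>w. rear p (G w))"
    by (rule smooth_domain_map_restrict[OF _ A order_refl U]) (use FD GD in blast)
  define s where "s = (\<lambda>w\<in>A. \<phi> (rear p (G w)))"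
  have AW: "A \<subseteq> W" using G(5) q(3) by blast
  have "(p, A, \<lambda>w\<in>A. (restrict P A w, s w)) \<in> plots (prod_dspace M N)"
    unfolding plots_prod_iff s_def
    using plots_restrict[OF pM P A AW] plots_precomp[OF pN chart_plot(1)[OF \<phi>] sG] by blast
  moreover have "(\<lambda>w\<in>A. (restrict P A w, s w)) w0 = xy"
  proof -
    \<comment> \<open>The base point itself solves the equation, so uniqueness of the solution in
      \<open>E\<close> identifies it with \<open>G w0\<close>; this gives the lift its prescribed
      value.\<close>
    have "G w0 = join p w0 origin" using G(7)[OF G(3)] F(3) q(4) by (simp add: c0)
    then show ?thesis using G(2) chart_plot(3)[OF \<phi>] by (simp add: s_def xy'(1))
  qed
  moreover have "(\<lambda>(x, y). (x, f (x, y))) ((\<lambda>w\<in>A. (restrict P A w, s w)) w) = R w" if w: "w \<in> A" for w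
  proof -
    have "f (P w, \<phi> (rear p (G w))) = \<psi> (F (G w))" using FD[OF GD[OF w]] G(6)[OF w] by simp
    also have "\<dots> = Q w" using FG[OF w] q(5) G(5) w by auto
    finally show ?thesis using w AW by (auto simp: Re s_def)
  qed
  ultimately show "\<exists>V s. (p, V, s) \<in> plots (prod_dspace M N) \<and> w0 \<in> V \<and> V \<subseteq> W \<and> s w0 = xy \<and>
      (\<forall>r\<in>V. (\<lambda>(x, y). (x, f (x, y))) (s r) = R r)"
    using G(2) AW by blast
qed

text \<open>Two lifts have the same component in \<open>M\<close>, and their components in
  \<open>N\<close> are represented by maps \<open>u1\<close> and \<open>u2\<close> into the chart.
  Both graphs solve one and the same parametrised equation, whose solution is unique near the base
  point.\<close>

lemma track_lifts_unique:
  assumes M: "diffeological_space M" and N: "etale_manifold N" and L: "etale_manifold L"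
    and f: "dsmooth (prod_dspace M N) L f"
    and iso: "\<And>x y. x \<in> points M \<Longrightarrow> y \<in> points N \<Longrightarrow> tangent_iso N y L (f (x, y)) (tangent_map N L (\<lambda>y'. f (x, y')) y)"
  shows "lifts_unique (prod_dspace M N) (\<lambda>(x, y). (x, f (x, y)))"
  unfolding lifts_unique_def
proof (intro allI impI)
  note pM = diffeological_space_precomp_closed[OF M]
  note pN = diffeological_space_precomp_closed[OF etale_manifold_diffeological[OF N]]
  fix p W R1 R2 w0
  assume R1: "(p, W, R1) \<in> plots (prod_dspace M N)" and R2: "(p, W, R2) \<in> plots (prod_dspace M N)"
    and w0: "w0 \<in> W" and eq0: "R1 w0 = R2 w0"
    and eq: "\<forall>r\<in>W. (\<lambda>(x, y). (x, f (x, y))) (R1 r) = (\<lambda>(x, y). (x, f (x, y))) (R2 r)"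
  obtain P y1 where P: "(p, W, P) \<in> plots M" and y1: "(p, W, y1) \<in> plots N" and R1e: "R1 = (\<lambda>r\<in>W. (P r, y1 r))"
    using R1 unfolding plots_prod_iff by (elim exE conjE) (rule that)
  obtain P2 y2 where y2: "(p, W, y2) \<in> plots N" and R2e: "R2 = (\<lambda>r\<in>W. (P2 r, y2 r))"
    using R2 unfolding plots_prod_iff by (elim exE conjE) (rule that)
  have P2: "P2 r = P r" and feq: "f (P r, y1 r) = f (P r, y2 r)" if "r \<in> W" for r
    using bspec[OF eq that] that by (auto simp: R1e R2e)
  define y0 where "y0 = y1 w0"
  have y0: "y0 \<in> points N" "y2 w0 = y0" "P w0 \<in> points M"
    using plots_mem[OF pN y1 w0] eq0 w0 plots_mem[OF pM P w0] by (auto simp: y0_def R1e R2e)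
  have w0R: "w0 \<in> Rn p" by (rule n_domain_RnD[OF plots_n_domain[OF pM P] w0])
  obtain n U \<phi> l V \<psi> D F b where \<phi>: "chart n N y0 U \<phi>" and \<psi>: "chart l L (f (P w0, y0)) V \<psi>"
    and F: "smooth_domain_map (p + n) D l V F" "join p w0 origin \<in> D" "F (join p w0 origin) = origin"
    and FD: "\<And>x. x \<in> D \<Longrightarrow> front p x \<in> W \<and> rear p x \<in> U \<and> f (P (front p x), \<phi> (rear p x)) = \<psi> (F x)"
    and b: "inverse_matrix n l b (\<lambda>c i. partial (p + i) (\<lambda>x. F x c) (join p w0 origin))"
    by (rule track_in_charts[OF M N L f y0(1) P w0 iso[OF y0(3,1)]]) (rule that)
  have D: "n_domain (p + n) D" by (rule smooth_domain_mapD(1)[OF F(1)])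
  have c0: "front p (join p w0 origin) = w0" by (rule front_join[OF w0R])
  have graph: "\<exists>W1 u. smooth_domain_map p W1 n U u \<and> smooth_domain_map p W1 (p + n) D (\<lambda>w. join p w (u w)) \<and>
      w0 \<in> W1 \<and> W1 \<subseteq> W \<and> u w0 = origin \<and> (\<forall>w\<in>W1. y w = \<phi> (u w))"
    if y: "(p, W, y) \<in> plots N" "y w0 = y0" for y
  proof -
    obtain W1 u where u: "smooth_domain_map p W1 n U u" "w0 \<in> W1" "W1 \<subseteq> W" "u w0 = origin"
      "\<And>r. r \<in> W1 \<Longrightarrow> y r = \<phi> (u r)"
      by (rule chart_lift[OF \<phi> y(1) w0 y(2)]) (rule that)
    have W1: "n_domain p W1" by (rule smooth_domain_mapD(1)[OF u(1)])
    have j: "smooth_domain_map p W1 (p + n) (Rn (p + n)) (\<lambda>w. join p w (u w))"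
      by (rule smooth_domain_map_join[OF smooth_domain_map_id[OF W1 W1 order_refl] u(1)])
    let ?W = "{w \<in> W1. join p w (u w) \<in> D}"
    have W: "n_domain p ?W" by (rule smooth_preimage[OF j D])
    have "smooth_domain_map p ?W n U u"
      by (rule smooth_domain_map_restrict[OF u(1) W _ smooth_domain_mapD(2)[OF u(1)]])
        (auto dest: smooth_domain_map_mem[OF u(1)])
    moreover have "smooth_domain_map p ?W (p + n) D (\<lambda>w. join p w (u w))"
      by (rule smooth_domain_map_restrict[OF j W _ D]) auto
    moreover have "w0 \<in> ?W" using u(2,4) F(2) by simp
    moreover have "?W \<subseteq> W" using u(3) by blast
    moreover have "\<forall>w\<in>?W. y w = \<phi> (u w)" using u(5) by simp
    ultimately show ?thesis using u(4) by blast
  qed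
  obtain W1 u1 where u1: "smooth_domain_map p W1 n U u1" "smooth_domain_map p W1 (p + n) D (\<lambda>w. join p w (u1 w))"
     "w0 \<in> W1" "W1 \<subseteq> W" "u1 w0 = origin" "\<forall>w\<in>W1. y1 w = \<phi> (u1 w)"
    using graph[OF y1 y0_def[symmetric]] by (elim exE conjE) (rule that)
  obtain W2 u2 where u2: "smooth_domain_map p W2 n U u2" "smooth_domain_map p W2 (p + n) D (\<lambda>w. join p w (u2 w))"
     "w0 \<in> W2" "W2 \<subseteq> W" "u2 w0 = origin" "\<forall>w\<in>W2. y2 w = \<phi> (u2 w)"
    using graph[OF y2 y0(2)] by (elim exE conjE) (rule that)
  let ?W = "W1 \<inter> W2"
  have Wd: "n_domain p ?W" by (intro n_domain_Int smooth_domain_mapD(1)[OF u1(1)] smooth_domain_mapD(1)[OF u2(1)])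
  have j1: "smooth_domain_map p ?W (p + n) D (\<lambda>w. join p w (u1 w))"
    by (rule smooth_domain_map_restrict[OF u1(2) Wd _ D]) (auto dest: smooth_domain_map_mem[OF u1(2)])
  have j2: "smooth_domain_map p ?W (p + n) D (\<lambda>w. join p w (u2 w))"
    by (rule smooth_domain_map_restrict[OF u2(2) Wd _ D]) (auto dest: smooth_domain_map_mem[OF u2(2)])
  have lift: "\<psi> (F (join p w (u1 w))) = f (P w, y1 w)" "\<psi> (F (join p w (u2 w))) = f (P w, y2 w)" if w: "w \<in> ?W" for w
  proof -
    have wR: "w \<in> Rn p" by (rule n_domain_RnD[OF Wd w])
    show "\<psi> (F (join p w (u1 w))) = f (P w, y1 w)"
      using FD[OF smooth_domain_map_mem[OF j1 w]] u1(6) w by (simp add: front_join[OF wR])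
    show "\<psi> (F (join p w (u2 w))) = f (P w, y2 w)"
      using FD[OF smooth_domain_map_mem[OF j2 w]] u2(6) w by (simp add: front_join[OF wR])
  qed
  have lift_eq: "\<psi> (F (join p r (u1 r))) = \<psi> (F (join p r (u2 r)))" if "r \<in> ?W" for r
    using lift[OF that] feq that u1(4) by auto
  have w0W: "w0 \<in> ?W" and F1: "F (join p w0 (u1 w0)) = origin" and F2: "F (join p w0 (u2 w0)) = origin"
    using u1(3,5) u2(3,5) F(3) by simp_all
  \<comment> \<open>So far only the values under \<open>\<psi>\<close> agree. Unique lifting through
    \<open>\<psi>\<close> turns this into equality of the values of \<open>F\<close> near
    \<open>w0\<close>, where both start at the origin.\<close>
  obtain W3 where W3: "n_domain p W3" "w0 \<in> W3" "W3 \<subseteq> ?W"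
    "\<And>r. r \<in> W3 \<Longrightarrow> F (join p r (u1 r)) = F (join p r (u2 r))"
    by (rule chart_lift_unique[OF \<psi> smooth_domain_map_comp[OF j1 F(1)] smooth_domain_map_comp[OF j2 F(1)]
          w0W F1 F2 lift_eq], assumption) (rule that)
  \<comment> \<open>The right-hand side is taken to be \<open>F\<close> along the first graph, so
    that \<open>u1\<close> is a solution by construction, and \<open>u2\<close> is one by the
    equality on \<open>W3\<close>.\<close>
  have q: "smooth_domain_map p W3 l V (\<lambda>w. F (join p w (u1 w)))"
    by (rule smooth_domain_map_restrict[OF smooth_domain_map_comp[OF j1 F(1)] W3(1,3) smooth_domain_mapD(2)[OF F(1)]])
      (use W3(3) smooth_domain_map_mem[OF smooth_domain_map_comp[OF j1 F(1)]] in blast)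
  have qW: "front p (join p w0 origin) \<in> W3" using W3(2) by (simp add: c0)
  have qF: "F (join p w0 origin) = F (join p (front p (join p w0 origin)) (u1 (front p (join p w0 origin))))"
    by (simp add: c0 u1(5))
  obtain A E G where G: "smooth_domain_map p A (p + n) E G" "w0 \<in> A" "join p w0 origin \<in> E" "E \<subseteq> D" "A \<subseteq> W3"
    "\<And>w. w \<in> A \<Longrightarrow> front p (G w) = w"
    "\<And>x. x \<in> E \<Longrightarrow> front p x \<in> A \<and> (F x = F (join p (front p x) (u1 (front p x))) \<longleftrightarrow> x = G (front p x))"
    by (rule parametrised_solution[OF F(1,2) b q qW qF, unfolded c0]) (rule that)
  define W4 where "W4 = W3 \<inter> ({w \<in> ?W. join p w (u1 w) \<in> E} \<inter> {w \<in> ?W. join p w (u2 w) \<in> E})"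
  have "n_domain p W4"
    unfolding W4_def
    by (intro n_domain_Int W3(1) smooth_preimage[OF j1] smooth_preimage[OF j2] smooth_domain_mapD(2)[OF G(1)])
  moreover have "w0 \<in> W4" using W3(2) u1(3,5) u2(3,5) G(3) by (simp add: W4_def)
  moreover have "W4 \<subseteq> W" using u1(4) by (auto simp: W4_def)
  moreover have "R1 r = R2 r" if r: "r \<in> W4" for r
  proof -
    have rW: "r \<in> ?W" "r \<in> W3" "join p r (u1 r) \<in> E" "join p r (u2 r) \<in> E" using r by (auto simp: W4_def)
    have rR: "r \<in> Rn p" by (rule n_domain_RnD[OF Wd rW(1)])
    have "join p r (u1 r) = G r" using G(7)[OF rW(3)] by (simp add: front_join[OF rR])
    moreover have "join p r (u2 r) = G r" using G(7)[OF rW(4)] W3(4)[OF rW(2)] by (simp add: front_join[OF rR])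
    ultimately have "u1 r = u2 r" using rear_join by metis
    then have "y1 r = y2 r" using u1(6) u2(6) rW(1) by simp
    moreover have "r \<in> W" using rW(1) u1(4) by blast
    ultimately show ?thesis using P2 by (simp add: R1e R2e)
  qed
  ultimately show "\<exists>V. n_domain p V \<and> w0 \<in> V \<and> V \<subseteq> W \<and> (\<forall>r\<in>V. R1 r = R2 r)" by blast
qed

section \<open>From the etale track map to isomorphisms of tangent spaces\<close>

lemma differential_inverse:
  assumes F: "smooth_domain_map m W n U F" and G: "smooth_domain_map n U' m W' G"
    and A: "n_domain m A" "x \<in> A" "A \<subseteq> W" "\<And>y. y \<in> A \<Longrightarrow> F y \<in> U' \<and> G (F y) = y" and v: "v \<in> Rn m"
  shows "differential n G (F x) (differential m F x v) = v"
proof -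
  have F': "smooth_domain_map m A n U' F"
    by (rule smooth_domain_map_restrict[OF F A(1,3) smooth_domain_mapD(1)[OF G]]) (use A(4) in blast)
  have "differential m (\<lambda>y. G (F y)) x v = differential m (\<lambda>y. y) x v"
    using differential_cong[OF A(1,2), of "\<lambda>y. G (F y)" "\<lambda>y. y"] A(4) by simp
  then show ?thesis using differential_comp[OF F' G A(2), of v] differential_id[OF v] by simp
qed

text \<open>The lift of \<open>(x0, \<psi>)\<close> is represented in the chart
  \<open>\<phi>\<close> by \<open>k\<close>. Both composites of \<open>h\<close> and
  \<open>k\<close> are the identity near the origin, so their differentials there are mutually
  inverse.\<close>

lemma track_etale_imp_tangent_iso:
  assumes M: "diffeological_space M" and N: "etale_manifold N" and L: "etale_manifold L"
    and f: "dsmooth (prod_dspace M N) L f"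
    and ex: "lifts_exist (prod_dspace M N) (prod_dspace M L) (\<lambda>(x, y). (x, f (x, y)))"
    and un: "lifts_unique (prod_dspace M N) (\<lambda>(x, y). (x, f (x, y)))"
    and x0: "x0 \<in> points M" and y0: "y0 \<in> points N"
  shows "tangent_iso N y0 L (f (x0, y0)) (tangent_map N L (\<lambda>y. f (x0, y)) y0)"
proof -
  note pM = diffeological_space_precomp_closed[OF M]
  note pN = diffeological_space_precomp_closed[OF etale_manifold_diffeological[OF N]]
  note pL = diffeological_space_precomp_closed[OF etale_manifold_diffeological[OF L]]
  define g where "g y = f (x0, y)" for y
  have g: "dsmooth N L g" unfolding g_def by (rule dsmooth_section[OF M f x0 pN])
  obtain n U \<phi> where \<phi>: "chart n N y0 U \<phi>" by (rule chart_exists[OF N y0])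
  obtain l V \<psi> where \<psi>: "chart l L (g y0) V \<psi>" by (rule chart_exists[OF L dsmooth_mem[OF g y0]])
  note \<phi>p = chart_plot[OF \<phi>] and \<psi>p = chart_plot[OF \<psi>]
  have U: "n_domain n U" by (rule plots_n_domain[OF pN \<phi>p(1)])
  have V: "n_domain l V" by (rule plots_n_domain[OF pL \<psi>p(1)])
  have g0: "(\<lambda>u\<in>U. g (\<phi> u)) origin = g y0" by (simp add: \<phi>p)
  obtain U' h where h: "smooth_domain_map n U' l V h" "origin \<in> U'" "U' \<subseteq> U" "h origin = origin"
    "\<And>u. u \<in> U' \<Longrightarrow> (\<lambda>u\<in>U. g (\<phi> u)) u = \<psi> (h u)"
    by (rule chart_lift[OF \<psi> dsmooth_plots[OF g \<phi>p(1)] \<phi>p(2) g0]) (rule that)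
  have h5: "g (\<phi> u) = \<psi> (h u)" if "u \<in> U'" for u using h(5)[OF that] subsetD[OF h(3) that] by simp
  have U': "n_domain n U'" by (rule smooth_domain_mapD(1)[OF h(1)])
  \<comment> \<open>A lift of this plot through the track map has constant first component
    \<open>x0\<close>, so its second component \<open>s\<close> satisfies
    \<open>g (s v) = \<psi> v\<close>.\<close>
  have S0: "(l, V, \<lambda>v\<in>V. ((\<lambda>v\<in>V. x0) v, \<psi> v)) \<in> plots (prod_dspace M L)"
    unfolding plots_prod_iff using const_plots[OF M x0 V] \<psi>p(1) by blast
  have xy0: "(x0, y0) \<in> points (prod_dspace M N)" using x0 y0 by simp
  have "(\<lambda>(x, y). (x, f (x, y))) (x0, y0) = (\<lambda>v\<in>V. ((\<lambda>v\<in>V. x0) v, \<psi> v)) origin"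
    using \<psi>p by (simp add: g_def)
  from ex[unfolded lifts_exist_def, rule_format, OF S0 \<psi>p(2) xy0 this]
  obtain V1 S where S: "(l, V1, S) \<in> plots (prod_dspace M N)" "origin \<in> V1" "V1 \<subseteq> V" "S origin = (x0, y0)"
    "\<forall>v\<in>V1. (\<lambda>(x, y). (x, f (x, y))) (S v) = (\<lambda>v\<in>V. ((\<lambda>v\<in>V. x0) v, \<psi> v)) v"
    by (elim exE conjE) (rule that)
  obtain a s where a: "(l, V1, a) \<in> plots M" and s: "(l, V1, s) \<in> plots N" and Se: "S = (\<lambda>v\<in>V1. (a v, s v))"
    using S(1) unfolding plots_prod_iff by (elim exE conjE) (rule that)
  have V1: "n_domain l V1" by (rule plots_n_domain[OF pN s])
  have av: "a v = x0" and gs: "g (s v) = \<psi> v" if "v \<in> V1" for v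
    using bspec[OF S(5) that] S(3) that by (auto simp: Se g_def)
  have s0: "s origin = y0" using S(2,4) by (simp add: Se)
  obtain V2 k where k: "smooth_domain_map l V2 n U k" "origin \<in> V2" "V2 \<subseteq> V1" "k origin = origin"
    "\<And>v. v \<in> V2 \<Longrightarrow> s v = \<phi> (k v)"
    by (rule chart_lift[OF \<phi> s S(2) s0]) (rule that)
  have V2: "n_domain l V2" by (rule smooth_domain_mapD(1)[OF k(1)])

  \<comment> \<open>\<open>h \<circ> k\<close> and the identity have the same composite with
    \<open>\<psi>\<close> and fix the origin, so unique lifting through \<open>\<psi>\<close> gives
    \<open>h (k v) = v\<close> near it.\<close>
  let ?V3 = "{v \<in> V2. k v \<in> U'}"
  have V3: "n_domain l ?V3" by (rule smooth_preimage[OF k(1) U'])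
  have k3: "smooth_domain_map l ?V3 n U' k" by (rule smooth_domain_map_restrict[OF k(1) V3 _ U']) auto
  have id3: "smooth_domain_map l ?V3 l V (\<lambda>v. v)"
    using k(3) S(3) by (intro smooth_domain_map_id V3 V) auto
  have o3: "origin \<in> ?V3" using k(2,4) h(2) by simp
  have hk0: "h (k origin) = origin" by (simp add: k(4) h(4))
  have eq3: "\<psi> (h (k v)) = \<psi> v" if "v \<in> ?V3" for v
  proof -
    have v: "v \<in> V2" "k v \<in> U'" "v \<in> V1" using that k(3) by auto
    show ?thesis using h5[OF v(2)] k(5)[OF v(1)] gs[OF v(3)] by simp
  qed
  obtain V4 where V4: "n_domain l V4" "origin \<in> V4" "V4 \<subseteq> ?V3" "\<And>v. v \<in> V4 \<Longrightarrow> h (k v) = v"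
    by (rule chart_lift_unique[OF \<psi> smooth_domain_map_comp[OF k3 h(1)] id3 o3 hk0 refl eq3], assumption) (rule that)

  let ?U3 = "{u \<in> U'. h u \<in> V2}"
  have U3: "n_domain n ?U3" by (rule smooth_preimage[OF h(1) V2])
  have h3: "smooth_domain_map n ?U3 l V2 h" by (rule smooth_domain_map_restrict[OF h(1) U3 _ V2]) auto
  have h3': "smooth_domain_map n ?U3 l V1 h" by (rule smooth_domain_map_restrict[OF h(1) U3 _ V1]) (use k(3) in auto)
  have U3U: "?U3 \<subseteq> U" using h(3) by blast
  have o3: "origin \<in> ?U3" using h(2,4) k(2) by simp
  have c3: "(n, ?U3, \<lambda>u\<in>?U3. x0) \<in> plots M" by (rule const_plots[OF M x0 U3])
  \<comment> \<open>For \<open>k \<circ> h\<close> uniqueness is used twice. \<open>R1\<close> and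
    \<open>R2\<close> lift the plot \<open>u \<mapsto> (x0, g (\<phi> u))\<close> through the track
    map, so \<open>s (h u) = \<phi> u\<close> near the origin; as \<open>s\<close> is represented by
    \<open>k\<close>, unique lifting through \<open>\<phi>\<close> then gives
    \<open>k (h u) = u\<close>.\<close>
  define R1 where "R1 = (\<lambda>u\<in>?U3. ((\<lambda>u\<in>?U3. x0) u, restrict \<phi> ?U3 u))"
  define R2 where "R2 = (\<lambda>u\<in>?U3. ((\<lambda>u\<in>?U3. x0) u, (\<lambda>u\<in>?U3. s (h u)) u))"
  have pR1: "(n, ?U3, R1) \<in> plots (prod_dspace M N)"
    unfolding plots_prod_iff R1_def using c3 plots_restrict[OF pN \<phi>p(1) U3 U3U] by blast
  have pR2: "(n, ?U3, R2) \<in> plots (prod_dspace M N)"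
    unfolding plots_prod_iff R2_def using c3 plots_precomp[OF pN s h3'] by blast
  have R0: "R1 origin = R2 origin"
    using o3 \<phi>p(3) s0 h(4) by (simp add: R1_def R2_def)
  have Req: "\<forall>u\<in>?U3. (\<lambda>(x, y). (x, f (x, y))) (R1 u) = (\<lambda>(x, y). (x, f (x, y))) (R2 u)"
  proof
    fix u assume u: "u \<in> ?U3"
    then have u': "u \<in> U'" "h u \<in> V1" using k(3) by auto
    show "(\<lambda>(x, y). (x, f (x, y))) (R1 u) = (\<lambda>(x, y). (x, f (x, y))) (R2 u)"
      using u h5[OF u'(1)] gs[OF u'(2)] by (simp add: R1_def R2_def g_def)
  qed
  have "\<exists>V. n_domain n V \<and> origin \<in> V \<and> V \<subseteq> ?U3 \<and> (\<forall>u\<in>V. R1 u = R2 u)"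
    by (rule un[unfolded lifts_unique_def, rule_format, OF pR1 pR2 o3 R0]) (rule bspec[OF Req])
  then obtain U4 where U4: "n_domain n U4" "origin \<in> U4" "U4 \<subseteq> ?U3" "\<forall>u\<in>U4. R1 u = R2 u"
    by (elim exE conjE) (rule that)
  have h4: "smooth_domain_map n U4 l V2 h"
    by (rule smooth_domain_map_restrict[OF h3 U4(1,3) V2]) (use U4(3) in blast)
  have id4: "smooth_domain_map n U4 n U (\<lambda>u. u)"
    using U4(3) U3U by (intro smooth_domain_map_id U4(1) U) blast
  have eq4: "\<phi> (k (h u)) = \<phi> u" if "u \<in> U4" for u
  proof -
    have u: "u \<in> ?U3" using U4(3) that by blast
    then have "s (h u) = \<phi> u" using bspec[OF U4(4) that] by (simp add: R1_def R2_def)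
    then show ?thesis using k(5)[of "h u"] u by simp
  qed
  have kh0: "k (h origin) = origin" by (simp add: k(4) h(4))
  obtain U5 where U5: "n_domain n U5" "origin \<in> U5" "U5 \<subseteq> U4" "\<And>u. u \<in> U5 \<Longrightarrow> k (h u) = u"
    by (rule chart_lift_unique[OF \<phi> smooth_domain_map_comp[OF h4 k(1)] id4 U4(2) kh0 refl eq4], assumption) (rule that)

  define dh where "dh = differential n h origin"
  define dk where "dk = differential l k origin"
  have "bij_betw dh (Rn n) (Rn l)"
  proof (rule bij_betw_byWitness[where f' = dk])
    have U5': "U5 \<subseteq> U'" "\<And>u. u \<in> U5 \<Longrightarrow> h u \<in> V2" using U5(3) U4(3) by auto
    show "\<forall>v\<in>Rn n. dk (dh v) = v"
      using differential_inverse[OF h(1) k(1) U5(1,2) U5'(1), unfolded h(4)] U5(4) U5'(2)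
      by (simp add: dh_def dk_def)
    have V4': "V4 \<subseteq> V2" "\<And>v. v \<in> V4 \<Longrightarrow> k v \<in> U'" using V4(3) by auto
    show "\<forall>v\<in>Rn l. dh (dk v) = v"
      using differential_inverse[OF k(1) h(1) V4(1,2) V4'(1), unfolded k(4)] V4(4) V4'(2)
      by (simp add: dh_def dk_def)
    show "dh ` Rn n \<subseteq> Rn l" using differential_Rn[OF h(1,2)] by (auto simp: dh_def)
    show "dk ` Rn l \<subseteq> Rn n" using differential_Rn[OF k(1,2)] by (auto simp: dk_def)
  qed
  then have "tangent_iso N y0 L (g y0) (tangent_map N L g y0)"
    using tangent_iso_chart_iff[OF pN pL g \<phi> \<psi> h(1-4) h5] by (simp add: dh_def)
  then show ?thesis by (simp add: g_def[abs_def])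
qed

theorem theorem6p16:
  fixes M :: "'a dspace" and N :: "'b dspace" and L :: "'c dspace"
    and f :: "'a \<times> 'b \<Rightarrow> 'c"
  assumes "etale_manifold M" and "etale_manifold N" and "etale_manifold L"
    and "dsmooth (prod_dspace M N) L f"
  shows "(\<forall>x\<in>points M. \<forall>y\<in>points N.
            tangent_iso N y L (f (x, y)) (tangent_map N L (\<lambda>y'. f (x, y')) y))
         \<longleftrightarrow> diffeological_etale (prod_dspace M N) (prod_dspace M L) (\<lambda>(x, y). (x, f (x, y)))"
proof -
  note M = etale_manifold_diffeological[OF assms(1)]
  note pM = diffeological_space_precomp_closed[OF M]
  note pN = diffeological_space_precomp_closed[OF etale_manifold_diffeological[OF assms(2)]]
  note pL = diffeological_space_precomp_closed[OF etale_manifold_diffeological[OF assms(3)]]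
  note pMN = precomp_closed_prod[OF pM pN] and pML = precomp_closed_prod[OF pM pL]
  show ?thesis
  proof
    assume iso: "\<forall>x\<in>points M. \<forall>y\<in>points N. tangent_iso N y L (f (x, y)) (tangent_map N L (\<lambda>y'. f (x, y')) y)"
    show "diffeological_etale (prod_dspace M N) (prod_dspace M L) (\<lambda>(x, y). (x, f (x, y)))"
      by (rule lifts_imp_diffeological_etale[OF pMN pML dsmooth_track[OF pM pN assms(4)]
            track_lifts_exist[OF M assms(2-4)] track_lifts_unique[OF M assms(2-4)]]) (use iso in blast)+
  next
    assume "diffeological_etale (prod_dspace M N) (prod_dspace M L) (\<lambda>(x, y). (x, f (x, y)))"
    then show "\<forall>x\<in>points M. \<forall>y\<in>points N. tangent_iso N y L (f (x, y)) (tangent_map N L (\<lambda>y'. f (x, y')) y)"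
      using track_etale_imp_tangent_iso[OF M assms(2-4)] etale_lifts_exist[OF pMN pML]
        etale_lifts_unique[OF pMN] by blast
  qed
qed

end
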